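(* Let $\mathcal V=(V,\eta,\xi)$ be a left cyclic polarized arrangement of $n$ hyperplanes in $(k+1)$-space ($k\ge0$), let $\hat{\mathcal V}$ be a left cyclic polarized arrangement of $n+1$ hyperplanes in $(k+1)$-space whose first deletion is $\mathcal V$, let $\mathcal V'=(V',\eta',\xi')$ be the first restriction of $\hat{\mathcal V}$, and let $\mathcal V''=(V',-\eta',-\xi')$, which is a left cyclic polarized arrangement of $n$ hyperplanes in $k$-space. With the bimodules $\mathbf F_k$, $\mathbf{Rest}_1$, $\mathbf{Del}_1$ and the identifications $\tilde B(\mathcal V)\cong\mathcal B_l(n,k+1)$, $\tilde B(\hat{\mathcal V})\cong\mathcal B_l(n+1,k+1)$, $\tilde B(\mathcal V'')\cong\mathcal B_l(n,k)$ described in the context, there is an isomorphism of $(\mathcal B_l(n,k),\mathcal B_l(n,k+1))$-bimodules $$\mathbf F_k\cong\mathbf{Rest}_1\otimes_{\mathcal B_l(n+1,k+1)}\mathbf{Del}_1.$$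
   Context: **Arrangements.** A polarized arrangement of $n$ hyperplanes in $k$-space is $(V,\eta,\xi)$: $V\subset\mathbb R^n$ a $k$-dimensional subspace, $\eta\in\mathbb R^n/V$ with every representative having at least $n-k$ nonzero entries, $\xi\in V^*=(\mathbb R^n)^*/V^\perp$ with every representative having at least $k$ nonzero entries. In the affine space $V+\eta\subset\mathbb R^n$ put $H_i=\{x:x_i=0\}$, $H_S=\bigcap_{i\in S}H_i$, $\Delta_\alpha=\{x:\alpha(i)x_i\ge0\ \forall i\}$ for $\alpha\in\{+,-\}^n$. $\alpha$ is feasible if $\Delta_\alpha\neq\emptyset$, bounded if an affine function on $V+\eta$ with linear part $\xi$ is bounded above on $\Delta_\alpha$; $\mathcal P$ is the set of bounded feasible $\alpha$. It is left cyclic if $V+\langle\eta\rangle\in\mathrm{Gr}^{>0}_{k+1,n}$, $\{(\xi(v),v):v\in V\}\in\mathrm{Gr}^{>0}_{k,n+1}$, and the first coordinate of the orthogonal projection of a representative of $\eta$ onto $V^\perp$ is positive; $\mathrm{Gr}^{>0}$ denotes subspaces with all Plücker coordinates nonzero of the same sign. For left cyclic arrangements in $k$-space, $\mathcal P$ is the set of $\alpha$ such that $+\alpha$ has exactly $k$ sign changes. **Deletion, restriction.** Let $\pi:\mathbb R^{n+1}\to\mathbb R^n$ forget the first coordinate and $\iota:\mathbb R^n\to\mathbb R^{n+1}$ be the inclusion of the first coordinate hyperplane. For $\hat{\mathcal V}=(\hat V,\hat\eta,\hat\xi)$ with $n+1$ hyperplanes, its first deletion is $(\pi(\hat V),\pi(\hat\eta),\hat\xi\circ(\pi|_{\hat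 V})^{-1})$ and its first restriction is $(\iota^{-1}(\hat V),\iota^{-1}(\hat\eta),\hat\xi|_{\iota^{-1}(\hat V)})$. **Algebras.** $\tilde B(\mathcal V)=\bigoplus_{\alpha,\beta\in\mathcal P}\tilde R_{\alpha\beta}$, $\tilde R_{\alpha\beta}=\mathbb Z[u_1,\dots,u_n]/(u_S:\Delta_\alpha\cap\Delta_\beta\cap H_S=\emptyset)$, $u_S=\prod_{i\in S}u_i$, $f_{\alpha,\beta}$ the class of $1$, with $\mathbb Z[u]$-bilinear product $f_{\alpha,\beta}f_{\beta,\gamma}=u_{S(\alpha\beta\gamma)}f_{\alpha,\gamma}$, $S(\alpha\beta\gamma)=\{i:\alpha(i)=\gamma(i)\ne\beta(i)\}$ (other products $0$); put $e_\alpha=f_{\alpha,\alpha}$, and set $f_{\alpha,\beta}=0$ if $\alpha$ or $\beta$ is infeasible. $\mathcal B(n,k)$ is the path algebra over $\mathbb Z$ (paths composed left to right) of the quiver with vertices the $k$-element subsets $\mathbf x\subset\{0,\dots,n\}$ and arrows, for $1\le i\le n$, $R_i:\mathbf x\to\mathbf y$, $L_i:\mathbf y\to\mathbf x$ when $\mathbf x\cap\{i-1,i\}=\{i-1\}$, $\mathbf y=(\mathbf x\setminus\{i-1\})\cup\{i\}$, and $U_i:\mathbf x\to\mathbf x$, modulo $R_iU_j=U_jR_i$, $L_iU_j=U_jL_i$, $U_iU_j=U_jU_i$; $R_iL_i=U_i=L_iR_i$; $R_iR_j=R_jR_i$, $L_iL_j=L_jL_i$, $L_iR_j=R_jL_i$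 ($|i-j|>1$); $R_{i-1}R_i=0=L_iL_{i-1}$; $U_i\mathbf I_{\mathbf x}=0$ if $\mathbf x\cap\{i-1,i\}=\emptyset$ ($\mathbf I_{\mathbf x}$ the trivial path). $\mathcal B_l(n,k)$ is the idempotent truncation $\bigoplus\mathbf I_{\mathbf x}\mathcal B(n,k)\mathbf I_{\mathbf x'}$ to $k$-subsets $\mathbf x,\mathbf x'$ of $\{0,\dots,n-1\}$. **Identifications.** For a left cyclic arrangement of $n$ hyperplanes in $k$-space, $\mathcal B_l(n,k)\cong\tilde B$ by $\mathbf I_{\mathbf x}\mapsto e_{\alpha_{\mathbf x}}$, arrows $R_i,L_i:\mathbf x\to\mathbf y$ to $f_{\alpha_{\mathbf x},\alpha_{\mathbf y}}$, $U_i\mathbf I_{\mathbf x}\mapsto u_ie_{\alpha_{\mathbf x}}$, where $\alpha_{\mathbf x}\in\mathcal P$ is determined by $\mathbf x=\{i\in\{0,\dots,n-1\}:\alpha_{\mathbf x}(i)\ne\alpha_{\mathbf x}(i+1)\}$, $\alpha_{\mathbf x}(0)=+$. This is applied to $\mathcal V$, $\hat{\mathcal V}$ and $\mathcal V''$. **Bimodules.** A (not necessarily unital) ring homomorphism $\varphi:A\to B$ gives the $(B,A)$-bimodule $B\varphi(1_A)$, with $A$ acting on the right through $\varphi$. - $\mathbf{Del}_1$ is the bimodule of the homomorphism $\tilde B(\mathcal V)\to\tilde B(\hat{\mathcal V})$, $f_{\alpha,\beta}\mapsto f_{+\alpha,+\beta}$ ($+\alpha$ is $\alpha$ with a plus prepended),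 $u_j\mapsto u_{j+1}$. - $\mathbf{Rest}_1$ is the bimodule of the composite $\tilde B(\hat{\mathcal V})\to\tilde B(\mathcal V')\to\tilde B(\mathcal V'')$, where the first map sends $f_{+\alpha,+\beta}\mapsto f_{\alpha,\beta}$, sends $f_{\hat\alpha,\hat\beta}\mapsto0$ if $\hat\alpha$ or $\hat\beta$ begins with a minus, and sends $u_1\mapsto0$, $u_j\mapsto u_{j-1}$ for $j>1$; the second is the sign-change isomorphism $f_{\alpha,\beta}\mapsto f_{-\alpha,-\beta}$, $u_j\mapsto u_j$ ($-\alpha$ is $\alpha$ with all signs reversed). - $\mathbf F_k$ is the bimodule of the ring homomorphism $\mathcal B_l(n,k+1)\to\mathcal B_l(n,k)$ that sends $\mathbf I_{\mathbf x}$ to $\mathbf I_{\mathbf x\setminus\{0\}}$ if $0\in\mathbf x$ and to $0$ otherwise; sends an arrow $R_i$ or $L_i$ from $\mathbf x$ to $\mathbf y$ to the arrow with the same label from $\mathbf x\setminus\{0\}$ to $\mathbf y\setminus\{0\}$ if $0\in\mathbf x\cap\mathbf y$ and to $0$ otherwise; and sends $U_i\mathbf I_{\mathbf x}$ to $U_i\mathbf I_{\mathbf x\setminus\{0\}}$ if $0\in\mathbf x$ and to $0$ otherwise. Thus $\mathbf F_k=\mathcal B_l(n,k)\cdot\sum_{0\notin\mathbf x}\mathbf I_{\mathbf x}$ as a left module. *)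

theory Defs
  imports
    "HOL-Analysis.Finite_Function_Topology"
    "HOL-Algebra.QuotRing"
    "HOL-Algebra.Generated_Groups"
    "HOL-Algebra.Free_Abelian_Groups"
    "Jordan_Normal_Form.Determinant"
begin

text \<open>
  Coordinates are numbered from 1, so a vector of real n-space is a finitely supported
  \<^typ>\<open>nat \<Rightarrow>\<^sub>0 real\<close> with support in \<open>{1..n}\<close>; for such an \<open>x\<close>,
  \<open>card (keys x)\<close> is its number of nonzero entries.
\<close>

type_synonym rvec = "nat \<Rightarrow>\<^sub>0 real"

definition Rn :: "nat \<Rightarrow> rvec set" where
  "Rn n = {x. Poly_Mapping.keys x \<subseteq> {1..n}}"

definition dotp :: "rvec \<Rightarrow> rvec \<Rightarrow> real" where
  "dotp x y = (\<Sum>i\<in>Poly_Mapping.keys x. Poly_Mapping.lookup x i * Poly_Mapping.lookup y i)"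

text \<open>\<open>vcons c x = (c, x\<^sub>1, x\<^sub>2, \<dots>)\<close>, and \<open>vtail (x\<^sub>1, x\<^sub>2, \<dots>) = (x\<^sub>2, x\<^sub>3, \<dots>)\<close>.\<close>

lift_definition vcons :: "real \<Rightarrow> rvec \<Rightarrow> rvec" is
  "\<lambda>c x i. if i = 0 then 0 else if i = 1 then c else x (i - 1)"
proof -
  fix c and x :: "nat \<Rightarrow> real" assume f: "finite {i. x i \<noteq> 0}"
  have "{i. (if i = 0 then 0 else if i = 1 then c else x (i - 1)) \<noteq> 0}
      \<subseteq> insert 1 (Suc ` {i. x i \<noteq> 0})"
    by (auto simp: image_iff gr0_conv_Suc split: if_splits)
  then show "finite {i. (if i = 0 then 0 else if i = 1 then c else x (i - 1)) \<noteq> 0}"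
    by (rule finite_subset) (simp add: f)
qed

lift_definition vtail :: "rvec \<Rightarrow> rvec" is
  "\<lambda>x i. if i = 0 then 0 else x (i + 1)"
proof -
  fix x :: "nat \<Rightarrow> real" assume f: "finite {i. x i \<noteq> 0}"
  have "{i. (if i = 0 then 0 else x (i + 1)) \<noteq> 0} \<subseteq> (\<lambda>j. j - 1) ` {i. x i \<noteq> 0}"
    by (force simp: image_iff split: if_splits)
  then show "finite {i. (if i = 0 then 0 else x (i + 1)) \<noteq> 0}"
    by (rule finite_subset) (simp add: f)
qed

text \<open>
  \<open>vcoset\<close> is the element \<open>\<eta>\<close> of \<open>\<real>\<^sup>n / V\<close>, as a coset; as a set it is the affine space
  \<open>V + \<eta>\<close>. \<open>vfun\<close> is the functional \<open>\<xi>\<close> on \<open>V\<close>, taken \<open>undefined\<close> off \<open>V\<close> so that equality of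
  arrangements is equality of records.
\<close>

record arrangement =
  vspace :: "rvec set"
  vcoset :: "rvec set"
  vfun :: "rvec \<Rightarrow> real"

definition polarized_arrangement :: "nat \<Rightarrow> nat \<Rightarrow> arrangement \<Rightarrow> bool" where
  "polarized_arrangement n k A \<longleftrightarrow>
     vspace A \<subseteq> Rn n \<and> subspace (vspace A) \<and> dim (vspace A) = k \<and>
     (\<exists>e\<in>Rn n. vcoset A = (\<lambda>v. v + e) ` vspace A) \<and>
     (\<forall>e\<in>vcoset A. n - k \<le> card (Poly_Mapping.keys e)) \<and>
     vfun A \<in> extensional (vspace A) \<and>
     (\<forall>v\<in>vspace A. \<forall>w\<in>vspace A. vfun A (v + w) = vfun A v + vfun A w) \<and>
     (\<forall>c. \<forall>v\<in>vspace A. vfun A (c *\<^sub>R v) = c * vfun A v) \<and>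
     (\<forall>a\<in>Rn n. (\<forall>v\<in>vspace A. vfun A v = dotp a v) \<longrightarrow> k \<le> card (Poly_Mapping.keys a))"

text \<open>
  The Pluecker coordinate at the columns \<open>J\<close> of a subspace with ordered basis \<open>bs\<close>. Changing the
  basis multiplies all of them by one common nonzero scalar.
\<close>

definition pluecker :: "rvec list \<Rightarrow> nat set \<Rightarrow> real" where
  "pluecker bs J = Determinant.det (mat (length bs) (length bs)
     (\<lambda>(i, j). Poly_Mapping.lookup (bs ! i) (sorted_list_of_set J ! j)))"

definition Gr_pos :: "nat \<Rightarrow> nat \<Rightarrow> rvec set set" where
  "Gr_pos d m = {W. W \<subseteq> Rn m \<and>
     (\<exists>bs. length bs = d \<and> distinct bs \<and> independent (set bs) \<and> span (set bs) = W \<and>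
       (\<exists>s\<in>{1, -1}. \<forall>J\<subseteq>{1..m}. card J = d \<longrightarrow> 0 < s * pluecker bs J))}"

definition is_orth_proj :: "nat \<Rightarrow> rvec set \<Rightarrow> rvec \<Rightarrow> rvec \<Rightarrow> bool" where
  "is_orth_proj n V e p \<longleftrightarrow> p \<in> Rn n \<and> (\<forall>v\<in>V. dotp p v = 0) \<and> e - p \<in> V"

definition left_cyclic :: "nat \<Rightarrow> nat \<Rightarrow> arrangement \<Rightarrow> bool" where
  "left_cyclic n k A \<longleftrightarrow>
     polarized_arrangement n k A \<and>
     span (vspace A \<union> vcoset A) \<in> Gr_pos (k + 1) n \<and>
     (\<lambda>v. vcons (vfun A v) v) ` vspace A \<in> Gr_pos k (n + 1) \<and>
     (\<exists>e\<in>vcoset A. \<exists>p. is_orth_proj n (vspace A) e p \<and> 0 < Poly_Mapping.lookup p 1)"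

definition first_deletion :: "arrangement \<Rightarrow> arrangement" where
  "first_deletion A =
     \<lparr> vspace = vtail ` vspace A,
       vcoset = vtail ` vcoset A,
       vfun = restrict (\<lambda>v. vfun A (inv_into (vspace A) vtail v)) (vtail ` vspace A) \<rparr>"

text \<open>Here \<open>n\<close> is the number of hyperplanes of the restricted arrangement.\<close>

definition first_restriction :: "nat \<Rightarrow> arrangement \<Rightarrow> arrangement" where
  "first_restriction n A =
     \<lparr> vspace = {v \<in> Rn n. vcons 0 v \<in> vspace A},
       vcoset = {v \<in> Rn n. vcons 0 v \<in> vcoset A},
       vfun = restrict (\<lambda>v. vfun A (vcons 0 v)) {v \<in> Rn n. vcons 0 v \<in> vspace A} \<rparr>"

definition negate_arrangement :: "arrangement \<Rightarrow> arrangement" where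
  "negate_arrangement A =
     \<lparr> vspace = vspace A,
       vcoset = uminus ` vcoset A,
       vfun = restrict (\<lambda>v. - vfun A v) (vspace A) \<rparr>"

text \<open>
  A sign vector is a list \<open>[\<alpha>(1), \<dots>, \<alpha>(n)]\<close> of \<open>\<plusminus>1\<close>'s. With \<open>sgn_at\<close> the entries are numbered as
  in \<open>+\<alpha>\<close>, that is, \<open>\<alpha>(0) = +\<close>.
\<close>

type_synonym sgnvec = "int list"

definition signs :: "nat \<Rightarrow> sgnvec set" where
  "signs n = {\<alpha>. length \<alpha> = n \<and> set \<alpha> \<subseteq> {1, -1}}"

definition sgn_at :: "sgnvec \<Rightarrow> nat \<Rightarrow> int" where
  "sgn_at \<alpha> i = (1 # \<alpha>) ! i"

definition Delta :: "nat \<Rightarrow> arrangement \<Rightarrow> sgnvec \<Rightarrow> rvec set" where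
  "Delta n A \<alpha> = {x \<in> vcoset A. \<forall>i\<in>{1..n}. 0 \<le> of_int (sgn_at \<alpha> i) * Poly_Mapping.lookup x i}"

definition HS :: "arrangement \<Rightarrow> nat set \<Rightarrow> rvec set" where
  "HS A S = {x \<in> vcoset A. \<forall>i\<in>S. Poly_Mapping.lookup x i = 0}"

definition feasible :: "nat \<Rightarrow> arrangement \<Rightarrow> sgnvec \<Rightarrow> bool" where
  "feasible n A \<alpha> \<longleftrightarrow> Delta n A \<alpha> \<noteq> {}"

definition bounded_sgn :: "nat \<Rightarrow> arrangement \<Rightarrow> sgnvec \<Rightarrow> bool" where
  "bounded_sgn n A \<alpha> \<longleftrightarrow>
     (\<exists>h :: rvec \<Rightarrow> real. (\<forall>x\<in>vcoset A. \<forall>v\<in>vspace A. h (x + v) = h x + vfun A v) \<and>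
        bdd_above (h ` Delta n A \<alpha>))"

definition PP :: "nat \<Rightarrow> arrangement \<Rightarrow> sgnvec set" where
  "PP n A = {\<alpha> \<in> signs n. feasible n A \<alpha> \<and> bounded_sgn n A \<alpha>}"

text \<open>
  The ring of combinations of the basis \<open>B\<close> with coefficients in \<open>C\<close>, the product of two basis
  elements being given by \<open>m\<close> and extended bilinearly, with unit \<open>e\<close>.
\<close>

definition scale :: "'r::comm_ring_1 \<Rightarrow> ('b \<Rightarrow>\<^sub>0 'r) \<Rightarrow> ('b \<Rightarrow>\<^sub>0 'r)" where
  "scale c F = Poly_Mapping.map ((*) c) F"

definition bilinear_ext ::
  "('b \<Rightarrow> 'b \<Rightarrow> 'b \<Rightarrow>\<^sub>0 'r::comm_ring_1) \<Rightarrow> ('b \<Rightarrow>\<^sub>0 'r) \<Rightarrow> ('b \<Rightarrow>\<^sub>0 'r) \<Rightarrow> ('b \<Rightarrow>\<^sub>0 'r)" where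
  "bilinear_ext m F G =
     (\<Sum>a\<in>Poly_Mapping.keys F. \<Sum>b\<in>Poly_Mapping.keys G. scale (Poly_Mapping.lookup F a * Poly_Mapping.lookup G b) (m a b))"

definition based_ring ::
  "'b set \<Rightarrow> 'r::comm_ring_1 set \<Rightarrow> ('b \<Rightarrow> 'b \<Rightarrow> 'b \<Rightarrow>\<^sub>0 'r) \<Rightarrow> ('b \<Rightarrow>\<^sub>0 'r) \<Rightarrow> ('b \<Rightarrow>\<^sub>0 'r) ring" where
  "based_ring B C m e =
     \<lparr> carrier = {F. Poly_Mapping.keys F \<subseteq> B \<and> (\<forall>b. Poly_Mapping.lookup F b \<in> C)},
       monoid.mult = bilinear_ext m, monoid.one = e, ring.zero = 0, ring.add = (+) \<rparr>"

text \<open>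
  An integer polynomial is a finitely supported function from monomials to \<open>\<int>\<close>, a monomial being
  the finitely supported function of its exponents.
\<close>

type_synonym zpoly = "(nat \<Rightarrow>\<^sub>0 nat) \<Rightarrow>\<^sub>0 int"

definition uvar :: "nat \<Rightarrow> zpoly" where
  "uvar j = Poly_Mapping.single (Poly_Mapping.single j 1) 1"

definition uprod :: "nat set \<Rightarrow> zpoly" where
  "uprod S = (\<Prod>i\<in>S. uvar i)"

definition Zu :: "nat \<Rightarrow> zpoly ring" where
  "Zu n = \<lparr> carrier = {p. \<forall>m\<in>Poly_Mapping.keys p. Poly_Mapping.keys m \<subseteq> {1..n}},
            monoid.mult = (*), monoid.one = 1, ring.zero = 0, ring.add = (+) \<rparr>"

definition poly_subst :: "(nat \<Rightarrow> zpoly) \<Rightarrow> zpoly \<Rightarrow> zpoly" where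
  "poly_subst \<sigma> p = (\<Sum>m\<in>Poly_Mapping.keys p. of_int (Poly_Mapping.lookup p m) *
     (\<Prod>j\<in>Poly_Mapping.keys m. \<sigma> j ^ Poly_Mapping.lookup m j))"

definition Rideal :: "nat \<Rightarrow> arrangement \<Rightarrow> sgnvec \<Rightarrow> sgnvec \<Rightarrow> zpoly set" where
  "Rideal n A \<alpha> \<beta> = genideal (Zu n)
     {uprod S | S. S \<subseteq> {1..n} \<and> Delta n A \<alpha> \<inter> Delta n A \<beta> \<inter> HS A S = {}}"

definition Sdiff :: "nat \<Rightarrow> sgnvec \<Rightarrow> sgnvec \<Rightarrow> sgnvec \<Rightarrow> nat set" where
  "Sdiff n \<alpha> \<beta> \<gamma> = {i\<in>{1..n}. sgn_at \<alpha> i = sgn_at \<gamma> i \<and> sgn_at \<alpha> i \<noteq> sgn_at \<beta> i}"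

text \<open>
  The direct sum of the rings \<open>\<int>[u] / I\<^bsub>\<alpha>\<beta>\<^esub>\<close> is formed as the quotient of the free \<open>\<int>[u]\<close>-module on
  the symbols \<open>f\<^bsub>\<alpha>\<beta>\<^esub>\<close>, indexed by pairs in \<open>\<P>\<close>, by the direct sum of the ideals \<open>I\<^bsub>\<alpha>\<beta>\<^esub>\<close>; the product
  is already defined on the free module.
\<close>

type_synonym fmod = "(sgnvec \<times> sgnvec) \<Rightarrow>\<^sub>0 zpoly"

definition fmult :: "nat \<Rightarrow> sgnvec \<times> sgnvec \<Rightarrow> sgnvec \<times> sgnvec \<Rightarrow> fmod" where
  "fmult n = (\<lambda>(\<alpha>, \<beta>) (\<beta>', \<gamma>).
     if \<beta> = \<beta>' then Poly_Mapping.single (\<alpha>, \<gamma>) (uprod (Sdiff n \<alpha> \<beta> \<gamma>)) else 0)"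

definition Bfree :: "nat \<Rightarrow> arrangement \<Rightarrow> fmod ring" where
  "Bfree n A = based_ring (PP n A \<times> PP n A) (carrier (Zu n)) (fmult n)
     (\<Sum>\<alpha>\<in>PP n A. Poly_Mapping.single (\<alpha>, \<alpha>) 1)"

definition Bideal :: "nat \<Rightarrow> arrangement \<Rightarrow> fmod set" where
  "Bideal n A = {F \<in> carrier (Bfree n A). \<forall>\<alpha> \<beta>. Poly_Mapping.lookup F (\<alpha>, \<beta>) \<in> Rideal n A \<alpha> \<beta>}"

definition Btilde :: "nat \<Rightarrow> arrangement \<Rightarrow> fmod set ring" where
  "Btilde n A = Bfree n A Quot Bideal n A"

text \<open>
  \<open>fsym n A \<alpha> \<beta>\<close> is a representative of \<open>f\<^bsub>\<alpha>\<beta>\<^esub>\<close>, with the convention that it vanishes when \<open>\<alpha>\<close> or \<open>\<beta>\<close>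
  is not in \<open>\<P>\<close>; \<open>fcls n A p \<alpha> \<beta>\<close> is the class of \<open>p f\<^bsub>\<alpha>\<beta>\<^esub>\<close>.
\<close>

definition fsym :: "nat \<Rightarrow> arrangement \<Rightarrow> sgnvec \<Rightarrow> sgnvec \<Rightarrow> fmod" where
  "fsym n A \<alpha> \<beta> =
     (if \<alpha> \<in> PP n A \<and> \<beta> \<in> PP n A then Poly_Mapping.single (\<alpha>, \<beta>) 1 else 0)"

definition fcls :: "nat \<Rightarrow> arrangement \<Rightarrow> zpoly \<Rightarrow> sgnvec \<Rightarrow> sgnvec \<Rightarrow> fmod set" where
  "fcls n A p \<alpha> \<beta> = Bideal n A +>\<^bsub>Bfree n A\<^esub> scale p (fsym n A \<alpha> \<beta>)"

text \<open>
  Vertices are \<open>k\<close>-element subsets of \<open>{0..n}\<close>. An arrow is determined by its label and its source,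
  so a path is a source together with a word of labels.
\<close>

datatype label = ArrR nat | ArrL nat | LoopU nat

type_synonym qpath = "nat set \<times> label list"

definition ksubsets :: "nat set \<Rightarrow> nat \<Rightarrow> nat set set" where
  "ksubsets X k = {x. x \<subseteq> X \<and> card x = k}"

fun is_arrow :: "nat \<Rightarrow> label \<Rightarrow> nat set \<Rightarrow> bool" where
  "is_arrow n (ArrR i) x \<longleftrightarrow> 1 \<le> i \<and> i \<le> n \<and> x \<inter> {i - 1, i} = {i - 1}"
| "is_arrow n (ArrL i) x \<longleftrightarrow> 1 \<le> i \<and> i \<le> n \<and> x \<inter> {i - 1, i} = {i}"
| "is_arrow n (LoopU i) x \<longleftrightarrow> 1 \<le> i \<and> i \<le> n"

fun target :: "label \<Rightarrow> nat set \<Rightarrow> nat set" where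
  "target (ArrR i) x = insert i (x - {i - 1})"
| "target (ArrL i) x = insert (i - 1) (x - {i})"
| "target (LoopU i) x = x"

fun is_walk :: "nat \<Rightarrow> nat set \<Rightarrow> label list \<Rightarrow> bool" where
  "is_walk n x [] \<longleftrightarrow> True"
| "is_walk n x (a # w) \<longleftrightarrow> is_arrow n a x \<and> is_walk n (target a x) w"

definition walk_end :: "qpath \<Rightarrow> nat set" where
  "walk_end = (\<lambda>(x, w). fold target w x)"

definition qpaths :: "nat \<Rightarrow> nat \<Rightarrow> qpath set" where
  "qpaths n k = {(x, w). x \<in> ksubsets {0..n} k \<and> is_walk n x w}"

text \<open>Paths compose left to right: \<open>p q\<close> is nonzero when \<open>p\<close> ends where \<open>q\<close> starts.\<close>

definition path_mult :: "qpath \<Rightarrow> qpath \<Rightarrow> qpath \<Rightarrow>\<^sub>0 int" where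
  "path_mult p q = (if walk_end p = fst q then Poly_Mapping.single (fst p, snd p @ snd q) 1 else 0)"

definition path_algebra :: "nat \<Rightarrow> nat \<Rightarrow> (qpath \<Rightarrow>\<^sub>0 int) ring" where
  "path_algebra n k = based_ring (qpaths n k) UNIV path_mult
     (\<Sum>x\<in>ksubsets {0..n} k. Poly_Mapping.single (x, []) 1)"

text \<open>
  An equation between words of labels is imposed at every vertex at which both words are paths.
  For \<open>R\<^sub>i L\<^sub>i = U\<^sub>i\<close> this means at \<open>x\<close> with \<open>x \<inter> {i-1, i} = {i-1}\<close>, and for \<open>L\<^sub>i R\<^sub>i = U\<^sub>i\<close> at \<open>x\<close> with
  \<open>x \<inter> {i-1, i} = {i}\<close>; in the other equations one side is a path precisely when the other one is.
\<close>

inductive word_eq :: "label list \<Rightarrow> label list \<Rightarrow> bool" where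
  RU: "word_eq [ArrR i, LoopU j] [LoopU j, ArrR i]"
| LU: "word_eq [ArrL i, LoopU j] [LoopU j, ArrL i]"
| UU: "word_eq [LoopU i, LoopU j] [LoopU j, LoopU i]"
| RL: "word_eq [ArrR i, ArrL i] [LoopU i]"
| LR: "word_eq [ArrL i, ArrR i] [LoopU i]"
| far_RR: "i + 1 < j \<or> j + 1 < i \<Longrightarrow> word_eq [ArrR i, ArrR j] [ArrR j, ArrR i]"
| far_LL: "i + 1 < j \<or> j + 1 < i \<Longrightarrow> word_eq [ArrL i, ArrL j] [ArrL j, ArrL i]"
| far_LR: "i + 1 < j \<or> j + 1 < i \<Longrightarrow> word_eq [ArrL i, ArrR j] [ArrR j, ArrL i]"

inductive zero_path :: "nat set \<Rightarrow> label list \<Rightarrow> bool" where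
  zero_RR: "zero_path x [ArrR i, ArrR (i + 1)]"
| zero_LL: "zero_path x [ArrL (i + 1), ArrL i]"
| zero_U: "x \<inter> {i - 1, i} = {} \<Longrightarrow> zero_path x [LoopU i]"

definition relators :: "nat \<Rightarrow> nat \<Rightarrow> (qpath \<Rightarrow>\<^sub>0 int) set" where
  "relators n k =
     {Poly_Mapping.single (x, v) 1 - Poly_Mapping.single (x, w) 1 | x v w.
        (x, v) \<in> qpaths n k \<and> (x, w) \<in> qpaths n k \<and> word_eq v w} \<union>
     {Poly_Mapping.single (x, w) 1 | x w. (x, w) \<in> qpaths n k \<and> zero_path x w}"

definition relideal :: "nat \<Rightarrow> nat \<Rightarrow> (qpath \<Rightarrow>\<^sub>0 int) set" where
  "relideal n k = genideal (path_algebra n k) (relators n k)"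

definition BB :: "nat \<Rightarrow> nat \<Rightarrow> (qpath \<Rightarrow>\<^sub>0 int) set ring" where
  "BB n k = path_algebra n k Quot relideal n k"

definition pcls :: "nat \<Rightarrow> nat \<Rightarrow> nat set \<Rightarrow> label list \<Rightarrow> (qpath \<Rightarrow>\<^sub>0 int) set" where
  "pcls n k x w = relideal n k +>\<^bsub>path_algebra n k\<^esub> Poly_Mapping.single (x, w) 1"

text \<open>The truncation \<open>e B e\<close>, where \<open>e\<close> is the sum of the \<open>I\<^sub>x\<close> with \<open>x \<subseteq> {0..n-1}\<close>.\<close>

definition left_idem :: "nat \<Rightarrow> nat \<Rightarrow> (qpath \<Rightarrow>\<^sub>0 int) set" where
  "left_idem n k = relideal n k +>\<^bsub>path_algebra n k\<^esub>
     (\<Sum>x\<in>ksubsets {..<n} k. Poly_Mapping.single (x, []) 1)"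

definition Bl :: "nat \<Rightarrow> nat \<Rightarrow> (qpath \<Rightarrow>\<^sub>0 int) set ring" where
  "Bl n k = (BB n k)
     \<lparr> carrier := {left_idem n k \<otimes>\<^bsub>BB n k\<^esub> X \<otimes>\<^bsub>BB n k\<^esub> left_idem n k | X. X \<in> carrier (BB n k)},
       one := left_idem n k \<rparr>"

definition sgn_of :: "nat \<Rightarrow> nat set \<Rightarrow> sgnvec" where
  "sgn_of n x = (THE \<alpha>. \<alpha> \<in> signs n \<and> x = {i. i < n \<and> sgn_at \<alpha> i \<noteq> sgn_at \<alpha> (i + 1)})"

text \<open>
  As \<open>Bl n k\<close> is generated as a ring by the listed elements, there is at most one such \<open>\<Phi>\<close> on its
  carrier.
\<close>

definition identification ::
  "nat \<Rightarrow> nat \<Rightarrow> arrangement \<Rightarrow> ((qpath \<Rightarrow>\<^sub>0 int) set \<Rightarrow> fmod set) \<Rightarrow> bool" where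
  "identification n k A \<Phi> \<longleftrightarrow>
     \<Phi> \<in> ring_iso (Bl n k) (Btilde n A) \<and>
     (\<forall>x\<in>ksubsets {..<n} k. sgn_of n x \<in> PP n A \<and>
        \<Phi> (pcls n k x []) = fcls n A 1 (sgn_of n x) (sgn_of n x)) \<and>
     (\<forall>x\<in>ksubsets {..<n} k. \<forall>i. \<forall>a\<in>{ArrR i, ArrL i}. is_arrow n a x \<and> target a x \<subseteq> {..<n} \<longrightarrow>
        \<Phi> (pcls n k x [a]) = fcls n A 1 (sgn_of n x) (sgn_of n (target a x))) \<and>
     (\<forall>x\<in>ksubsets {..<n} k. \<forall>i\<in>{1..n}.
        \<Phi> (pcls n k x [LoopU i]) = fcls n A (uvar i) (sgn_of n x) (sgn_of n x))"

text \<open>As in the library's \<open>module\<close> record, the fields \<open>mult\<close> and \<open>one\<close> of a bimodule carry no meaning.\<close>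

record ('b, 'a, 'm) bimodule = "'m ring" +
  lact :: "'b \<Rightarrow> 'm \<Rightarrow> 'm"
  ract :: "'m \<Rightarrow> 'a \<Rightarrow> 'm"

definition rng_hom :: "('a, 'x) ring_scheme \<Rightarrow> ('b, 'y) ring_scheme \<Rightarrow> ('a \<Rightarrow> 'b) set" where
  "rng_hom A B = {h \<in> carrier A \<rightarrow> carrier B. \<forall>x\<in>carrier A. \<forall>y\<in>carrier A.
     h (x \<oplus>\<^bsub>A\<^esub> y) = h x \<oplus>\<^bsub>B\<^esub> h y \<and> h (x \<otimes>\<^bsub>A\<^esub> y) = h x \<otimes>\<^bsub>B\<^esub> h y}"

definition hom_bimodule ::
  "'b ring \<Rightarrow> 'a ring \<Rightarrow> ('a \<Rightarrow> 'b) \<Rightarrow> ('b, 'a, 'b) bimodule" where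
  "hom_bimodule B A \<phi> =
     \<lparr> carrier = {b \<otimes>\<^bsub>B\<^esub> \<phi> \<one>\<^bsub>A\<^esub> | b. b \<in> carrier B},
       monoid.mult = undefined, monoid.one = undefined, ring.zero = \<zero>\<^bsub>B\<^esub>, ring.add = ring.add B,
       lact = (\<lambda>b m. b \<otimes>\<^bsub>B\<^esub> m), ract = (\<lambda>m a. m \<otimes>\<^bsub>B\<^esub> \<phi> a) \<rparr>"

definition pullback_bimodule ::
  "('d \<Rightarrow> 'b) \<Rightarrow> ('c \<Rightarrow> 'a) \<Rightarrow> ('b, 'a, 'm) bimodule \<Rightarrow> ('d, 'c, 'm) bimodule" where
  "pullback_bimodule \<Phi> \<Psi> M =
     \<lparr> carrier = carrier M, monoid.mult = undefined, monoid.one = undefined, ring.zero = \<zero>\<^bsub>M\<^esub>, ring.add = ring.add M,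
       lact = (\<lambda>b m. lact M (\<Phi> b) m), ract = (\<lambda>m a. ract M m (\<Psi> a)) \<rparr>"

definition tensor_relators ::
  "'r ring \<Rightarrow> ('b, 'r, 'm) bimodule \<Rightarrow> ('r, 'a, 'n) bimodule \<Rightarrow> ('m \<times> 'n \<Rightarrow>\<^sub>0 int) set" where
  "tensor_relators S M N =
     {frag_of (m \<oplus>\<^bsub>M\<^esub> m', x) - frag_of (m, x) - frag_of (m', x) | m m' x.
        m \<in> carrier M \<and> m' \<in> carrier M \<and> x \<in> carrier N} \<union>
     {frag_of (m, x \<oplus>\<^bsub>N\<^esub> x') - frag_of (m, x) - frag_of (m, x') | m x x'.
        m \<in> carrier M \<and> x \<in> carrier N \<and> x' \<in> carrier N} \<union>
     {frag_of (ract M m s, x) - frag_of (m, lact N s x) | m s x.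
        m \<in> carrier M \<and> s \<in> carrier S \<and> x \<in> carrier N}"

definition tensor_bimodule ::
  "'r ring \<Rightarrow> ('b, 'r, 'm) bimodule \<Rightarrow> ('r, 'a, 'n) bimodule
    \<Rightarrow> ('b, 'a, ('m \<times> 'n \<Rightarrow>\<^sub>0 int) set) bimodule" where
  "tensor_bimodule S M N =
     (let G = free_Abelian_group (carrier M \<times> carrier N);
          H = generate G (tensor_relators S M N)
      in \<lparr> carrier = carrier (G Mod H), monoid.mult = undefined, monoid.one = undefined,
           ring.zero = \<one>\<^bsub>G Mod H\<^esub>, ring.add = (\<lambda>X Y. X \<otimes>\<^bsub>G Mod H\<^esub> Y),
           lact = (\<lambda>b X. \<Union>t\<in>X. H #>\<^bsub>G\<^esub> frag_extend (\<lambda>(m, x). frag_of (lact M b m, x)) t),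
           ract = (\<lambda>X a. \<Union>t\<in>X. H #>\<^bsub>G\<^esub> frag_extend (\<lambda>(m, x). frag_of (m, ract N x a)) t) \<rparr>)"

definition bimodule_isomorphic ::
  "'b ring \<Rightarrow> 'a ring \<Rightarrow> ('b, 'a, 'm) bimodule \<Rightarrow> ('b, 'a, 'n) bimodule \<Rightarrow> bool" where
  "bimodule_isomorphic B A M N \<longleftrightarrow>
     (\<exists>h. bij_betw h (carrier M) (carrier N) \<and>
        (\<forall>x\<in>carrier M. \<forall>y\<in>carrier M. h (x \<oplus>\<^bsub>M\<^esub> y) = h x \<oplus>\<^bsub>N\<^esub> h y) \<and>
        (\<forall>b\<in>carrier B. \<forall>x\<in>carrier M. h (lact M b x) = lact N b (h x)) \<and>
        (\<forall>a\<in>carrier A. \<forall>x\<in>carrier M. h (ract M x a) = ract N (h x) a))"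

text \<open>
  The map \<open>Btilde n A \<rightarrow> Btilde n' A'\<close> that sends the class of \<open>\<Sum> p\<^bsub>\<alpha>\<beta>\<^esub> f\<^bsub>\<alpha>\<beta>\<^esub>\<close> to the class of
  \<open>\<Sum> \<sigma>(p\<^bsub>\<alpha>\<beta>\<^esub>) g\<^bsub>\<alpha>\<beta>\<^esub>\<close>, where \<open>\<sigma>\<close> substitutes polynomials for the variables. The union is over all
  representatives of the class \<open>X\<close>.
\<close>

definition induced_map ::
  "nat \<Rightarrow> arrangement \<Rightarrow> (nat \<Rightarrow> zpoly) \<Rightarrow> (sgnvec \<Rightarrow> sgnvec \<Rightarrow> fmod) \<Rightarrow> fmod set \<Rightarrow> fmod set" where
  "induced_map n' A' \<sigma> g X = (\<Union>F\<in>X. Bideal n' A' +>\<^bsub>Bfree n' A'\<^esub>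
     (\<Sum>(\<alpha>, \<beta>)\<in>Poly_Mapping.keys F. scale (poly_subst \<sigma> (Poly_Mapping.lookup F (\<alpha>, \<beta>))) (g \<alpha> \<beta>)))"

definition Del_map :: "nat \<Rightarrow> arrangement \<Rightarrow> fmod set \<Rightarrow> fmod set" where
  "Del_map n Ahat = induced_map (n + 1) Ahat (\<lambda>j. uvar (j + 1))
     (\<lambda>\<alpha> \<beta>. fsym (n + 1) Ahat (1 # \<alpha>) (1 # \<beta>))"

definition Rest_map :: "nat \<Rightarrow> arrangement \<Rightarrow> fmod set \<Rightarrow> fmod set" where
  "Rest_map n A' = induced_map n A' (\<lambda>j. if j = 1 then 0 else uvar (j - 1))
     (\<lambda>\<alpha> \<beta>. if hd \<alpha> = 1 \<and> hd \<beta> = 1 then fsym n A' (tl \<alpha>) (tl \<beta>) else 0)"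

text \<open>\<open>Neg_map\<close> goes from the algebra of an arrangement to that of its negative \<open>A''\<close>.\<close>

definition Neg_map :: "nat \<Rightarrow> arrangement \<Rightarrow> fmod set \<Rightarrow> fmod set" where
  "Neg_map n A'' = induced_map n A'' uvar
     (\<lambda>\<alpha> \<beta>. fsym n A'' (map uminus \<alpha>) (map uminus \<beta>))"

definition Del1 :: "nat \<Rightarrow> arrangement \<Rightarrow> arrangement \<Rightarrow> (fmod set, fmod set, fmod set) bimodule" where
  "Del1 n A Ahat = hom_bimodule (Btilde (n + 1) Ahat) (Btilde n A) (Del_map n Ahat)"

definition Rest1 :: "nat \<Rightarrow> arrangement \<Rightarrow> (fmod set, fmod set, fmod set) bimodule" where
  "Rest1 n Ahat =
     (let A' = first_restriction n Ahat; A'' = negate_arrangement A'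
      in hom_bimodule (Btilde n A'') (Btilde (n + 1) Ahat) (Neg_map n A'' \<circ> Rest_map n A'))"

definition F_map :: "nat \<Rightarrow> nat \<Rightarrow> (qpath \<Rightarrow>\<^sub>0 int) set \<Rightarrow> (qpath \<Rightarrow>\<^sub>0 int) set" where
  "F_map n k = (THE \<phi>. \<phi> \<in> rng_hom (Bl n (k + 1)) (Bl n k) \<inter> extensional (carrier (Bl n (k + 1))) \<and>
     (\<forall>x\<in>ksubsets {..<n} (k + 1).
        \<phi> (pcls n (k + 1) x []) = (if 0 \<in> x then pcls n k (x - {0}) [] else \<zero>\<^bsub>Bl n k\<^esub>)) \<and>
     (\<forall>x\<in>ksubsets {..<n} (k + 1). \<forall>i. \<forall>a\<in>{ArrR i, ArrL i}. is_arrow n a x \<and> target a x \<subseteq> {..<n} \<longrightarrow>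
        \<phi> (pcls n (k + 1) x [a]) =
          (if 0 \<in> x \<inter> target a x then pcls n k (x - {0}) [a] else \<zero>\<^bsub>Bl n k\<^esub>)) \<and>
     (\<forall>x\<in>ksubsets {..<n} (k + 1). \<forall>i\<in>{1..n}.
        \<phi> (pcls n (k + 1) x [LoopU i]) = (if 0 \<in> x then pcls n k (x - {0}) [LoopU i] else \<zero>\<^bsub>Bl n k\<^esub>)))"

definition FF :: "nat \<Rightarrow> nat \<Rightarrow>
  ((qpath \<Rightarrow>\<^sub>0 int) set, (qpath \<Rightarrow>\<^sub>0 int) set, (qpath \<Rightarrow>\<^sub>0 int) set) bimodule" where
  "FF n k = hom_bimodule (Bl n k) (Bl n (k + 1)) (F_map n k)"

end

theory Submission
  imports Defs
begin

text \<open>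
  For ring homomorphisms \<open>\<delta> : R \<rightarrow> S\<close> and \<open>\<rho> : S \<rightarrow> T\<close>, not necessarily unital, the tensor product over
  \<open>S\<close> of the bimodules of \<open>\<rho>\<close> and \<open>\<delta>\<close> is the bimodule of \<open>\<rho> \<circ> \<delta>\<close>: every tensor \<open>m \<otimes> x\<close> equals
  \<open>m \<rho>(x) \<otimes> \<delta>(1)\<close>. It remains to see that the composite \<open>f\<^bsub>\<alpha>\<beta>\<^esub> \<mapsto> f\<^bsub>-\<alpha>,-\<beta>\<^esub>\<close> corresponds to the
  homomorphism that defines \<open>F\<^sub>k\<close>. Negating \<open>\<alpha>\<close> changes its set of sign changes exactly at 0, and a
  class \<open>f\<^bsub>-\<alpha>,-\<beta>\<^esub>\<close> with \<open>-\<alpha>\<close> of the wrong number of sign changes vanishes, so the two homomorphisms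
  agree on the vertices, arrows and loops. These generate the truncated quiver algebra: a path that
  leaves and re-enters the truncation can be rewritten to stay inside it.
\<close>

section \<open>Tensor products of bimodules of ring homomorphisms\<close>

text \<open>\<open>F_map\<close> is a definite description, so existence and uniqueness of the
  homomorphism are both owed. Existence is not checked against the quiver relations: the composite
  of deletion, restriction and negation is transported along the identifications and evaluated on
  the generators. Uniqueness is where generation enters, and there the vertices containing
  \<open>n\<close> are the obstacle: a path between vertices of the truncation may visit them, so
  arrows of index \<open>n\<close> have to be eliminated by rewriting. The three maps between
  arrangement algebras are instances of one locale, \<open>sign_map\<close>. Its delicate point is
  the convention that a symbol vanishes once a sign vector leaves \<open>PP\<close>: if this happens
  to the middle vector of a product, the monomial of repeated crossings must already die in the
  target. When the middle chamber is empty, this is because a common point of the outer chambers on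
  all those hyperplanes would lie in the middle chamber. The number of sign changes of the vectors
  in \<open>PP n A''\<close> is read off from the identification itself, by comparing units.\<close>

lemma rng_hom_closed:
  "h \<in> rng_hom A B \<Longrightarrow> x \<in> carrier A \<Longrightarrow> h x \<in> carrier B"
  by (auto simp: rng_hom_def)

lemma rng_hom_add:
  "h \<in> rng_hom A B \<Longrightarrow> x \<in> carrier A \<Longrightarrow> y \<in> carrier A \<Longrightarrow> h (x \<oplus>\<^bsub>A\<^esub> y) = h x \<oplus>\<^bsub>B\<^esub> h y"
  by (auto simp: rng_hom_def)

lemma rng_hom_mult:
  "h \<in> rng_hom A B \<Longrightarrow> x \<in> carrier A \<Longrightarrow> y \<in> carrier A \<Longrightarrow> h (x \<otimes>\<^bsub>A\<^esub> y) = h x \<otimes>\<^bsub>B\<^esub> h y"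
  by (auto simp: rng_hom_def)

lemma rng_hom_comp: "g \<in> rng_hom A B \<Longrightarrow> h \<in> rng_hom B C \<Longrightarrow> h \<circ> g \<in> rng_hom A C"
  by (auto simp: rng_hom_def Pi_def)

lemma ring_hom_imp_rng_hom: "h \<in> Ring.ring_hom A B \<Longrightarrow> h \<in> rng_hom A B"
  by (auto simp: rng_hom_def Ring.ring_hom_def)

lemma rng_hom_zero:
  assumes "ring A" "ring B" and h: "h \<in> rng_hom A B"
  shows "h \<zero>\<^bsub>A\<^esub> = \<zero>\<^bsub>B\<^esub>"
proof -
  interpret A: ring A by fact
  interpret B: ring B by fact
  have "h \<zero>\<^bsub>A\<^esub> \<oplus>\<^bsub>B\<^esub> h \<zero>\<^bsub>A\<^esub> = h \<zero>\<^bsub>A\<^esub>"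
    using rng_hom_add[OF h, of "\<zero>\<^bsub>A\<^esub>" "\<zero>\<^bsub>A\<^esub>"] by simp
  then show ?thesis
    using rng_hom_closed[OF h, of "\<zero>\<^bsub>A\<^esub>"] by (metis A.zero_closed B.add.l_cancel_one)
qed

text \<open>The kernel of \<open>g\<close> is a subgroup, so it contains everything generated by the
  relators in it. This is what makes the evaluation of a tensor in the target ring independent of
  the representative.\<close>

lemma (in ring) generate_least_kernel:
  assumes g: "g \<in> hom (free_Abelian_group X) (add_monoid R)"
    and Y: "Y \<subseteq> carrier (free_Abelian_group X)" "\<And>r. r \<in> Y \<Longrightarrow> g r = \<zero>"
    and t: "t \<in> generate (free_Abelian_group X) Y"
  shows "g t = \<zero>"
proof -
  interpret gh: group_hom "free_Abelian_group X" "add_monoid R" g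
    by (intro group_hom.intro group_hom_axioms.intro g group_free_Abelian_group)
       (use add.is_group in simp)
  have "generate (free_Abelian_group X) Y \<subseteq> kernel (free_Abelian_group X) (add_monoid R) g"
    by (rule gh.generate_subgroup_incl) (use Y(2) subsetD[OF Y(1)] gh.subgroup_kernel in \<open>auto simp: kernel_def\<close>)
  then show ?thesis using t by (auto simp: kernel_def)
qed

text \<open>\<open>frag_extend f\<close> is additive, so preserving the generated subgroup can be
  tested on generators. It is used to pass the left and the right action from pairs to the tensor
  product.\<close>

lemma frag_extend_generate:
  assumes "Y \<subseteq> carrier (free_Abelian_group X)"
    and "\<And>r. r \<in> Y \<Longrightarrow> frag_extend f r \<in> generate (free_Abelian_group X') Y'"
    and Y': "Y' \<subseteq> carrier (free_Abelian_group X')"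
    and t: "t \<in> generate (free_Abelian_group X) Y"
  shows "frag_extend f t \<in> generate (free_Abelian_group X') Y'"
  using t
proof (induction t rule: generate.induct)
  case one
  then show ?case using generate.one[of "free_Abelian_group X'" Y'] by simp
next
  case (incl h)
  then show ?case by (rule assms)
next
  case (inv h)
  have "Poly_Mapping.keys h \<subseteq> X" using subsetD[OF assms(1) inv] by simp
  moreover have "- frag_extend f h \<in> generate (free_Abelian_group X') Y'"
  proof -
    have *: "frag_extend f h \<in> generate (free_Abelian_group X') Y'" using assms(2) inv by blast
    have "Poly_Mapping.keys (frag_extend f h) \<subseteq> X'"
      using subsetD[OF group.generate_incl[OF group_free_Abelian_group Y'] *] by simp
    then show ?thesis
      using group.generate_m_inv_closed[OF group_free_Abelian_group Y' *] by simp
  qed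
  ultimately show ?case by (simp add: frag_extend_minus)
next
  case (eng h1 h2)
  then show ?case
    using generate.eng by (fastforce simp: frag_extend_add)
qed

lemma (in ring) add_minus_cancel:
  "a \<in> carrier R \<Longrightarrow> b \<in> carrier R \<Longrightarrow> (a \<oplus> b) \<ominus> a \<ominus> b = \<zero>"
  by algebra

lemma (in ring) minus_eq_zero_imp_eq:
  assumes "a \<in> carrier R" "b \<in> carrier R" "a \<ominus> b = \<zero>"
  shows "a = b"
proof -
  have "a = (a \<ominus> b) \<oplus> b" using assms(1,2) by algebra
  then show ?thesis using assms by simp
qed

text \<open>The isomorphism sends \<open>z\<close> to the class of the pair of
  \<open>\<Phi>'' z\<close> and \<open>\<delta> 1\<close>. Evaluating a pair \<open>(m, x)\<close>
  to \<open>m \<rho>(x)\<close> is well defined on classes and recovers \<open>\<Phi>'' z\<close>,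
  which gives injectivity.\<close>

lemma bimodule_isomorphic_tensor_hom_bimodules:
  fixes R :: "'r ring" and S :: "'s ring" and T :: "'t ring"
    and R0 :: "'a ring" and S0 :: "'b ring" and T0 :: "'c ring"
  assumes ringR: "ring R" and ringS: "ring S" and ringT: "ring T" and ringR0: "ring R0" and ringT0: "ring T0"
    and \<delta>: "\<delta> \<in> rng_hom R S" and \<rho>: "\<rho> \<in> rng_hom S T"
    and \<Phi>: "\<Phi> \<in> ring_iso R0 R" and \<Phi>hat: "\<Phi>hat \<in> ring_iso S0 S" and \<Phi>'': "\<Phi>'' \<in> ring_iso T0 T"
    and F: "\<And>a. a \<in> carrier R0 \<Longrightarrow> F a \<in> carrier T0"
      "\<And>a. a \<in> carrier R0 \<Longrightarrow> \<Phi>'' (F a) = \<rho> (\<delta> (\<Phi> a))"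
  shows "bimodule_isomorphic T0 R0 (hom_bimodule T0 R0 F)
    (tensor_bimodule S0 (pullback_bimodule \<Phi>'' \<Phi>hat (hom_bimodule T S \<rho>))
       (pullback_bimodule \<Phi>hat \<Phi> (hom_bimodule S R \<delta>)))"
proof -
  interpret R: ring R by fact
  interpret S: ring S by fact
  interpret T: ring T by fact
  interpret R0: ring R0 by fact
  interpret T0: ring T0 by fact
  define M where "M = pullback_bimodule \<Phi>'' \<Phi>hat (hom_bimodule T S \<rho>)"
  define N where "N = pullback_bimodule \<Phi>hat \<Phi> (hom_bimodule S R \<delta>)"
  define d where "d = \<delta> \<one>\<^bsub>R\<^esub>"
  define e where "e = \<rho> \<one>\<^bsub>S\<^esub>"
  define CM where "CM = carrier M"
  define CN where "CN = carrier N"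
  have CM: "CM = {b \<otimes>\<^bsub>T\<^esub> e | b. b \<in> carrier T}"
    by (simp add: CM_def M_def pullback_bimodule_def hom_bimodule_def e_def)
  have CN: "CN = {b \<otimes>\<^bsub>S\<^esub> d | b. b \<in> carrier S}"
    by (simp add: CN_def N_def pullback_bimodule_def hom_bimodule_def d_def)
  have Mops: "ring.add M = ring.add T" "\<And>b m. lact M b m = \<Phi>'' b \<otimes>\<^bsub>T\<^esub> m"
    "\<And>m s. ract M m s = m \<otimes>\<^bsub>T\<^esub> \<rho> (\<Phi>hat s)"
    by (auto simp: M_def pullback_bimodule_def hom_bimodule_def)
  have Nops: "ring.add N = ring.add S" "\<And>b m. lact N b m = \<Phi>hat b \<otimes>\<^bsub>S\<^esub> m"
    "\<And>m s. ract N m s = m \<otimes>\<^bsub>S\<^esub> \<delta> (\<Phi> s)"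
    by (auto simp: N_def pullback_bimodule_def hom_bimodule_def)
  have \<Phi>c: "\<Phi> a \<in> carrier R" if "a \<in> carrier R0" for a
    using \<Phi> that by (auto simp: ring_iso_def Ring.ring_hom_def)
  have \<Phi>hatc: "\<Phi>hat a \<in> carrier S" if "a \<in> carrier S0" for a
    using \<Phi>hat that by (auto simp: ring_iso_def Ring.ring_hom_def)
  have \<Phi>hat_surj: "\<exists>a\<in>carrier S0. \<Phi>hat a = s" if "s \<in> carrier S" for s
    using \<Phi>hat that unfolding ring_iso_def bij_betw_def mem_Collect_eq by (metis imageE)
  have \<Phi>''c: "\<Phi>'' a \<in> carrier T" if "a \<in> carrier T0" for a
    using \<Phi>'' that by (auto simp: ring_iso_def Ring.ring_hom_def)
  have \<Phi>''_surj: "\<exists>a\<in>carrier T0. \<Phi>'' a = s" if "s \<in> carrier T" for s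
    using \<Phi>'' that unfolding ring_iso_def bij_betw_def mem_Collect_eq by (metis imageE)
  have \<Phi>''_inj: "a = b" if "a \<in> carrier T0" "b \<in> carrier T0" "\<Phi>'' a = \<Phi>'' b" for a b
    using \<Phi>'' that by (auto simp: ring_iso_def bij_betw_def inj_on_def)
  have \<Phi>''m: "\<Phi>'' (a \<otimes>\<^bsub>T0\<^esub> b) = \<Phi>'' a \<otimes>\<^bsub>T\<^esub> \<Phi>'' b" "\<Phi>'' (a \<oplus>\<^bsub>T0\<^esub> b) = \<Phi>'' a \<oplus>\<^bsub>T\<^esub> \<Phi>'' b"
    if "a \<in> carrier T0" "b \<in> carrier T0" for a b
    using \<Phi>'' that by (auto simp: ring_iso_def Ring.ring_hom_def)
  have \<Phi>1: "\<Phi> \<one>\<^bsub>R0\<^esub> = \<one>\<^bsub>R\<^esub>"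
    using \<Phi> by (auto simp: ring_iso_def Ring.ring_hom_def)
  note \<delta>c = rng_hom_closed[OF \<delta>] and \<rho>c = rng_hom_closed[OF \<rho>]
  note \<delta>m = rng_hom_mult[OF \<delta>, symmetric] and \<rho>m = rng_hom_mult[OF \<rho>, symmetric]
  have dc: "d \<in> carrier S" and ec: "e \<in> carrier T" by (auto simp: d_def e_def \<delta>c \<rho>c)
  have dd: "d \<otimes>\<^bsub>S\<^esub> d = d" by (simp add: d_def \<delta>m)
  have ee: "e \<otimes>\<^bsub>T\<^esub> e = e" by (simp add: e_def \<rho>m)
  have \<delta>d: "\<delta> a \<otimes>\<^bsub>S\<^esub> d = \<delta> a" "d \<otimes>\<^bsub>S\<^esub> \<delta> a = \<delta> a" if "a \<in> carrier R" for a
    using that by (simp_all add: d_def \<delta>m)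
  have \<rho>e: "\<rho> s \<otimes>\<^bsub>T\<^esub> e = \<rho> s" "e \<otimes>\<^bsub>T\<^esub> \<rho> s = \<rho> s" if "s \<in> carrier S" for s
    using that by (simp_all add: e_def \<rho>m)
  \<comment> \<open>\<open>d\<close> and \<open>e\<close> are images of units but need not be units.
    Being idempotent, they describe the modules \<open>S d\<close> and \<open>T e\<close> as the
    elements that they fix on the right.\<close>
  have CM_iff: "m \<in> CM \<longleftrightarrow> m \<in> carrier T \<and> m \<otimes>\<^bsub>T\<^esub> e = m" for m
    using ec by (auto simp: CM T.m_assoc ee) metis
  have CN_iff: "x \<in> CN \<longleftrightarrow> x \<in> carrier S \<and> x \<otimes>\<^bsub>S\<^esub> d = x" for x
    using dc by (auto simp: CN S.m_assoc dd) metis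
  have dN: "d \<in> CN" by (simp add: CN_iff dc dd)
  have CM_add: "m \<oplus>\<^bsub>T\<^esub> m' \<in> CM" if "m \<in> CM" "m' \<in> CM" for m m'
    using that ec by (auto simp: CM_iff T.l_distr)
  have CM_neg: "\<ominus>\<^bsub>T\<^esub> m \<in> CM" if "m \<in> CM" for m
    using that ec by (auto simp: CM_iff T.l_minus)
  have CM_zero: "\<zero>\<^bsub>T\<^esub> \<in> CM" using ec by (auto simp: CM_iff)
  have CN_add: "m \<oplus>\<^bsub>S\<^esub> m' \<in> CN" if "m \<in> CN" "m' \<in> CN" for m m'
    using that dc by (auto simp: CN_iff S.l_distr)
  have CM_r: "m \<otimes>\<^bsub>T\<^esub> \<rho> s \<in> CM" if "m \<in> CM" "s \<in> carrier S" for m s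
    using that ec by (auto simp: CM_iff T.m_assoc \<rho>c \<rho>e)
  have CM_l: "b \<otimes>\<^bsub>T\<^esub> m \<in> CM" if "m \<in> CM" "b \<in> carrier T" for m b
    using that ec by (auto simp: CM_iff T.m_assoc)
  have CN_l: "s \<otimes>\<^bsub>S\<^esub> x \<in> CN" if "x \<in> CN" "s \<in> carrier S" for s x
    using that dc by (auto simp: CN_iff S.m_assoc)
  have CN_r: "x \<otimes>\<^bsub>S\<^esub> \<delta> a \<in> CN" if "x \<in> CN" "a \<in> carrier R" for x a
    using that dc by (auto simp: CN_iff S.m_assoc \<delta>c \<delta>d)
  define G where "G = free_Abelian_group (CM \<times> CN)"
  define Y where "Y = tensor_relators S0 M N"
  define H where "H = generate G Y"
  have Yadd1: "frag_of (m \<oplus>\<^bsub>T\<^esub> m', x) - frag_of (m, x) - frag_of (m', x) \<in> Y"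
    if "m \<in> CM" "m' \<in> CM" "x \<in> CN" for m m' x
    unfolding Y_def tensor_relators_def Mops(1) CM_def[symmetric] CN_def[symmetric] using that by blast
  have Yadd2: "frag_of (m, x \<oplus>\<^bsub>S\<^esub> x') - frag_of (m, x) - frag_of (m, x') \<in> Y"
    if "m \<in> CM" "x \<in> CN" "x' \<in> CN" for m x x'
    unfolding Y_def tensor_relators_def Nops(1) CM_def[symmetric] CN_def[symmetric] using that by blast
  \<comment> \<open>The relators balance over \<open>S0\<close>; surjectivity of
    \<open>\<Phi>hat\<close> turns this into balancing over all of \<open>S\<close>.\<close>
  have Ybal: "frag_of (m \<otimes>\<^bsub>T\<^esub> \<rho> s, x) - frag_of (m, s \<otimes>\<^bsub>S\<^esub> x) \<in> Y"
    if "m \<in> CM" "s \<in> carrier S" "x \<in> CN" for m s x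
    unfolding Y_def tensor_relators_def Mops(3) Nops(2) CM_def[symmetric] CN_def[symmetric]
    using that \<Phi>hat_surj[OF that(2)] by blast
  have Y_cases: "(\<exists>m m' x. r = frag_of (m \<oplus>\<^bsub>T\<^esub> m', x) - frag_of (m, x) - frag_of (m', x) \<and> m \<in> CM \<and> m' \<in> CM \<and> x \<in> CN)
     \<or> (\<exists>m x x'. r = frag_of (m, x \<oplus>\<^bsub>S\<^esub> x') - frag_of (m, x) - frag_of (m, x') \<and> m \<in> CM \<and> x \<in> CN \<and> x' \<in> CN)
     \<or> (\<exists>m s x. r = frag_of (m \<otimes>\<^bsub>T\<^esub> \<rho> s, x) - frag_of (m, s \<otimes>\<^bsub>S\<^esub> x) \<and> m \<in> CM \<and> s \<in> carrier S \<and> x \<in> CN)"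
    if "r \<in> Y" for r
    using that \<Phi>hatc
    unfolding Y_def tensor_relators_def Mops Nops CM_def[symmetric] CN_def[symmetric] by blast
  have YG: "Y \<subseteq> carrier G"
  proof
    fix r assume "r \<in> Y"
    from Y_cases[OF this] show "r \<in> carrier G"
      unfolding G_def
      by (elim disjE exE conjE; simp only: carrier_free_Abelian_group_iff)
         (intro order_trans[OF keys_diff] Un_least; simp add: keys_frag_of CM_add CN_add CM_r CN_l)+
  qed
  interpret G: comm_group G unfolding G_def by (rule abelian_free_Abelian_group)
  have Hsub: "subgroup H G" unfolding H_def by (rule G.generate_is_subgroup[OF YG])
  interpret H: normal H G using G.normal_iff_subgroup Hsub by blast
  have Gc: "t \<in> carrier G \<longleftrightarrow> Poly_Mapping.keys t \<subseteq> CM \<times> CN" for t by (simp add: G_def)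
  have Gm: "s \<otimes>\<^bsub>G\<^esub> t = s + t" for s t by (simp add: G_def)
  have fG: "frag_of (m, x) \<in> carrier G" if "m \<in> CM" "x \<in> CN" for m x
    using that by (simp add: G_def)
  have HG: "t \<in> H \<Longrightarrow> t \<in> carrier G" for t by (rule H.mem_carrier)
  have H0: "0 \<in> H" using H.one_closed by (simp add: G_def)
  have Hadd: "s + t \<in> H" if "s \<in> H" "t \<in> H" for s t using H.m_closed[OF that] by (simp add: Gm)
  have Hneg: "- t \<in> H" if "t \<in> H" for t
    using H.m_inv_closed[OF that] HG[OF that] by (simp add: G_def)
  have Hdiff: "s - t \<in> H" if "s \<in> H" "t \<in> H" for s t
    using Hadd[OF that(1) Hneg[OF that(2)]] by simp
  have HY: "r \<in> Y \<Longrightarrow> r \<in> H" for r unfolding H_def by (rule generate.incl)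
  have Gdiff: "s - t \<in> carrier G" if "s \<in> carrier G" "t \<in> carrier G" for s t
    using that keys_diff[of s t] by (auto simp: Gc)
  have coset_eq: "H #>\<^bsub>G\<^esub> s = H #>\<^bsub>G\<^esub> t \<longleftrightarrow> s - t \<in> H" if "s \<in> carrier G" "t \<in> carrier G" for s t
  proof
    assume "H #>\<^bsub>G\<^esub> s = H #>\<^bsub>G\<^esub> t"
    then have "s \<in> H #>\<^bsub>G\<^esub> t" by (metis G.rcos_self Hsub that(1))
    then show "s - t \<in> H" by (auto simp: r_coset_def Gm)
  next
    assume "s - t \<in> H"
    then have "s \<in> H #>\<^bsub>G\<^esub> t" by (auto simp: r_coset_def Gm intro!: bexI[of _ "s - t"])
    then show "H #>\<^bsub>G\<^esub> s = H #>\<^bsub>G\<^esub> t" by (metis G.repr_independence Hsub that(2))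
  qed
  have coset_mem: "t' \<in> H #>\<^bsub>G\<^esub> t \<Longrightarrow> t' - t \<in> H" for t t'
    by (auto simp: r_coset_def Gm)
  \<comment> \<open>Evaluation exists on the free group by its universal property;
    \<open>evH\<close> then makes it factor through the tensor product.\<close>
  obtain ev where ev_hom: "ev \<in> hom G (add_monoid T)"
    and ev: "\<And>p. p \<in> CM \<times> CN \<Longrightarrow> ev (frag_of p) = fst p \<otimes>\<^bsub>T\<^esub> \<rho> (snd p)"
  proof -
    have "comm_group (add_monoid T)" by (rule T.a_comm_group)
    from comm_group.free_Abelian_group_universal[OF this,
        of "\<lambda>p. fst p \<otimes>\<^bsub>T\<^esub> \<rho> (snd p)" "CM \<times> CN"]
    show ?thesis
      using that unfolding G_def by (auto simp: CM_iff CN_iff \<rho>c image_subset_iff)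
  qed
  have evc: "ev t \<in> carrier T" if "t \<in> carrier G" for t
    using ev_hom that by (auto simp: hom_def)
  have ev_add: "ev (s + t) = ev s \<oplus>\<^bsub>T\<^esub> ev t" if "s \<in> carrier G" "t \<in> carrier G" for s t
    using ev_hom that by (auto simp: hom_def Gm)
  have ev_diff: "ev (s - t) = ev s \<ominus>\<^bsub>T\<^esub> ev t" if "s \<in> carrier G" "t \<in> carrier G" for s t
  proof -
    have "ev s = ev (s - t) \<oplus>\<^bsub>T\<^esub> ev t"
      using ev_add[OF Gdiff[OF that] that(2)] by simp
    then show ?thesis using evc that Gdiff[OF that]
      by (metis T.add.inv_solve_right T.minus_eq)
  qed
  have evH: "ev t = \<zero>\<^bsub>T\<^esub>" if "t \<in> H" for t
  proof (rule T.generate_least_kernel[OF ev_hom[unfolded G_def] YG[unfolded G_def] _ that[unfolded H_def G_def]])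
    fix r assume "r \<in> Y"
    from Y_cases[OF this] show "ev r = \<zero>\<^bsub>T\<^esub>"
    proof (elim disjE exE conjE)
      fix m m' x assume r: "r = frag_of (m \<oplus>\<^bsub>T\<^esub> m', x) - frag_of (m, x) - frag_of (m', x)"
        and "m \<in> CM" "m' \<in> CM" "x \<in> CN"
      then show ?thesis
        by (simp add: ev_diff Gdiff fG CM_add ev) (simp add: CM_iff CN_iff T.l_distr \<rho>c T.add_minus_cancel)
    next
      fix m x x' assume r: "r = frag_of (m, x \<oplus>\<^bsub>S\<^esub> x') - frag_of (m, x) - frag_of (m, x')"
        and "m \<in> CM" "x \<in> CN" "x' \<in> CN"
      then show ?thesis
        by (simp add: ev_diff Gdiff fG CN_add ev) (simp add: CM_iff CN_iff T.r_distr \<rho>c rng_hom_add[OF \<rho>] T.add_minus_cancel)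
    next
      fix m s x assume r: "r = frag_of (m \<otimes>\<^bsub>T\<^esub> \<rho> s, x) - frag_of (m, s \<otimes>\<^bsub>S\<^esub> x)"
        and "m \<in> CM" "s \<in> carrier S" "x \<in> CN"
      then show ?thesis
        by (simp add: ev_diff Gdiff fG CM_r CN_l ev) (simp add: CM_iff CN_iff \<rho>c rng_hom_mult[OF \<rho>] T.m_assoc T.minus_eq T.r_neg)
    qed
  qed
  \<comment> \<open>The scalar \<open>x\<close> is moved across the pair of \<open>m\<close> and
    \<open>d\<close>, using that \<open>x\<close> times \<open>d\<close> is
    \<open>x\<close>.\<close>
  have reduce1: "frag_of (m, x) - frag_of (m \<otimes>\<^bsub>T\<^esub> \<rho> x, d) \<in> H" if "m \<in> CM" "x \<in> CN" for m x
    using Hneg[OF HY[OF Ybal[of m x d]]] that dN by (simp add: CN_iff)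
  \<comment> \<open>Once all second entries are \<open>d\<close>, additivity in the first entry
    collapses any combination to a single symbol.\<close>
  have reduce: "\<exists>m\<in>CM. t - frag_of (m, d) \<in> H" if "t \<in> carrier G" for t
  proof -
    have "Poly_Mapping.keys t \<subseteq> CM \<times> CN" using that by (simp add: Gc)
    then show ?thesis
    proof (induction t rule: frag_induction)
      case zero
      \<comment> \<open>The additivity relator for \<open>0 + 0\<close> is exactly minus this
        symbol.\<close>
      have "- frag_of (\<zero>\<^bsub>T\<^esub>, d) \<in> H" using HY[OF Yadd1[OF CM_zero CM_zero dN]] by simp
      then show ?case using CM_zero by auto
    next
      case (one p)
      then obtain m x where p: "p = (m, x)" "m \<in> CM" "x \<in> CN" by auto
      then show ?case using reduce1[of m x] CM_r[of m x] by (auto simp: CN_iff)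
    next
      case (diff a b)
      then obtain m m' where m: "m \<in> CM" "a - frag_of (m, d) \<in> H" "m' \<in> CM" "b - frag_of (m', d) \<in> H"
        by blast
      define m'' where "m'' = m \<ominus>\<^bsub>T\<^esub> m'"
      have m'': "m'' \<in> CM" "m'' \<oplus>\<^bsub>T\<^esub> m' = m"
        using m CM_add[OF m(1) CM_neg[OF m(3)]]
        by (auto simp: m''_def T.minus_eq CM_iff T.a_assoc T.l_neg)
      have "frag_of (m, d) - frag_of (m'', d) - frag_of (m', d) \<in> H"
        using HY[OF Yadd1[OF m''(1) m(3) dN]] m''(2) by simp
      then have "(frag_of (m, d) - frag_of (m'', d) - frag_of (m', d)) + (a - frag_of (m, d)) - (b - frag_of (m', d)) \<in> H"
        by (rule Hdiff[OF Hadd[OF _ m(2)] m(4)])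
      also have "(frag_of (m, d) - frag_of (m'', d) - frag_of (m', d)) + (a - frag_of (m, d)) - (b - frag_of (m', d))
        = a - b - frag_of (m'', d)" by simp
      finally show ?case using m''(1) by blast
    qed
  qed
  define L where "L = (\<lambda>b. frag_extend (\<lambda>(m, x). frag_of (\<Phi>'' b \<otimes>\<^bsub>T\<^esub> m, x)) :: ('t \<times> 's \<Rightarrow>\<^sub>0 int) \<Rightarrow> ('t \<times> 's \<Rightarrow>\<^sub>0 int))"
  define Q where "Q = (\<lambda>a. frag_extend (\<lambda>(m, x). frag_of (m, x \<otimes>\<^bsub>S\<^esub> \<delta> (\<Phi> a))) :: ('t \<times> 's \<Rightarrow>\<^sub>0 int) \<Rightarrow> ('t \<times> 's \<Rightarrow>\<^sub>0 int))"
  have LH: "L b t \<in> H" if "t \<in> H" and b: "b \<in> carrier T0" for b t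
    unfolding H_def L_def G_def
  proof (rule frag_extend_generate[OF YG[unfolded G_def] _ YG[unfolded G_def] that(1)[unfolded H_def G_def]])
    fix r assume "r \<in> Y"
    from Y_cases[OF this]
    have "L b r \<in> Y"
    proof (elim disjE exE conjE)
      fix m m' x assume r: "r = frag_of (m \<oplus>\<^bsub>T\<^esub> m', x) - frag_of (m, x) - frag_of (m', x)"
        and h: "m \<in> CM" "m' \<in> CM" "x \<in> CN"
      then show ?thesis
        using Yadd1[OF CM_l CM_l, OF h(1) \<Phi>''c[OF b] h(2) \<Phi>''c[OF b] h(3)] \<Phi>''c[OF b]
        by (simp add: L_def frag_extend_diff T.r_distr CM_iff)
    next
      fix m x x' assume r: "r = frag_of (m, x \<oplus>\<^bsub>S\<^esub> x') - frag_of (m, x) - frag_of (m, x')"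
        and h: "m \<in> CM" "x \<in> CN" "x' \<in> CN"
      then show ?thesis
        using Yadd2[OF CM_l, OF h(1) \<Phi>''c[OF b] h(2,3)]
        by (simp add: L_def frag_extend_diff)
    next
      fix m s x assume r: "r = frag_of (m \<otimes>\<^bsub>T\<^esub> \<rho> s, x) - frag_of (m, s \<otimes>\<^bsub>S\<^esub> x)"
        and h: "m \<in> CM" "s \<in> carrier S" "x \<in> CN"
      then show ?thesis
        using Ybal[OF CM_l, OF h(1) \<Phi>''c[OF b] h(2,3)] \<Phi>''c[OF b]
        by (simp add: L_def frag_extend_diff T.m_assoc CM_iff \<rho>c)
    qed
    then show "frag_extend (\<lambda>(m, x). frag_of (\<Phi>'' b \<otimes>\<^bsub>T\<^esub> m, x)) r \<in> generate (free_Abelian_group (CM \<times> CN)) Y"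
      using HY unfolding H_def G_def L_def by blast
  qed
  have QH: "Q a t \<in> H" if "t \<in> H" and a: "a \<in> carrier R0" for a t
    unfolding H_def Q_def G_def
  proof (rule frag_extend_generate[OF YG[unfolded G_def] _ YG[unfolded G_def] that(1)[unfolded H_def G_def]])
    fix r assume "r \<in> Y"
    from Y_cases[OF this]
    have "Q a r \<in> Y"
    proof (elim disjE exE conjE)
      fix m m' x assume r: "r = frag_of (m \<oplus>\<^bsub>T\<^esub> m', x) - frag_of (m, x) - frag_of (m', x)"
        and h: "m \<in> CM" "m' \<in> CM" "x \<in> CN"
      then show ?thesis
        using Yadd1[OF h(1,2) CN_r, OF h(3) \<Phi>c[OF a]]
        by (simp add: Q_def frag_extend_diff)
    next
      fix m x x' assume r: "r = frag_of (m, x \<oplus>\<^bsub>S\<^esub> x') - frag_of (m, x) - frag_of (m, x')"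
        and h: "m \<in> CM" "x \<in> CN" "x' \<in> CN"
      then show ?thesis
        using Yadd2[OF h(1) CN_r CN_r, OF h(2) \<Phi>c[OF a] h(3) \<Phi>c[OF a]] \<delta>c[OF \<Phi>c[OF a]]
        by (simp add: Q_def frag_extend_diff S.l_distr CN_iff)
    next
      fix m s x assume r: "r = frag_of (m \<otimes>\<^bsub>T\<^esub> \<rho> s, x) - frag_of (m, s \<otimes>\<^bsub>S\<^esub> x)"
        and h: "m \<in> CM" "s \<in> carrier S" "x \<in> CN"
      then show ?thesis
        using Ybal[OF h(1,2) CN_r, OF h(3) \<Phi>c[OF a]] \<delta>c[OF \<Phi>c[OF a]]
        by (simp add: Q_def frag_extend_diff S.m_assoc CN_iff)
    qed
    then show "frag_extend (\<lambda>(m, x). frag_of (m, x \<otimes>\<^bsub>S\<^esub> \<delta> (\<Phi> a))) r \<in> generate (free_Abelian_group (CM \<times> CN)) Y"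
      using HY unfolding H_def G_def Q_def by blast
  qed
  have LG: "L b t \<in> carrier G" if "t \<in> carrier G" and b: "b \<in> carrier T0" for b t
    unfolding L_def Gc using that
    by (intro order_trans[OF keys_frag_extend] UN_least) (auto simp: Gc keys_frag_of CM_l \<Phi>''c)
  have QG: "Q a t \<in> carrier G" if "t \<in> carrier G" and a: "a \<in> carrier R0" for a t
    unfolding Q_def Gc using that
    by (intro order_trans[OF keys_frag_extend] UN_least) (auto simp: Gc keys_frag_of CN_r \<Phi>c)
  \<comment> \<open>The actions on the tensor product are defined as unions over all representatives
    of a class; every representative contributes the same coset.\<close>
  have Union_coset: "(\<Union>t'\<in>H #>\<^bsub>G\<^esub> t. H #>\<^bsub>G\<^esub> frag_extend f t') = H #>\<^bsub>G\<^esub> frag_extend f t"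
    if t: "t \<in> carrier G" and c: "\<And>t. t \<in> carrier G \<Longrightarrow> frag_extend f t \<in> carrier G"
      and h: "\<And>t. t \<in> H \<Longrightarrow> frag_extend f t \<in> H" for t and f :: "'t \<times> 's \<Rightarrow> ('t \<times> 's) \<Rightarrow>\<^sub>0 int"
  proof -
    have eq: "H #>\<^bsub>G\<^esub> frag_extend f t' = H #>\<^bsub>G\<^esub> frag_extend f t" if t': "t' \<in> H #>\<^bsub>G\<^esub> t" for t'
    proof -
      have "t' \<in> carrier G" using G.r_coset_subset_G[OF H.subset t] t' by (rule subsetD)
      moreover have "frag_extend f t' - frag_extend f t \<in> H"
        using h[OF coset_mem[OF t']] by (simp add: frag_extend_diff)
      ultimately show ?thesis using coset_eq[OF c c, THEN iffD2] t by blast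
    qed
    have "H #>\<^bsub>G\<^esub> t \<noteq> {}" using G.rcos_self[OF t Hsub] by blast
    then show ?thesis by (rule SUP_eq_const) (rule eq)
  qed
  define W where "W = tensor_bimodule S0 M N"
  have Wc: "carrier W = {H #>\<^bsub>G\<^esub> t | t. t \<in> carrier G}"
    by (auto simp: W_def tensor_bimodule_def Let_def FactGroup_def RCOSETS_def
        CM_def[symmetric] CN_def[symmetric] G_def[symmetric] Y_def[symmetric] H_def[symmetric])
  have Wadd: "(H #>\<^bsub>G\<^esub> s) \<oplus>\<^bsub>W\<^esub> (H #>\<^bsub>G\<^esub> t) = H #>\<^bsub>G\<^esub> (s + t)" if "s \<in> carrier G" "t \<in> carrier G" for s t
    using H.rcos_sum[OF that]
    by (simp add: W_def tensor_bimodule_def Let_def FactGroup_def Gm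
        CM_def[symmetric] CN_def[symmetric] G_def[symmetric] Y_def[symmetric] H_def[symmetric])
  have Wl: "lact W b (H #>\<^bsub>G\<^esub> t) = H #>\<^bsub>G\<^esub> L b t" if "t \<in> carrier G" "b \<in> carrier T0" for b t
    using Union_coset[OF that(1) LG[unfolded L_def, OF _ that(2)] LH[unfolded L_def, OF _ that(2)]]
    by (simp add: W_def tensor_bimodule_def Let_def L_def Mops
        CM_def[symmetric] CN_def[symmetric] G_def[symmetric] Y_def[symmetric] H_def[symmetric])
  have Wr: "ract W (H #>\<^bsub>G\<^esub> t) a = H #>\<^bsub>G\<^esub> Q a t" if "t \<in> carrier G" "a \<in> carrier R0" for a t
    using Union_coset[OF that(1) QG[unfolded Q_def, OF _ that(2)] QH[unfolded Q_def, OF _ that(2)]]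
    by (simp add: W_def tensor_bimodule_def Let_def Q_def Nops
        CM_def[symmetric] CN_def[symmetric] G_def[symmetric] Y_def[symmetric] H_def[symmetric])
  define F1 where "F1 = F \<one>\<^bsub>R0\<^esub>"
  have F1: "F1 \<in> carrier T0" "\<Phi>'' F1 = \<rho> d" using F by (simp_all add: F1_def \<Phi>1 d_def)
  define CF where "CF = {b \<otimes>\<^bsub>T0\<^esub> F1 | b. b \<in> carrier T0}"
  have \<rho>d: "\<rho> d \<in> carrier T" "\<rho> d \<otimes>\<^bsub>T\<^esub> \<rho> d = \<rho> d" "\<rho> d \<otimes>\<^bsub>T\<^esub> e = \<rho> d" "e \<otimes>\<^bsub>T\<^esub> \<rho> d = \<rho> d"
    using dc by (simp_all add: \<rho>c \<rho>m dd \<rho>e)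
  have CF: "z \<in> carrier T0 \<and> \<Phi>'' z \<in> CM \<and> \<Phi>'' z \<otimes>\<^bsub>T\<^esub> \<rho> d = \<Phi>'' z" if z: "z \<in> CF" for z
    using z F1 \<rho>d ec by (auto simp: CF_def \<Phi>''m CM_iff \<Phi>''c T.m_assoc)
  define h where "h = (\<lambda>z. H #>\<^bsub>G\<^esub> frag_of (\<Phi>'' z, d))"
  have evh: "ev (frag_of (\<Phi>'' z, d)) = \<Phi>'' z" if "z \<in> CF" for z
    using CF[OF that] dN by (simp add: ev)
  have inj: "inj_on h CF"
  proof (rule inj_onI)
    fix z z' assume z: "z \<in> CF" "z' \<in> CF" "h z = h z'"
    then have "frag_of (\<Phi>'' z, d) - frag_of (\<Phi>'' z', d) \<in> H"
      using coset_eq fG CF dN unfolding h_def by metis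
    from evH[OF this] have "\<Phi>'' z \<ominus>\<^bsub>T\<^esub> \<Phi>'' z' = \<zero>\<^bsub>T\<^esub>"
      using z CF dN by (simp add: ev_diff fG evh)
    then have "\<Phi>'' z = \<Phi>'' z'" using z CF \<Phi>''c by (blast intro: T.minus_eq_zero_imp_eq)
    then show "z = z'" using \<Phi>''_inj CF z by blast
  qed
  have surj: "h ` CF = carrier W"
  proof
    show "h ` CF \<subseteq> carrier W" using CF fG dN by (auto simp: h_def Wc)
    show "carrier W \<subseteq> h ` CF"
    proof
      fix w assume "w \<in> carrier W"
      then obtain t where t: "t \<in> carrier G" "w = H #>\<^bsub>G\<^esub> t" by (auto simp: Wc)
      obtain m where m: "m \<in> CM" "t - frag_of (m, d) \<in> H" using reduce t by blast
      \<comment> \<open>\<open>m\<close> is only known to lie in \<open>T e\<close>, whereas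
        preimages under \<open>h\<close> require an element of \<open>T \<rho>(d)\<close>.
        Multiplying by \<open>\<rho> d\<close> does not change the class, since \<open>d\<close> can
        be moved across and is idempotent.\<close>
      define m' where "m' = m \<otimes>\<^bsub>T\<^esub> \<rho> d"
      have m': "m' \<in> CM" using CM_r[OF m(1) dc] by (simp add: m'_def)
      have "(t - frag_of (m, d)) + (frag_of (m, d) - frag_of (m', d)) \<in> H"
        using Hadd[OF m(2) reduce1[OF m(1) dN]] by (simp add: m'_def)
      then have "w = H #>\<^bsub>G\<^esub> frag_of (m', d)" using t m' dN by (simp add: coset_eq fG)
      moreover obtain b where "b \<in> carrier T0" "\<Phi>'' b = m" using \<Phi>''_surj m by (auto simp: CM_iff)
      then have "b \<otimes>\<^bsub>T0\<^esub> F1 \<in> CF" "\<Phi>'' (b \<otimes>\<^bsub>T0\<^esub> F1) = m'"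
        using F1 by (auto simp: CF_def \<Phi>''m m'_def)
      ultimately show "w \<in> h ` CF" by (metis h_def imageI)
    qed
  qed
  have CFadd: "x \<oplus>\<^bsub>T0\<^esub> y \<in> CF" if "x \<in> CF" "y \<in> CF" for x y
    using that F1(1) by (auto simp: CF_def T0.l_distr[symmetric])
  show ?thesis
    unfolding bimodule_isomorphic_def M_def[symmetric] N_def[symmetric] W_def[symmetric]
  proof (intro exI[of _ h] conjI ballI)
    have c: "carrier (hom_bimodule T0 R0 F) = CF"
      by (simp add: hom_bimodule_def CF_def F1_def)
    show "bij_betw h (carrier (hom_bimodule T0 R0 F)) (carrier W)"
      using inj surj by (simp add: c bij_betw_def)
    fix x assume "x \<in> carrier (hom_bimodule T0 R0 F)"
    then have x: "x \<in> CF" by (simp add: c)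
    note x' = CF[OF x]
    {
      fix y assume "y \<in> carrier (hom_bimodule T0 R0 F)"
      then have y: "y \<in> CF" by (simp add: c)
      note y' = CF[OF y]
      have "frag_of (\<Phi>'' x \<oplus>\<^bsub>T\<^esub> \<Phi>'' y, d) - (frag_of (\<Phi>'' x, d) + frag_of (\<Phi>'' y, d)) \<in> H"
        using HY[OF Yadd1[of "\<Phi>'' x" "\<Phi>'' y" d]] x' y' dN by (simp add: algebra_simps)
      then show "h (x \<oplus>\<^bsub>hom_bimodule T0 R0 F\<^esub> y) = h x \<oplus>\<^bsub>W\<^esub> h y"
        using x' y' dN G.m_closed[OF fG fG, of "\<Phi>'' x" d "\<Phi>'' y" d]
        by (simp add: h_def Wadd fG hom_bimodule_def \<Phi>''m coset_eq CM_add Gm)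
    next
      fix b assume b: "b \<in> carrier T0"
      show "h (lact (hom_bimodule T0 R0 F) b x) = lact W b (h x)"
        using x' b dN by (simp add: h_def Wl fG hom_bimodule_def L_def \<Phi>''m)
    next
      fix a assume a: "a \<in> carrier R0"
      \<comment> \<open>The right action changes the second entry from \<open>d\<close> to
        \<open>\<delta> (\<Phi> a)\<close>. Reducing it to \<open>d\<close> again multiplies the
        first entry by \<open>\<rho> (\<delta> (\<Phi> a))\<close>, which is
        \<open>\<Phi>'' (F a)\<close>.\<close>
      have "frag_of (\<Phi>'' x, \<delta> (\<Phi> a)) - frag_of (\<Phi>'' x \<otimes>\<^bsub>T\<^esub> \<rho> (\<delta> (\<Phi> a)), d) \<in> H"
        using reduce1[of "\<Phi>'' x" "\<delta> (\<Phi> a)"] x' a by (simp add: CN_iff \<delta>c \<Phi>c \<delta>d)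
      then have "H #>\<^bsub>G\<^esub> frag_of (\<Phi>'' x, \<delta> (\<Phi> a)) = H #>\<^bsub>G\<^esub> frag_of (\<Phi>'' x \<otimes>\<^bsub>T\<^esub> \<rho> (\<delta> (\<Phi> a)), d)"
        using x' a dN by (subst coset_eq) (auto intro!: fG CM_r simp: CN_iff \<delta>c \<Phi>c \<delta>d)
      then show "h (ract (hom_bimodule T0 R0 F) x a) = ract W (h x) a"
        using x' a dN F(1)[OF a]
        by (simp add: h_def Wr fG hom_bimodule_def Q_def \<Phi>''m F(2) \<delta>d \<Phi>c)
    }
  qed
qed

section \<open>Rings with a basis\<close>

lemma lookup_scale [simp]: "Poly_Mapping.lookup (scale c F) b = c * Poly_Mapping.lookup F b"
  by (simp add: scale_def Poly_Mapping.map.rep_eq when_def)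

lemma scale_simps [simp]:
  "scale 0 F = 0" "scale c 0 = 0" "scale 1 F = F" "scale c (scale d F) = scale (c * d) F"
  "scale c (Poly_Mapping.single b d) = Poly_Mapping.single b (c * d)"
  by (auto intro!: poly_mapping_eqI simp: mult.assoc lookup_single when_def)

lemma scale_add_left: "scale (c + d) F = scale c F + scale d F"
  by (auto intro!: poly_mapping_eqI simp: lookup_add algebra_simps)

lemma scale_sum_right: "scale c (\<Sum>i\<in>I. f i) = (\<Sum>i\<in>I. scale c (f i))"
  by (auto intro!: poly_mapping_eqI simp: lookup_sum sum_distrib_left)

lemma keys_scale: "Poly_Mapping.keys (scale c F) \<subseteq> Poly_Mapping.keys F"
  by (auto simp: in_keys_iff)

lemma sum_scale_single:
  assumes "finite K" "Poly_Mapping.keys F \<subseteq> K"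
  shows "(\<Sum>b\<in>K. Poly_Mapping.single b (Poly_Mapping.lookup F b)) = F"
proof (rule poly_mapping_eqI)
  fix k
  have "(\<Sum>b\<in>K. Poly_Mapping.lookup F b when b = k) = Poly_Mapping.lookup F k"
    using assms by (cases "k \<in> K") (auto simp: when_def sum.delta' in_keys_iff)
  then show "Poly_Mapping.lookup (\<Sum>b\<in>K. Poly_Mapping.single b (Poly_Mapping.lookup F b)) k
      = Poly_Mapping.lookup F k"
    by (simp add: lookup_sum lookup_single)
qed

text \<open>The definition sums over the exact supports, which change under addition and scaling.
  Over common larger finite sets two such sums can be compared term by term.\<close>

lemma bilinear_ext_eq:
  assumes "finite K" "Poly_Mapping.keys F \<subseteq> K" "finite L" "Poly_Mapping.keys G \<subseteq> L"
  shows "bilinear_ext m F G =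
    (\<Sum>a\<in>K. \<Sum>b\<in>L. scale (Poly_Mapping.lookup F a * Poly_Mapping.lookup G b) (m a b))"
proof -
  have "bilinear_ext m F G = (\<Sum>a\<in>Poly_Mapping.keys F. \<Sum>b\<in>L. scale (Poly_Mapping.lookup F a * Poly_Mapping.lookup G b) (m a b))"
    unfolding bilinear_ext_def
    by (intro sum.cong refl sum.mono_neutral_left assms) (auto simp: in_keys_iff)
  also have "\<dots> = (\<Sum>a\<in>K. \<Sum>b\<in>L. scale (Poly_Mapping.lookup F a * Poly_Mapping.lookup G b) (m a b))"
    by (intro sum.mono_neutral_left assms) (auto simp: in_keys_iff)
  finally show ?thesis .
qed

lemma bilinear_ext_add_left: "bilinear_ext m (F + F') G = bilinear_ext m F G + bilinear_ext m F' G"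
proof -
  let ?K = "Poly_Mapping.keys F \<union> Poly_Mapping.keys F'" and ?L = "Poly_Mapping.keys G"
  have "Poly_Mapping.keys (F + F') \<subseteq> ?K" by (rule keys_add)
  then show ?thesis
    by (subst (1 2 3) bilinear_ext_eq[where K = ?K and L = ?L])
       (auto simp: lookup_add distrib_right scale_add_left sum.distrib)
qed

lemma bilinear_ext_add_right: "bilinear_ext m F (G + G') = bilinear_ext m F G + bilinear_ext m F G'"
proof -
  let ?L = "Poly_Mapping.keys G \<union> Poly_Mapping.keys G'" and ?K = "Poly_Mapping.keys F"
  have "Poly_Mapping.keys (G + G') \<subseteq> ?L" by (rule keys_add)
  then show ?thesis
    by (subst (1 2 3) bilinear_ext_eq[where K = ?K and L = ?L])
       (auto simp: lookup_add distrib_left scale_add_left sum.distrib)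
qed

lemma bilinear_ext_scale_left: "bilinear_ext m (scale c F) G = scale c (bilinear_ext m F G)"
  by (subst (1 2) bilinear_ext_eq[where K = "Poly_Mapping.keys F" and L = "Poly_Mapping.keys G"])
     (auto simp: keys_scale[THEN subsetD] scale_sum_right mult.assoc)

lemma bilinear_ext_scale_right: "bilinear_ext m F (scale c G) = scale c (bilinear_ext m F G)"
  by (subst (1 2) bilinear_ext_eq[where K = "Poly_Mapping.keys F" and L = "Poly_Mapping.keys G"])
     (auto simp: keys_scale[THEN subsetD] scale_sum_right mult_ac)

lemma bilinear_ext_zero [simp]: "bilinear_ext m 0 G = 0" "bilinear_ext m F 0 = 0"
  by (simp_all add: bilinear_ext_def)

lemma bilinear_ext_single [simp]:
  "bilinear_ext m (Poly_Mapping.single a c) (Poly_Mapping.single b d) = scale (c * d) (m a b)"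
  by (subst bilinear_ext_eq[where K = "{a}" and L = "{b}"]) auto

lemma bilinear_ext_sum_left: "bilinear_ext m (\<Sum>i\<in>I. f i) G = (\<Sum>i\<in>I. bilinear_ext m (f i) G)"
  by (induction I rule: infinite_finite_induct) (auto simp: bilinear_ext_add_left)

lemma bilinear_ext_sum_right: "bilinear_ext m F (\<Sum>i\<in>I. f i) = (\<Sum>i\<in>I. bilinear_ext m F (f i))"
  by (induction I rule: infinite_finite_induct) (auto simp: bilinear_ext_add_right)

lemma bilinear_ext_linear_right:
  "bilinear_ext m F G =
    (\<Sum>b\<in>Poly_Mapping.keys G. scale (Poly_Mapping.lookup G b) (bilinear_ext m F (Poly_Mapping.single b 1)))"
proof -
  have "bilinear_ext m F G = bilinear_ext m F (\<Sum>b\<in>Poly_Mapping.keys G. scale (Poly_Mapping.lookup G b) (Poly_Mapping.single b 1))"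
    by (simp add: sum_scale_single)
  then show ?thesis by (simp only: bilinear_ext_sum_right bilinear_ext_scale_right)
qed

lemma bilinear_ext_linear_left:
  "bilinear_ext m F G =
    (\<Sum>a\<in>Poly_Mapping.keys F. scale (Poly_Mapping.lookup F a) (bilinear_ext m (Poly_Mapping.single a 1) G))"
proof -
  have "bilinear_ext m F G = bilinear_ext m (\<Sum>a\<in>Poly_Mapping.keys F. scale (Poly_Mapping.lookup F a) (Poly_Mapping.single a 1)) G"
    by (simp add: sum_scale_single)
  then show ?thesis by (simp only: bilinear_ext_sum_left bilinear_ext_scale_left)
qed

text \<open>By linearity in each argument it suffices to compare triples of basis elements. The
  hypothesis is confined to \<open>B\<close> because in the arrangement algebras it is proved for
  genuine sign vectors.\<close>

lemma bilinear_ext_assoc: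
  assumes "\<And>a b c. a \<in> B \<Longrightarrow> b \<in> B \<Longrightarrow> c \<in> B \<Longrightarrow>
      bilinear_ext m (m a b) (Poly_Mapping.single c 1) = bilinear_ext m (Poly_Mapping.single a 1) (m b c)"
    and "Poly_Mapping.keys F \<subseteq> B" "Poly_Mapping.keys G \<subseteq> B" "Poly_Mapping.keys H \<subseteq> B"
  shows "bilinear_ext m (bilinear_ext m F G) H = bilinear_ext m F (bilinear_ext m G H)"
proof -
  have "bilinear_ext m (bilinear_ext m F G) H =
      (\<Sum>a\<in>Poly_Mapping.keys F. \<Sum>b\<in>Poly_Mapping.keys G. scale (Poly_Mapping.lookup F a * Poly_Mapping.lookup G b)
        (\<Sum>c\<in>Poly_Mapping.keys H. scale (Poly_Mapping.lookup H c) (bilinear_ext m (m a b) (Poly_Mapping.single c 1))))"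
    unfolding bilinear_ext_def[of m F G] bilinear_ext_sum_left bilinear_ext_scale_left
    by (intro sum.cong refl arg_cong[where f = "scale _"] bilinear_ext_linear_right)
  also have "\<dots> = (\<Sum>a\<in>Poly_Mapping.keys F. \<Sum>b\<in>Poly_Mapping.keys G. \<Sum>c\<in>Poly_Mapping.keys H.
      scale (Poly_Mapping.lookup F a * (Poly_Mapping.lookup G b * Poly_Mapping.lookup H c))
        (bilinear_ext m (Poly_Mapping.single a 1) (m b c)))"
    unfolding scale_sum_right using assms
    by (intro sum.cong refl) (auto simp: mult.assoc subset_iff)
  also have "\<dots> = bilinear_ext m F (bilinear_ext m G H)"
    by (subst bilinear_ext_linear_left)
       (simp add: bilinear_ext_def[of m G H] bilinear_ext_sum_right bilinear_ext_scale_right scale_sum_right)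
  finally show ?thesis .
qed

lemma based_ring_simps [simp]:
  "F \<in> carrier (based_ring B C m e) \<longleftrightarrow> Poly_Mapping.keys F \<subseteq> B \<and> (\<forall>b. Poly_Mapping.lookup F b \<in> C)"
  "\<zero>\<^bsub>based_ring B C m e\<^esub> = 0" "\<one>\<^bsub>based_ring B C m e\<^esub> = e"
  "F \<oplus>\<^bsub>based_ring B C m e\<^esub> G = F + G" "F \<otimes>\<^bsub>based_ring B C m e\<^esub> G = bilinear_ext m F G"
  by (simp_all add: based_ring_def)

lemma based_ring_sum_closed:
  assumes "\<And>c d. c \<in> C \<Longrightarrow> d \<in> C \<Longrightarrow> c + d \<in> C" "0 \<in> C"
    and "\<And>i. i \<in> I \<Longrightarrow> f i \<in> carrier (based_ring B C m e)"
  shows "(\<Sum>i\<in>I. f i) \<in> carrier (based_ring B C m e)"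
  using assms(3)
proof (induction I rule: infinite_finite_induct)
  case (insert x I)
  then have "f x \<in> carrier (based_ring B C m e)" "(\<Sum>i\<in>I. f i) \<in> carrier (based_ring B C m e)" by auto
  then show ?case
    using insert(1,2) subsetD[OF keys_add[of "f x" "\<Sum>i\<in>I. f i"]]
    by (auto simp: lookup_add intro!: assms)
qed (use assms in auto)

text \<open>One verification for both algebras of the development, the free module on the symbols
  and the path algebra: bilinearity reduces the ring axioms to products of basis elements.\<close>

lemma ring_based_ring:
  fixes C :: "'r::comm_ring_1 set"
  assumes C: "0 \<in> C" "\<And>c d. c \<in> C \<Longrightarrow> d \<in> C \<Longrightarrow> c + d \<in> C" "\<And>c. c \<in> C \<Longrightarrow> - c \<in> C"
      "\<And>c d. c \<in> C \<Longrightarrow> d \<in> C \<Longrightarrow> c * d \<in> C"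
    and m: "\<And>a b. a \<in> B \<Longrightarrow> b \<in> B \<Longrightarrow> m a b \<in> carrier (based_ring B C m e)"
    and assoc: "\<And>a b c. a \<in> B \<Longrightarrow> b \<in> B \<Longrightarrow> c \<in> B \<Longrightarrow>
      bilinear_ext m (m a b) (Poly_Mapping.single c 1) = bilinear_ext m (Poly_Mapping.single a 1) (m b c)"
    and e: "e \<in> carrier (based_ring B C m e)"
    and unit: "\<And>b. b \<in> B \<Longrightarrow> bilinear_ext m e (Poly_Mapping.single b 1) = Poly_Mapping.single b 1"
      "\<And>b. b \<in> B \<Longrightarrow> bilinear_ext m (Poly_Mapping.single b 1) e = Poly_Mapping.single b 1"
  shows "ring (based_ring B C m e)"
proof (rule ringI)
  let ?R = "based_ring B C m e"
  have add: "F + G \<in> carrier ?R" if "F \<in> carrier ?R" "G \<in> carrier ?R" for F G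
    using that keys_add[of F G] by (auto simp: lookup_add C)
  have mult: "bilinear_ext m F G \<in> carrier ?R" if "F \<in> carrier ?R" "G \<in> carrier ?R" for F G
    unfolding bilinear_ext_def
  proof (intro based_ring_sum_closed C)
    fix a b assume "a \<in> Poly_Mapping.keys F" "b \<in> Poly_Mapping.keys G"
    then have "m a b \<in> carrier ?R" using that by (intro m) auto
    then show "scale (Poly_Mapping.lookup F a * Poly_Mapping.lookup G b) (m a b) \<in> carrier ?R"
      using that keys_scale[of _ "m a b"] by (auto intro!: C)
  qed
  show "abelian_group ?R"
  proof (rule abelian_groupI)
    fix F assume F: "F \<in> carrier ?R"
    then show "\<exists>G\<in>carrier ?R. G \<oplus>\<^bsub>?R\<^esub> F = \<zero>\<^bsub>?R\<^esub>"
      by (intro bexI[of _ "- F"]) (auto simp: C)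
  qed (auto simp: add[simplified] C add_ac dest: subsetD[OF keys_add] intro!: C simp: lookup_add)
  show "Group.monoid ?R"
  proof (rule monoidI)
    fix F G H assume "F \<in> carrier ?R" "G \<in> carrier ?R" "H \<in> carrier ?R"
    then show "F \<otimes>\<^bsub>?R\<^esub> G \<otimes>\<^bsub>?R\<^esub> H = F \<otimes>\<^bsub>?R\<^esub> (G \<otimes>\<^bsub>?R\<^esub> H)"
      by (simp add: bilinear_ext_assoc[OF assoc])
  next
    fix F assume F: "F \<in> carrier ?R"
    then have "bilinear_ext m e F = (\<Sum>b\<in>Poly_Mapping.keys F. scale (Poly_Mapping.lookup F b) (Poly_Mapping.single b 1))"
      by (subst bilinear_ext_linear_right) (auto intro!: sum.cong simp: unit)
    then show "\<one>\<^bsub>?R\<^esub> \<otimes>\<^bsub>?R\<^esub> F = F" by (simp add: sum_scale_single)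
    from F have "bilinear_ext m F e = (\<Sum>b\<in>Poly_Mapping.keys F. scale (Poly_Mapping.lookup F b) (Poly_Mapping.single b 1))"
      by (subst bilinear_ext_linear_left) (auto intro!: sum.cong simp: unit)
    then show "F \<otimes>\<^bsub>?R\<^esub> \<one>\<^bsub>?R\<^esub> = F" by (simp add: sum_scale_single)
  qed (use mult e in auto)
qed (simp_all add: bilinear_ext_add_left bilinear_ext_add_right)

section \<open>The algebra of an arrangement\<close>

definition monom_subst :: "(nat \<Rightarrow> zpoly) \<Rightarrow> (nat \<Rightarrow>\<^sub>0 nat) \<Rightarrow> zpoly" where
  "monom_subst \<sigma> m = (\<Prod>j\<in>Poly_Mapping.keys m. \<sigma> j ^ Poly_Mapping.lookup m j)"

lemma monom_subst_eq:
  "finite K \<Longrightarrow> Poly_Mapping.keys m \<subseteq> K \<Longrightarrow> monom_subst \<sigma> m = (\<Prod>j\<in>K. \<sigma> j ^ Poly_Mapping.lookup m j)"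
  unfolding monom_subst_def by (intro prod.mono_neutral_left) (auto simp: in_keys_iff)

lemma monom_subst_add: "monom_subst \<sigma> (m + m') = monom_subst \<sigma> m * monom_subst \<sigma> m'"
proof -
  let ?K = "Poly_Mapping.keys m \<union> Poly_Mapping.keys m'"
  have "Poly_Mapping.keys (m + m') \<subseteq> ?K" by (rule keys_add)
  then show ?thesis
    by (subst (1 2 3) monom_subst_eq[where K = ?K]) (auto simp: lookup_add power_add prod.distrib)
qed

lemma poly_subst_eq:
  assumes "finite K" "Poly_Mapping.keys p \<subseteq> K"
  shows "poly_subst \<sigma> p = (\<Sum>m\<in>K. of_int (Poly_Mapping.lookup p m) * monom_subst \<sigma> m)"
  unfolding poly_subst_def monom_subst_def[symmetric]
  by (intro sum.mono_neutral_left assms) (auto simp: in_keys_iff)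

lemma poly_subst_add: "poly_subst \<sigma> (p + q) = poly_subst \<sigma> p + poly_subst \<sigma> q"
proof -
  let ?K = "Poly_Mapping.keys p \<union> Poly_Mapping.keys q"
  have "Poly_Mapping.keys (p + q) \<subseteq> ?K" by (rule keys_add)
  then show ?thesis
    by (subst (1 2 3) poly_subst_eq[where K = ?K]) (auto simp: lookup_add distrib_right sum.distrib)
qed

lemma poly_subst_single [simp]:
  "poly_subst \<sigma> (Poly_Mapping.single m c) = of_int c * monom_subst \<sigma> m"
  by (subst poly_subst_eq[where K = "{m}"]) auto

lemma poly_subst_zero [simp]: "poly_subst \<sigma> 0 = 0"
  by (simp add: poly_subst_def)

lemma poly_subst_sum: "poly_subst \<sigma> (\<Sum>i\<in>I. f i) = (\<Sum>i\<in>I. poly_subst \<sigma> (f i))"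
  by (induction I rule: infinite_finite_induct) (auto simp: poly_subst_add)

text \<open>Both factors are written as sums of monomials, so that only additivity and
  \<open>monom_subst_add\<close> are involved.\<close>

lemma poly_subst_mult: "poly_subst \<sigma> (p * q) = poly_subst \<sigma> p * poly_subst \<sigma> q"
proof -
  let ?P = "\<lambda>p. \<Sum>m\<in>Poly_Mapping.keys p. Poly_Mapping.single m (Poly_Mapping.lookup p m)"
  have "poly_subst \<sigma> (?P p * ?P q) = poly_subst \<sigma> (?P p) * poly_subst \<sigma> (?P q)"
    by (simp add: sum_product poly_subst_sum mult_single monom_subst_add mult_ac)
  then show ?thesis by (simp add: sum_scale_single)
qed

lemma poly_subst_one [simp]: "poly_subst \<sigma> 1 = 1"
  by (simp flip: single_one add: monom_subst_def)

lemma poly_subst_uvar [simp]: "poly_subst \<sigma> (uvar j) = \<sigma> j"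
  by (simp add: uvar_def monom_subst_def)

lemma poly_subst_uprod: "poly_subst \<sigma> (uprod S) = (\<Prod>i\<in>S. \<sigma> i)"
  unfolding uprod_def by (induction S rule: infinite_finite_induct) (auto simp: poly_subst_mult)

section \<open>Polynomial rings over the integers and the ideals attached to pairs of
  chambers\<close>

lemma carrier_Zu: "p \<in> carrier (Zu n) \<longleftrightarrow> (\<forall>m\<in>Poly_Mapping.keys p. Poly_Mapping.keys m \<subseteq> {1..n})"
  by (simp add: Zu_def)

lemma Zu_simps [simp]:
  "\<zero>\<^bsub>Zu n\<^esub> = 0" "\<one>\<^bsub>Zu n\<^esub> = 1" "p \<oplus>\<^bsub>Zu n\<^esub> q = p + q" "p \<otimes>\<^bsub>Zu n\<^esub> q = p * q"
  by (simp_all add: Zu_def)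

lemma Zu_closed [simp, intro]:
  "0 \<in> carrier (Zu n)" "1 \<in> carrier (Zu n)"
  "p \<in> carrier (Zu n) \<Longrightarrow> q \<in> carrier (Zu n) \<Longrightarrow> p + q \<in> carrier (Zu n)"
  "p \<in> carrier (Zu n) \<Longrightarrow> q \<in> carrier (Zu n) \<Longrightarrow> p * q \<in> carrier (Zu n)"
  "p \<in> carrier (Zu n) \<Longrightarrow> - p \<in> carrier (Zu n)"
proof -
  show "p + q \<in> carrier (Zu n)" if "p \<in> carrier (Zu n)" "q \<in> carrier (Zu n)"
    using that keys_add[of p q] unfolding carrier_Zu by blast
  show "p * q \<in> carrier (Zu n)" if pq: "p \<in> carrier (Zu n)" "q \<in> carrier (Zu n)"
    unfolding carrier_Zu
  proof
    fix m assume "m \<in> Poly_Mapping.keys (p * q)"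
    then obtain a b where "m = a + b" "a \<in> Poly_Mapping.keys p" "b \<in> Poly_Mapping.keys q"
      using keys_mult[of p q] by blast
    then show "Poly_Mapping.keys m \<subseteq> {1..n}"
      using pq keys_add[of a b] unfolding carrier_Zu by blast
  qed
qed (simp_all add: carrier_Zu)

lemma ring_Zu: "ring (Zu n)"
proof (rule ringI)
  show "abelian_group (Zu n)"
    by (rule abelian_groupI) (auto simp: add_ac intro!: bexI[of _ "- _"])
  show "Group.monoid (Zu n)" by (rule monoidI) (auto simp: mult_ac)
qed (auto simp: algebra_simps)

lemma uvar_closed [simp]: "1 \<le> i \<Longrightarrow> i \<le> n \<Longrightarrow> uvar i \<in> carrier (Zu n)"
  by (auto simp: uvar_def carrier_Zu)

lemma Zu_prod_closed: "(\<And>i. i \<in> S \<Longrightarrow> f i \<in> carrier (Zu n)) \<Longrightarrow> (\<Prod>i\<in>S. f i) \<in> carrier (Zu n)"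
  by (induction S rule: infinite_finite_induct) auto

lemma Zu_sum_closed: "(\<And>i. i \<in> S \<Longrightarrow> f i \<in> carrier (Zu n)) \<Longrightarrow> (\<Sum>i\<in>S. f i) \<in> carrier (Zu n)"
  by (induction S rule: infinite_finite_induct) auto

lemma uprod_closed: "S \<subseteq> {1..n} \<Longrightarrow> uprod S \<in> carrier (Zu n)"
  unfolding uprod_def by (rule Zu_prod_closed) auto

lemma Zu_of_int_closed: "of_int c \<in> carrier (Zu n)"
  by (simp add: carrier_Zu flip: single_of_int)

lemma Zu_power_closed: "p \<in> carrier (Zu n) \<Longrightarrow> p ^ i \<in> carrier (Zu n)"
  by (induction i) auto

lemma poly_subst_closed:
  assumes \<sigma>: "\<And>j. j \<in> {1..n} \<Longrightarrow> \<sigma> j \<in> carrier (Zu n')" and p: "p \<in> carrier (Zu n)"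
  shows "poly_subst \<sigma> p \<in> carrier (Zu n')"
  unfolding poly_subst_def
proof (intro Zu_sum_closed Zu_closed(4) Zu_of_int_closed Zu_prod_closed Zu_power_closed \<sigma>)
  fix m j assume "m \<in> Poly_Mapping.keys p" "j \<in> Poly_Mapping.keys m"
  then show "j \<in> {1..n}" using p unfolding carrier_Zu by blast
qed

text \<open>The elements of the carrier that satisfy \<open>P\<close> form an ideal containing
  \<open>X\<close>; closure under negation is multiplication by \<open>- 1\<close>.\<close>

lemma genideal_Zu_induct:
  assumes p: "p \<in> genideal (Zu n) X" and X: "X \<subseteq> carrier (Zu n)"
    and "\<And>x. x \<in> X \<Longrightarrow> P x" "P 0"
    and "\<And>p q. p \<in> carrier (Zu n) \<Longrightarrow> q \<in> carrier (Zu n) \<Longrightarrow> P p \<Longrightarrow> P q \<Longrightarrow> P (p + q)"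
    and mult: "\<And>p q. p \<in> carrier (Zu n) \<Longrightarrow> q \<in> carrier (Zu n) \<Longrightarrow> P p \<Longrightarrow> P (q * p)"
  shows "P p"
proof -
  interpret ring "Zu n" by (rule ring_Zu)
  have neg: "inv\<^bsub>add_monoid (Zu n)\<^esub> q = - q" if "q \<in> carrier (Zu n)" for q
  proof -
    have "\<ominus>\<^bsub>Zu n\<^esub> q = - q" using that by (intro minus_equality) auto
    then show ?thesis by (simp add: a_inv_def)
  qed
  have negP: "P (- q)" if "q \<in> carrier (Zu n)" "P q" for q
    using mult[of q "- 1"] that by simp
  have "ideal {q \<in> carrier (Zu n). P q} (Zu n)"
  proof (rule idealI[OF ring_Zu])
    show "subgroup {q \<in> carrier (Zu n). P q} (add_monoid (Zu n))"
    proof (rule subgroup.intro)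
      fix q assume "q \<in> {q \<in> carrier (Zu n). P q}"
      then have "q \<in> carrier (Zu n)" "P q" by auto
      then show "inv\<^bsub>add_monoid (Zu n)\<^esub> q \<in> {q \<in> carrier (Zu n). P q}"
        unfolding neg[OF \<open>q \<in> carrier (Zu n)\<close>] by (simp add: negP)
    qed (use assms in auto)
    fix a x assume "a \<in> {q \<in> carrier (Zu n). P q}" "x \<in> carrier (Zu n)"
    then show "x \<otimes>\<^bsub>Zu n\<^esub> a \<in> {q \<in> carrier (Zu n). P q}" "a \<otimes>\<^bsub>Zu n\<^esub> x \<in> {q \<in> carrier (Zu n). P q}"
      using mult[of a x] by (auto simp: mult.commute)
  qed
  then have "genideal (Zu n) X \<subseteq> {q \<in> carrier (Zu n). P q}"
    by (rule genideal_minimal) (use assms in auto)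
  then show ?thesis using p by auto
qed

lemma Rideal_gens: "{uprod S | S. S \<subseteq> {1..n} \<and> Delta n A \<alpha> \<inter> Delta n A \<beta> \<inter> HS A S = {}} \<subseteq> carrier (Zu n)"
  by (auto intro: uprod_closed[THEN subsetD[rotated]] simp: uprod_closed)

lemma ideal_Rideal: "ideal (Rideal n A \<alpha> \<beta>) (Zu n)"
  unfolding Rideal_def by (rule ring.genideal_ideal[OF ring_Zu Rideal_gens])

lemma Rideal_closed:
  "p \<in> Rideal n A \<alpha> \<beta> \<Longrightarrow> p \<in> carrier (Zu n)"
  "0 \<in> Rideal n A \<alpha> \<beta>"
  "p \<in> Rideal n A \<alpha> \<beta> \<Longrightarrow> q \<in> Rideal n A \<alpha> \<beta> \<Longrightarrow> p + q \<in> Rideal n A \<alpha> \<beta>"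
  "p \<in> Rideal n A \<alpha> \<beta> \<Longrightarrow> q \<in> carrier (Zu n) \<Longrightarrow> q * p \<in> Rideal n A \<alpha> \<beta>"
  "p \<in> Rideal n A \<alpha> \<beta> \<Longrightarrow> q \<in> carrier (Zu n) \<Longrightarrow> p * q \<in> Rideal n A \<alpha> \<beta>"
  "p \<in> Rideal n A \<alpha> \<beta> \<Longrightarrow> - p \<in> Rideal n A \<alpha> \<beta>"
proof -
  interpret ideal "Rideal n A \<alpha> \<beta>" "Zu n" by (rule ideal_Rideal)
  show "p \<in> Rideal n A \<alpha> \<beta> \<Longrightarrow> p \<in> carrier (Zu n)" by (rule a_Hcarr)
  show "0 \<in> Rideal n A \<alpha> \<beta>" using additive_subgroup.zero_closed[OF additive_subgroup_axioms] by simp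
  show "p \<in> Rideal n A \<alpha> \<beta> \<Longrightarrow> q \<in> Rideal n A \<alpha> \<beta> \<Longrightarrow> p + q \<in> Rideal n A \<alpha> \<beta>"
    using additive_subgroup.a_closed[OF additive_subgroup_axioms, of p q] by simp
  show *: "p \<in> Rideal n A \<alpha> \<beta> \<Longrightarrow> q \<in> carrier (Zu n) \<Longrightarrow> q * p \<in> Rideal n A \<alpha> \<beta>" for q
    using I_l_closed[of p q] by simp
  show "p \<in> Rideal n A \<alpha> \<beta> \<Longrightarrow> q \<in> carrier (Zu n) \<Longrightarrow> p * q \<in> Rideal n A \<alpha> \<beta>"
    using I_r_closed[of p q] by simp
  show "p \<in> Rideal n A \<alpha> \<beta> \<Longrightarrow> - p \<in> Rideal n A \<alpha> \<beta>"
    using *[of "- 1"] by simp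
qed

lemma uprod_in_Rideal:
  "S \<subseteq> {1..n} \<Longrightarrow> Delta n A \<alpha> \<inter> Delta n A \<beta> \<inter> HS A S = {} \<Longrightarrow> uprod S \<in> Rideal n A \<alpha> \<beta>"
  unfolding Rideal_def by (rule subsetD[OF ring.genideal_self[OF ring_Zu Rideal_gens]]) blast

lemma Rideal_induct:
  assumes "p \<in> Rideal n A \<alpha> \<beta>"
    and "\<And>S. S \<subseteq> {1..n} \<Longrightarrow> Delta n A \<alpha> \<inter> Delta n A \<beta> \<inter> HS A S = {} \<Longrightarrow> P (uprod S)" "P 0"
    and "\<And>p q. p \<in> carrier (Zu n) \<Longrightarrow> q \<in> carrier (Zu n) \<Longrightarrow> P p \<Longrightarrow> P q \<Longrightarrow> P (p + q)"
    and "\<And>p q. p \<in> carrier (Zu n) \<Longrightarrow> q \<in> carrier (Zu n) \<Longrightarrow> P p \<Longrightarrow> P (q * p)"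
  shows "P p"
  by (rule genideal_Zu_induct[OF assms(1)[unfolded Rideal_def] Rideal_gens]) (use assms in auto)

text \<open>Setting all variables to 0 kills every generator: \<open>S\<close> cannot be empty
  there, because \<open>HS A {}\<close> is the whole affine space. This is how the idempotent of a
  feasible sign vector is seen to be nonzero.\<close>

lemma one_notin_Rideal:
  assumes "Delta n A \<alpha> \<inter> Delta n A \<beta> \<noteq> {}"
  shows "1 \<notin> Rideal n A \<alpha> \<beta>"
proof
  assume "1 \<in> Rideal n A \<alpha> \<beta>"
  then have "poly_subst (\<lambda>_. 0) 1 = 0"
  proof (rule Rideal_induct)
    fix S assume S: "S \<subseteq> {1..n}" "Delta n A \<alpha> \<inter> Delta n A \<beta> \<inter> HS A S = {}"
    have "S \<noteq> {}" using S(2) assms by (auto simp: HS_def Delta_def)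
    moreover have "finite S" using S(1) by (rule finite_subset) simp
    ultimately show "poly_subst (\<lambda>_. 0) (uprod S) = 0"
      by (auto simp: poly_subst_uprod)
  qed (simp_all add: poly_subst_add poly_subst_mult)
  then show False by simp
qed

lemma sgn_at_cases: "\<alpha> \<in> signs n \<Longrightarrow> i \<le> n \<Longrightarrow> sgn_at \<alpha> i = 1 \<or> sgn_at \<alpha> i = -1"
proof (cases i)
  case (Suc j)
  assume "\<alpha> \<in> signs n" "i \<le> n"
  then have "set \<alpha> \<subseteq> {1, -1}" "j < length \<alpha>" by (auto simp: signs_def Suc)
  then have "\<alpha> ! j \<in> {1, -1}" using nth_mem by blast
  then show ?thesis by (simp add: sgn_at_def Suc)
qed (simp add: sgn_at_def)

lemma finite_PP: "finite (PP n A)"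
proof -
  have "finite {\<alpha> :: sgnvec. set \<alpha> \<subseteq> {1, -1} \<and> length \<alpha> = n}" by (rule finite_lists_length_eq) simp
  then show ?thesis by (rule rev_finite_subset) (auto simp: PP_def signs_def)
qed

lemma PP_signs: "\<alpha> \<in> PP n A \<Longrightarrow> \<alpha> \<in> signs n"
  by (simp add: PP_def)

text \<open>With only two signs available, outside \<open>Sdiff\<close> the entry of \<beta> agrees
  with that of \<alpha> or of \<gamma>; on \<open>Sdiff\<close> the coordinate is 0. The
  compatibility of the product with the ideals rests on this.\<close>

lemma Delta_between:
  assumes s: "\<alpha> \<in> signs n" "\<beta> \<in> signs n" "\<gamma> \<in> signs n"
    and x: "x \<in> Delta n A \<alpha>" "x \<in> Delta n A \<gamma>" "x \<in> HS A (Sdiff n \<alpha> \<beta> \<gamma>)"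
  shows "x \<in> Delta n A \<beta>"
  unfolding Delta_def
proof (intro CollectI conjI ballI)
  show "x \<in> vcoset A" using x by (simp add: Delta_def)
  fix i assume i: "i \<in> {1..n}"
  show "0 \<le> real_of_int (sgn_at \<beta> i) * poly_mapping.lookup x i"
  proof (cases "i \<in> Sdiff n \<alpha> \<beta> \<gamma>")
    case True
    then show ?thesis using x by (simp add: HS_def)
  next
    case False
    have "0 \<le> real_of_int (sgn_at \<alpha> i) * poly_mapping.lookup x i" "0 \<le> real_of_int (sgn_at \<gamma> i) * poly_mapping.lookup x i"
      using x i by (auto simp: Delta_def)
    moreover have "sgn_at \<alpha> i = sgn_at \<beta> i \<or> sgn_at \<gamma> i = sgn_at \<beta> i"
      using False i s[THEN sgn_at_cases, of i] by (auto simp: Sdiff_def)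
    ultimately show ?thesis by metis
  qed
qed

lemma Sdiff_subset: "Sdiff n \<alpha> \<beta> \<gamma> \<subseteq> {1..n}" by (auto simp: Sdiff_def)

lemma HS_Un: "HS A (S \<union> T) = HS A S \<inter> HS A T" by (auto simp: HS_def)

lemma uprod_Un_Int: "finite S \<Longrightarrow> finite T \<Longrightarrow> uprod S * uprod T = uprod (S \<union> T) * uprod (S \<inter> T)"
  unfolding uprod_def by (simp add: prod.union_inter)

text \<open>The product of \<open>uprod S\<close> and \<open>uprod D\<close> is the product of
  \<open>uprod (S \<union> D)\<close> and \<open>uprod (S \<inter> D)\<close>, and by
  \<open>sub\<close> the union again indexes a generator. The intersection only contributes a
  factor.\<close>

lemma Rideal_Sdiff_aux:
  assumes p: "p \<in> Rideal n A \<alpha>' \<beta>'"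
    and sub: "Delta n A \<alpha> \<inter> Delta n A \<gamma> \<inter> HS A D \<subseteq> Delta n A \<alpha>' \<inter> Delta n A \<beta>'" and D: "D \<subseteq> {1..n}"
  shows "p * uprod D \<in> Rideal n A \<alpha> \<gamma>"
  using p
proof (rule Rideal_induct)
  fix S assume S: "S \<subseteq> {1..n}" "Delta n A \<alpha>' \<inter> Delta n A \<beta>' \<inter> HS A S = {}"
  have "uprod (S \<union> D) \<in> Rideal n A \<alpha> \<gamma>"
    by (rule uprod_in_Rideal) (use S D sub in \<open>auto simp: HS_Un\<close>)
  then have "uprod (S \<union> D) * uprod (S \<inter> D) \<in> Rideal n A \<alpha> \<gamma>"
    by (rule Rideal_closed(5)) (use S in \<open>auto intro!: uprod_closed\<close>)
  moreover have "finite S" "finite D" using S D finite_subset by blast+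
  ultimately show "uprod S * uprod D \<in> Rideal n A \<alpha> \<gamma>" by (simp only: uprod_Un_Int[of S D])
next
  fix p q assume "p \<in> carrier (Zu n)" "q \<in> carrier (Zu n)" "p * uprod D \<in> Rideal n A \<alpha> \<gamma>"
  then have "q * (p * uprod D) \<in> Rideal n A \<alpha> \<gamma>" using Rideal_closed(4) by blast
  then show "q * p * uprod D \<in> Rideal n A \<alpha> \<gamma>" by (simp only: mult.assoc)
next
  fix p q assume "p * uprod D \<in> Rideal n A \<alpha> \<gamma>" "q * uprod D \<in> Rideal n A \<alpha> \<gamma>"
  then have "p * uprod D + q * uprod D \<in> Rideal n A \<alpha> \<gamma>" by (rule Rideal_closed(3))
  then show "(p + q) * uprod D \<in> Rideal n A \<alpha> \<gamma>" by (simp only: distrib_right)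
next
  show "0 * uprod D \<in> Rideal n A \<alpha> \<gamma>" by (simp add: Rideal_closed(2))
qed

text \<open>The two halves let the product of the free module descend to the quotient, one for each
  factor.\<close>

lemma Rideal_Sdiff:
  assumes "\<alpha> \<in> signs n" "\<beta> \<in> signs n" "\<gamma> \<in> signs n"
  shows "p \<in> Rideal n A \<alpha> \<beta> \<Longrightarrow> p * uprod (Sdiff n \<alpha> \<beta> \<gamma>) \<in> Rideal n A \<alpha> \<gamma>"
    and "p \<in> Rideal n A \<beta> \<gamma> \<Longrightarrow> p * uprod (Sdiff n \<alpha> \<beta> \<gamma>) \<in> Rideal n A \<alpha> \<gamma>"
proof -
  have "Delta n A \<alpha> \<inter> Delta n A \<gamma> \<inter> HS A (Sdiff n \<alpha> \<beta> \<gamma>) \<subseteq> Delta n A \<beta>"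
    using Delta_between[OF assms] by blast
  then have "Delta n A \<alpha> \<inter> Delta n A \<gamma> \<inter> HS A (Sdiff n \<alpha> \<beta> \<gamma>) \<subseteq> Delta n A \<alpha> \<inter> Delta n A \<beta>"
    "Delta n A \<alpha> \<inter> Delta n A \<gamma> \<inter> HS A (Sdiff n \<alpha> \<beta> \<gamma>) \<subseteq> Delta n A \<beta> \<inter> Delta n A \<gamma>" by auto
  then show "p \<in> Rideal n A \<alpha> \<beta> \<Longrightarrow> p * uprod (Sdiff n \<alpha> \<beta> \<gamma>) \<in> Rideal n A \<alpha> \<gamma>"
    and "p \<in> Rideal n A \<beta> \<gamma> \<Longrightarrow> p * uprod (Sdiff n \<alpha> \<beta> \<gamma>) \<in> Rideal n A \<alpha> \<gamma>"
    using Sdiff_subset by (blast intro: Rideal_Sdiff_aux)+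
qed

lemma uprod_Sdiff: "uprod (Sdiff n \<alpha> \<beta> \<gamma>) =
    (\<Prod>i\<in>{1..n}. if sgn_at \<alpha> i = sgn_at \<gamma> i \<and> sgn_at \<alpha> i \<noteq> sgn_at \<beta> i then uvar i else 1)"
  unfolding uprod_def Sdiff_def by (rule prod.inter_filter) simp

text \<open>Both sides count, for each hyperplane, half the crossings that the path
  \<open>\<alpha>, \<beta>, \<gamma>, \<delta>\<close> makes in excess of the direct path \<open>\<alpha>, \<delta>\<close>.\<close>

lemma uprod_Sdiff_cocycle:
  assumes "\<alpha> \<in> signs n" "\<beta> \<in> signs n" "\<gamma> \<in> signs n" "\<delta> \<in> signs n"
  shows "uprod (Sdiff n \<alpha> \<beta> \<gamma>) * uprod (Sdiff n \<alpha> \<gamma> \<delta>) = uprod (Sdiff n \<alpha> \<beta> \<delta>) * uprod (Sdiff n \<beta> \<gamma> \<delta>)"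
  unfolding uprod_Sdiff prod.distrib[symmetric]
proof (rule prod.cong)
  fix i assume "i \<in> {1..n}"
  then have "i \<le> n" by simp
  then show "(if sgn_at \<alpha> i = sgn_at \<gamma> i \<and> sgn_at \<alpha> i \<noteq> sgn_at \<beta> i then uvar i else 1) *
         (if sgn_at \<alpha> i = sgn_at \<delta> i \<and> sgn_at \<alpha> i \<noteq> sgn_at \<gamma> i then uvar i else 1) =
         (if sgn_at \<alpha> i = sgn_at \<delta> i \<and> sgn_at \<alpha> i \<noteq> sgn_at \<beta> i then uvar i else 1) *
         (if sgn_at \<beta> i = sgn_at \<delta> i \<and> sgn_at \<beta> i \<noteq> sgn_at \<gamma> i then uvar i else 1)"
    using assms[THEN sgn_at_cases, OF \<open>i \<le> n\<close>] by (elim disjE) simp_all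
qed simp

section \<open>The free algebra on the symbols and its quotient\<close>

lemma carrier_Bfree: "F \<in> carrier (Bfree n A) \<longleftrightarrow>
    Poly_Mapping.keys F \<subseteq> PP n A \<times> PP n A \<and> (\<forall>b. Poly_Mapping.lookup F b \<in> carrier (Zu n))"
  by (simp add: Bfree_def)

lemma Bfree_simps [simp]:
  "\<zero>\<^bsub>Bfree n A\<^esub> = 0" "\<one>\<^bsub>Bfree n A\<^esub> = (\<Sum>\<alpha>\<in>PP n A. Poly_Mapping.single (\<alpha>, \<alpha>) 1)"
  "F \<oplus>\<^bsub>Bfree n A\<^esub> G = F + G" "F \<otimes>\<^bsub>Bfree n A\<^esub> G = bilinear_ext (fmult n) F G"
  by (simp_all add: Bfree_def)

lemma single_in_Bfree:
  "\<alpha> \<in> PP n A \<Longrightarrow> \<beta> \<in> PP n A \<Longrightarrow> p \<in> carrier (Zu n) \<Longrightarrow> Poly_Mapping.single (\<alpha>, \<beta>) p \<in> carrier (Bfree n A)"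
  by (auto simp: carrier_Bfree lookup_single when_def)

lemma Bfree_sum_closed:
  "(\<And>i. i \<in> I \<Longrightarrow> f i \<in> carrier (Bfree n A)) \<Longrightarrow> (\<Sum>i\<in>I. f i) \<in> carrier (Bfree n A)"
  unfolding Bfree_def by (rule based_ring_sum_closed) auto

lemma fmult_closed:
  "a \<in> PP n A \<times> PP n A \<Longrightarrow> b \<in> PP n A \<times> PP n A \<Longrightarrow> fmult n a b \<in> carrier (Bfree n A)"
  by (auto simp: fmult_def intro!: single_in_Bfree uprod_closed Sdiff_subset) (simp add: carrier_Bfree)

lemma Sdiff_trivial [simp]: "Sdiff n \<alpha> \<alpha> \<beta> = {}" "Sdiff n \<alpha> \<beta> \<beta> = {}"
  by (auto simp: Sdiff_def)

lemma uprod_empty [simp]: "uprod {} = 1" by (simp add: uprod_def)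

lemma ring_Bfree: "ring (Bfree n A)"
proof -
  let ?e = "\<Sum>\<alpha>\<in>PP n A. Poly_Mapping.single (\<alpha>, \<alpha>) (1 :: zpoly)"
  have "ring (based_ring (PP n A \<times> PP n A) (carrier (Zu n)) (fmult n) ?e)"
  proof (rule ring_based_ring)
    fix a b c assume *: "a \<in> PP n A \<times> PP n A" "b \<in> PP n A \<times> PP n A" "c \<in> PP n A \<times> PP n A"
    obtain \<alpha> \<beta> \<beta>' \<gamma> \<gamma>' \<delta> where [simp]: "a = (\<alpha>, \<beta>)" "b = (\<beta>', \<gamma>)" "c = (\<gamma>', \<delta>)"
      by (metis surj_pair)
    have "uprod (Sdiff n \<alpha> \<beta> \<gamma>) * uprod (Sdiff n \<alpha> \<gamma> \<delta>) = uprod (Sdiff n \<beta> \<gamma> \<delta>) * uprod (Sdiff n \<alpha> \<beta> \<delta>)"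
      using * by (subst uprod_Sdiff_cocycle) (auto simp: PP_signs mult.commute)
    then show "bilinear_ext (fmult n) (fmult n a b) (Poly_Mapping.single c 1) =
        bilinear_ext (fmult n) (Poly_Mapping.single a 1) (fmult n b c)"
      by (auto simp: fmult_def)
  next
    fix b assume b: "b \<in> PP n A \<times> PP n A"
    then obtain \<beta> \<gamma> where [simp]: "b = (\<beta>, \<gamma>)" and "\<beta> \<in> PP n A" "\<gamma> \<in> PP n A" by auto
    then show "bilinear_ext (fmult n) ?e (Poly_Mapping.single b 1) = Poly_Mapping.single b 1"
      "bilinear_ext (fmult n) (Poly_Mapping.single b 1) ?e = Poly_Mapping.single b 1"
      by (auto simp: bilinear_ext_sum_left bilinear_ext_sum_right fmult_def finite_PP if_distrib[of "scale _"]
          sum.delta sum.delta' cong: if_cong)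
  qed (auto simp: Bfree_def[symmetric] intro!: fmult_closed Bfree_sum_closed single_in_Bfree simp del: based_ring_simps)
  then show ?thesis by (simp add: Bfree_def)
qed

lemma Bideal_iff: "F \<in> Bideal n A \<longleftrightarrow>
   Poly_Mapping.keys F \<subseteq> PP n A \<times> PP n A \<and> (\<forall>\<alpha> \<beta>. Poly_Mapping.lookup F (\<alpha>, \<beta>) \<in> Rideal n A \<alpha> \<beta>)"
  unfolding Bideal_def carrier_Bfree using Rideal_closed(1) by (auto; blast)

lemma Bideal_add: "F \<in> Bideal n A \<Longrightarrow> G \<in> Bideal n A \<Longrightarrow> F + G \<in> Bideal n A"
  using keys_add[of F G] by (auto simp: Bideal_iff lookup_add Rideal_closed)

lemma Bideal_zero: "0 \<in> Bideal n A"
  by (auto simp: Bideal_iff Rideal_closed)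

lemma Bideal_neg: "F \<in> Bideal n A \<Longrightarrow> - F \<in> Bideal n A"
  by (auto simp: Bideal_iff Rideal_closed)

lemma Bideal_sum: "(\<And>i. i \<in> I \<Longrightarrow> f i \<in> Bideal n A) \<Longrightarrow> (\<Sum>i\<in>I. f i) \<in> Bideal n A"
  by (induction I rule: infinite_finite_induct) (auto simp: Bideal_add Bideal_zero)

lemma Bideal_scale: "F \<in> Bideal n A \<Longrightarrow> c \<in> carrier (Zu n) \<Longrightarrow> scale c F \<in> Bideal n A"
  using keys_scale[of c F] by (auto simp: Bideal_iff Rideal_closed)

lemma Bideal_single: "\<alpha> \<in> PP n A \<Longrightarrow> \<beta> \<in> PP n A \<Longrightarrow> p \<in> Rideal n A \<alpha> \<beta> \<Longrightarrow> Poly_Mapping.single (\<alpha>, \<beta>) p \<in> Bideal n A"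
  by (auto simp: Bideal_iff lookup_single when_def Rideal_closed)

lemma Bfree_a_inv: "F \<in> carrier (Bfree n A) \<Longrightarrow> \<ominus>\<^bsub>Bfree n A\<^esub> F = - F"
proof -
  interpret ring "Bfree n A" by (rule ring_Bfree)
  show "F \<in> carrier (Bfree n A) \<Longrightarrow> \<ominus>\<^bsub>Bfree n A\<^esub> F = - F"
    by (rule minus_equality) (auto simp: carrier_Bfree)
qed

lemma ideal_Bideal: "ideal (Bideal n A) (Bfree n A)"
proof (rule idealI[OF ring_Bfree])
  show "subgroup (Bideal n A) (add_monoid (Bfree n A))"
  proof
    show "Bideal n A \<subseteq> carrier (add_monoid (Bfree n A))" by (auto simp: Bideal_def)
    fix F assume F: "F \<in> Bideal n A"
    then have "F \<in> carrier (Bfree n A)" by (simp add: Bideal_def)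
    from Bfree_a_inv[OF this, unfolded a_inv_def] show "inv\<^bsub>add_monoid (Bfree n A)\<^esub> F \<in> Bideal n A"
      using Bideal_neg[OF F] by argo
  qed (auto simp: Bideal_add Bideal_zero)
  fix F G assume F: "F \<in> Bideal n A" and G: "G \<in> carrier (Bfree n A)"
  \<comment> \<open>\<open>c\<close> and \<open>d\<close> are coefficients of the two factors.
    Whichever of them lies in its ideal, the matching half of \<open>Rideal_Sdiff\<close> applies,
    and the other coefficient is absorbed.\<close>
  have term_in: "scale (c * d) (fmult n (\<alpha>, \<beta>) (\<beta>', \<gamma>)) \<in> Bideal n A"
    if "\<alpha> \<in> PP n A" "\<beta> \<in> PP n A" "\<gamma> \<in> PP n A" "c \<in> carrier (Zu n)" "d \<in> carrier (Zu n)"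
      "c \<in> Rideal n A \<alpha> \<beta> \<or> d \<in> Rideal n A \<beta>' \<gamma>" for c d \<alpha> \<beta> \<beta>' \<gamma>
  proof (cases "\<beta> = \<beta>'")
    case True
    have "c * uprod (Sdiff n \<alpha> \<beta> \<gamma>) * d \<in> Rideal n A \<alpha> \<gamma> \<or> d * uprod (Sdiff n \<alpha> \<beta> \<gamma>) * c \<in> Rideal n A \<alpha> \<gamma>"
      using that True Rideal_Sdiff[of \<alpha> n \<beta> \<gamma>] by (meson PP_signs Rideal_closed(5))
    then have "c * d * uprod (Sdiff n \<alpha> \<beta> \<gamma>) \<in> Rideal n A \<alpha> \<gamma>" by (simp add: mult_ac)
    then show ?thesis using that True by (simp add: fmult_def Bideal_single)
  qed (simp add: fmult_def Bideal_zero)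
  note F' = F[unfolded Bideal_iff] and G' = G[unfolded carrier_Bfree]
  have F'': "Poly_Mapping.lookup F b \<in> carrier (Zu n)" for b
    using F' Rideal_closed(1) by (cases b) blast
  show "G \<otimes>\<^bsub>Bfree n A\<^esub> F \<in> Bideal n A"
    unfolding Bfree_simps bilinear_ext_def
    by (intro Bideal_sum) (use F' F'' G' in \<open>auto intro!: term_in\<close>)
  show "F \<otimes>\<^bsub>Bfree n A\<^esub> G \<in> Bideal n A"
    unfolding Bfree_simps bilinear_ext_def
    by (intro Bideal_sum) (use F' F'' G' in \<open>auto intro!: term_in\<close>)
qed

lemma ring_Btilde: "ring (Btilde n A)"
  unfolding Btilde_def by (rule ideal.quotient_is_ring[OF ideal_Bideal])

section \<open>Paths modulo relations\<close>

lemma rcos_closed_elim: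
  assumes "X \<in> carrier (R Quot I)"
  obtains a where "a \<in> carrier R" "X = I +>\<^bsub>R\<^esub> a"
  using assms by (auto simp: FactRing_def A_RCOSETS_def RCOSETS_def a_r_coset_def)

text \<open>Membership conditions replace the defining set equations as simplification rules. It is
  \<open>1 \<le> i\<close> that keeps \<open>i - 1\<close> and \<open>i\<close> apart under
  truncated subtraction.\<close>

lemma is_arrow_simps:
  "is_arrow n (ArrR i) x \<longleftrightarrow> 1 \<le> i \<and> i \<le> n \<and> i - 1 \<in> x \<and> i \<notin> x"
  "is_arrow n (ArrL i) x \<longleftrightarrow> 1 \<le> i \<and> i \<le> n \<and> i - 1 \<notin> x \<and> i \<in> x"
proof -
  have *: "x \<inter> {a, b} = {a} \<longleftrightarrow> a \<in> x \<and> b \<notin> x" "x \<inter> {a, b} = {b} \<longleftrightarrow> a \<notin> x \<and> b \<in> x" if "a \<noteq> b" for a b :: nat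
    using that by auto
  have "i - 1 \<noteq> i" if "1 \<le> i" using that by simp
  then show "is_arrow n (ArrR i) x \<longleftrightarrow> 1 \<le> i \<and> i \<le> n \<and> i - 1 \<in> x \<and> i \<notin> x"
    "is_arrow n (ArrL i) x \<longleftrightarrow> 1 \<le> i \<and> i \<le> n \<and> i - 1 \<notin> x \<and> i \<in> x"
    using *[of "i - 1" i] unfolding is_arrow.simps by blast+
qed

declare is_arrow.simps(1,2) [simp del]
declare is_arrow_simps [simp]

lemma fold_target_closed:
  "is_walk n x w \<Longrightarrow> x \<in> ksubsets {0..n} k \<Longrightarrow> fold target w x \<in> ksubsets {0..n} k"
proof (induction w arbitrary: x)
  case (Cons a w)
  have fin: "finite x" using Cons.prems(2) finite_subset by (fastforce simp: ksubsets_def)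
  have "target a x \<in> ksubsets {0..n} k"
  proof (cases a)
    case (ArrR i)
    then have "i - 1 \<in> x" "i \<notin> x" "i \<le> n" using Cons.prems by auto
    then have "card (insert i (x - {i - 1})) = card x" using fin card_Suc_Diff1[of x "i - 1"] by simp
    then show ?thesis using Cons.prems \<open>i \<le> n\<close> by (auto simp: ksubsets_def ArrR)
  next
    case (ArrL i)
    then have "i - 1 \<notin> x" "i \<in> x" "i \<le> n" using Cons.prems by auto
    then have "card (insert (i - 1) (x - {i})) = card x" using fin card_Suc_Diff1[of x i] by simp
    then show ?thesis using Cons.prems \<open>i \<le> n\<close> by (auto simp: ksubsets_def ArrL)
  qed (use Cons.prems in auto)
  then show ?case using Cons by simp
qed simp

lemma is_walk_append [simp]: "is_walk n x (v @ w) \<longleftrightarrow> is_walk n x v \<and> is_walk n (fold target v x) w"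
  by (induction v arbitrary: x) auto

lemma qpaths_iff: "(x, w) \<in> qpaths n k \<longleftrightarrow> x \<in> ksubsets {0..n} k \<and> is_walk n x w"
  by (simp add: qpaths_def)

lemma finite_ksubsets: "finite X \<Longrightarrow> finite (ksubsets X k)"
  by (rule finite_subset[of _ "Pow X"]) (auto simp: ksubsets_def)

lemma carrier_path_algebra: "F \<in> carrier (path_algebra n k) \<longleftrightarrow> Poly_Mapping.keys F \<subseteq> qpaths n k"
  by (simp add: path_algebra_def)

lemma path_algebra_simps [simp]:
  "\<zero>\<^bsub>path_algebra n k\<^esub> = 0" "\<one>\<^bsub>path_algebra n k\<^esub> = (\<Sum>x\<in>ksubsets {0..n} k. Poly_Mapping.single (x, []) 1)"
  "F \<oplus>\<^bsub>path_algebra n k\<^esub> G = F + G" "F \<otimes>\<^bsub>path_algebra n k\<^esub> G = bilinear_ext path_mult F G"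
  by (simp_all add: path_algebra_def)

lemma single_in_path_algebra: "p \<in> qpaths n k \<Longrightarrow> Poly_Mapping.single p c \<in> carrier (path_algebra n k)"
  by (auto simp: carrier_path_algebra)

lemma path_algebra_sum_closed:
  "(\<And>i. i \<in> I \<Longrightarrow> f i \<in> carrier (path_algebra n k)) \<Longrightarrow> (\<Sum>i\<in>I. f i) \<in> carrier (path_algebra n k)"
  unfolding path_algebra_def by (rule based_ring_sum_closed) auto

text \<open>Applied with \<open>X = {0..n}\<close> to the unit of the path algebra and with
  \<open>X = {..<n}\<close> to the idempotent of the truncation.\<close>

lemma ksubset_mult_path:
  assumes "finite X"
  shows "bilinear_ext path_mult (\<Sum>y\<in>ksubsets X k. Poly_Mapping.single (y, []) (1::int)) (Poly_Mapping.single (x, w) 1) =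
      (if x \<in> ksubsets X k then Poly_Mapping.single (x, w) 1 else 0)"
    and "bilinear_ext path_mult (Poly_Mapping.single (x, w) (1::int)) (\<Sum>y\<in>ksubsets X k. Poly_Mapping.single (y, []) 1) =
      (if walk_end (x, w) \<in> ksubsets X k then Poly_Mapping.single (x, w) 1 else 0)"
  using finite_ksubsets[OF assms, of k]
  by (auto simp: bilinear_ext_sum_left bilinear_ext_sum_right path_mult_def walk_end_def
      if_distrib[of "scale _"] sum.delta sum.delta' cong: if_cong)

lemma ring_path_algebra: "ring (path_algebra n k)"
proof -
  let ?e = "\<Sum>x\<in>ksubsets {0..n} k. Poly_Mapping.single (x, []) (1 :: int)"
  have "ring (based_ring (qpaths n k) UNIV path_mult ?e)"
  proof (rule ring_based_ring)
    fix a b assume "a \<in> qpaths n k" "b \<in> qpaths n k"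
    then show "path_mult a b \<in> carrier (based_ring (qpaths n k) UNIV path_mult ?e)"
      by (cases a; cases b) (auto simp: path_mult_def qpaths_iff walk_end_def)
  next
    fix a b c assume "a \<in> qpaths n k" "b \<in> qpaths n k" "c \<in> qpaths n k"
    then show "bilinear_ext path_mult (path_mult a b) (Poly_Mapping.single c 1) =
        bilinear_ext path_mult (Poly_Mapping.single a 1) (path_mult b c)"
      by (cases a; cases b; cases c) (auto simp: path_mult_def walk_end_def)
  next
    fix b assume b: "b \<in> qpaths n k"
    then obtain x w where [simp]: "b = (x, w)" and x: "x \<in> ksubsets {0..n} k" "is_walk n x w"
      by (cases b) (auto simp: qpaths_iff)
    have "walk_end (x, w) \<in> ksubsets {0..n} k" using x by (simp add: walk_end_def fold_target_closed)
    with x(1) show "bilinear_ext path_mult ?e (Poly_Mapping.single b 1) = Poly_Mapping.single b 1"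
      "bilinear_ext path_mult (Poly_Mapping.single b 1) ?e = Poly_Mapping.single b 1"
      by (simp_all add: ksubset_mult_path)
  next
    show "?e \<in> carrier (based_ring (qpaths n k) UNIV path_mult ?e)"
      unfolding path_algebra_def[symmetric]
      by (intro path_algebra_sum_closed single_in_path_algebra) (auto simp: qpaths_iff)
  qed auto
  then show ?thesis by (simp add: path_algebra_def)
qed

lemma relators_closed: "relators n k \<subseteq> carrier (path_algebra n k)"
  unfolding relators_def carrier_path_algebra
  by (auto simp: carrier_path_algebra dest!: subsetD[OF keys_diff])

lemma ideal_relideal: "ideal (relideal n k) (path_algebra n k)"
  unfolding relideal_def by (rule ring.genideal_ideal[OF ring_path_algebra relators_closed])

lemma ring_BB: "ring (BB n k)"
  unfolding BB_def by (rule ideal.quotient_is_ring[OF ideal_relideal])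

section \<open>Classes of paths and their rewriting\<close>

definition qcls :: "nat \<Rightarrow> nat \<Rightarrow> (qpath \<Rightarrow>\<^sub>0 int) \<Rightarrow> (qpath \<Rightarrow>\<^sub>0 int) set" where
  "qcls n k F = relideal n k +>\<^bsub>path_algebra n k\<^esub> F"

lemma qcls_hom: "qcls n k \<in> Ring.ring_hom (path_algebra n k) (BB n k)"
  using ideal.rcos_ring_hom[OF ideal_relideal, of n k] by (simp add: BB_def qcls_def[abs_def])

lemma pcls_qcls: "pcls n k x w = qcls n k (Poly_Mapping.single (x, w) 1)"
  by (simp add: pcls_def qcls_def)

lemma
  assumes "F \<in> carrier (path_algebra n k)" "G \<in> carrier (path_algebra n k)"
  shows qcls_add: "qcls n k (F + G) = qcls n k F \<oplus>\<^bsub>BB n k\<^esub> qcls n k G"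
    and qcls_mult: "qcls n k (bilinear_ext path_mult F G) = qcls n k F \<otimes>\<^bsub>BB n k\<^esub> qcls n k G"
  using ring_hom_add[OF qcls_hom assms] ring_hom_mult[OF qcls_hom assms] by simp_all

lemma qcls_closed: "F \<in> carrier (path_algebra n k) \<Longrightarrow> qcls n k F \<in> carrier (BB n k)"
  by (rule ring_hom_closed[OF qcls_hom])

lemma qcls_zero: "qcls n k 0 = \<zero>\<^bsub>BB n k\<^esub>"
  using rng_hom_zero[OF ring_path_algebra ring_BB ring_hom_imp_rng_hom[OF qcls_hom]] by simp

lemma qcls_eqI:
  assumes "F \<in> carrier (path_algebra n k)" "G \<in> carrier (path_algebra n k)" "F - G \<in> relideal n k"
  shows "qcls n k F = qcls n k G"
proof -
  interpret ideal "relideal n k" "path_algebra n k" by (rule ideal_relideal)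
  have "F \<in> relideal n k +>\<^bsub>path_algebra n k\<^esub> G"
    using assms(3) by (auto simp: a_r_coset_def r_coset_def intro!: bexI[of _ "F - G"])
  then show ?thesis unfolding qcls_def by (rule a_repr_independence'[OF _ assms(2), symmetric])
qed

lemma pcls_mult:
  assumes "(x, w) \<in> qpaths n k" "(y, v) \<in> qpaths n k"
  shows "pcls n k x w \<otimes>\<^bsub>BB n k\<^esub> pcls n k y v =
    (if fold target w x = y then pcls n k x (w @ v) else \<zero>\<^bsub>BB n k\<^esub>)"
proof -
  have "pcls n k x w \<otimes>\<^bsub>BB n k\<^esub> pcls n k y v =
      qcls n k (bilinear_ext path_mult (Poly_Mapping.single (x, w) 1) (Poly_Mapping.single (y, v) 1))"
    unfolding pcls_qcls using assms by (simp only: qcls_mult single_in_path_algebra)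
  then show ?thesis by (simp add: path_mult_def walk_end_def pcls_qcls qcls_zero)
qed

text \<open>Equality of classes alone does not determine where a walk ends, since different walks
  may both be zero. The common end is recorded so that the relation is a congruence for
  composition.\<close>

definition path_equiv :: "nat \<Rightarrow> nat \<Rightarrow> nat set \<Rightarrow> label list \<Rightarrow> label list \<Rightarrow> bool" where
  "path_equiv n k x v w \<longleftrightarrow> is_walk n x v \<and> is_walk n x w \<and> fold target v x = fold target w x \<and>
     pcls n k x v = pcls n k x w"

lemma path_equiv_refl: "is_walk n x w \<Longrightarrow> path_equiv n k x w w"
  by (simp add: path_equiv_def)

lemma path_equiv_sym: "path_equiv n k x v w \<Longrightarrow> path_equiv n k x w v"
  by (simp add: path_equiv_def)

lemma path_equiv_trans: "path_equiv n k x u v \<Longrightarrow> path_equiv n k x v w \<Longrightarrow> path_equiv n k x u w"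
  by (simp add: path_equiv_def)

lemma path_equiv_append:
  assumes x: "x \<in> ksubsets {0..n} k" and "path_equiv n k x v v'" "path_equiv n k (fold target v x) w w'"
  shows "path_equiv n k x (v @ w) (v' @ w')"
proof -
  have y: "fold target v x \<in> ksubsets {0..n} k"
    using assms by (auto simp: path_equiv_def fold_target_closed)
  have "pcls n k x (v @ w) = pcls n k x v \<otimes>\<^bsub>BB n k\<^esub> pcls n k (fold target v x) w"
    using assms y by (subst pcls_mult) (auto simp: path_equiv_def qpaths_iff)
  moreover have "pcls n k x (v' @ w') = pcls n k x v' \<otimes>\<^bsub>BB n k\<^esub> pcls n k (fold target v x) w'"
    using assms y by (subst pcls_mult) (auto simp: path_equiv_def qpaths_iff)
  ultimately show ?thesis using assms by (simp add: path_equiv_def)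
qed

lemma path_equiv_word_eq:
  assumes "x \<in> ksubsets {0..n} k" "word_eq v w" "is_walk n x v" "is_walk n x w" "fold target v x = fold target w x"
  shows "path_equiv n k x v w"
proof -
  have "Poly_Mapping.single (x, v) 1 - Poly_Mapping.single (x, w) 1 \<in> relators n k"
    unfolding relators_def using assms by (auto simp: qpaths_iff)
  then have "Poly_Mapping.single (x, v) 1 - Poly_Mapping.single (x, w) 1 \<in> relideal n k"
    using ring.genideal_self[OF ring_path_algebra relators_closed] by (auto simp: relideal_def)
  then have "pcls n k x v = pcls n k x w"
    unfolding pcls_qcls using assms by (intro qcls_eqI single_in_path_algebra) (auto simp: qpaths_iff)
  then show ?thesis using assms by (simp add: path_equiv_def)
qed

text \<open>Loops get index 0, which no arrow \<open>R\<^sub>i\<close>, \<open>L\<^sub>i\<close> has.\<close>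

fun arr_index :: "label \<Rightarrow> nat" where
  "arr_index (ArrR i) = i" | "arr_index (ArrL i) = i" | "arr_index (LoopU i) = 0"

text \<open>Indices at distance at least 2 concern disjoint pairs \<open>{i - 1, i}\<close>, so
  neither arrow affects whether the other is available; a loop is available at every vertex and
  leaves it unchanged.\<close>

lemma arrow_commute:
  assumes x: "x \<in> ksubsets {0..n} k" and w: "is_walk n x [a, b]" and a: "a = ArrR m \<or> a = ArrL m"
    and b: "arr_index b + 1 < m \<or> arr_index b = 0"
  shows "path_equiv n k x [a, b] [b, a]"
proof (cases b)
  case (LoopU j)
  then show ?thesis using a w
    by (intro path_equiv_word_eq[OF x]) (auto intro: word_eq.intros)
next
  case (ArrR i)
  then have i: "1 \<le> i" "i + 1 < m" using w b by auto
  \<comment> \<open>Writing the indices as successors removes truncated subtraction from the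
    vertices.\<close>
  then obtain i' m' where im: "i = Suc i'" "m = Suc m'" "Suc i' < m'"
    by (metis One_nat_def Suc_eq_plus1 Suc_le_D Suc_less_eq less_imp_Suc_add)
  have "word_eq [a, b] [b, a]" using a i by (auto simp: ArrR intro!: word_eq.intros)
  moreover have "is_walk n x [b, a]" "fold target [a, b] x = fold target [b, a] x"
    using a w im(3) by (auto simp: ArrR im(1,2))
  ultimately show ?thesis using w by (intro path_equiv_word_eq[OF x]) auto
next
  case (ArrL i)
  then have i: "1 \<le> i" "i + 1 < m" using w b by auto
  then obtain i' m' where im: "i = Suc i'" "m = Suc m'" "Suc i' < m'"
    by (metis One_nat_def Suc_eq_plus1 Suc_le_D Suc_less_eq less_imp_Suc_add)
  \<comment> \<open>\<open>far_LR\<close> is stated with the L-arrow first, so if \<open>a\<close>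
    is an R-arrow the relation is available from right to left only.\<close>
  have "word_eq [a, b] [b, a] \<or> word_eq [b, a] [a, b]" using a i by (auto simp: ArrL intro!: word_eq.intros)
  moreover have "is_walk n x [b, a]" "fold target [a, b] x = fold target [b, a] x"
    using a w im(3) by (auto simp: ArrL im(1,2))
  ultimately show ?thesis using w by (metis path_equiv_word_eq[OF x] path_equiv_sym)
qed

lemma arrow_commute_word:
  assumes "x \<in> ksubsets {0..n} k" "is_walk n x (a # v)" and a: "a = ArrR m \<or> a = ArrL m"
    and "\<forall>b\<in>set v. arr_index b + 1 < m \<or> arr_index b = 0"
  shows "path_equiv n k x (a # v) (v @ [a])"
  using assms
proof (induction v arbitrary: x)
  case Nil
  then show ?case by (simp add: path_equiv_refl)
next
  case (Cons b v)
  have ab: "path_equiv n k x [a, b] [b, a]"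
    using Cons.prems by (intro arrow_commute[where m = m]) auto
  have "path_equiv n k x ([a, b] @ v) ([b, a] @ v)"
    using Cons.prems by (intro path_equiv_append ab path_equiv_refl) auto
  moreover have y: "target b x \<in> ksubsets {0..n} k" "is_walk n (target b x) (a # v)" "is_walk n x [b]"
    using ab Cons.prems fold_target_closed[of n x "[b]" k] by (auto simp: path_equiv_def)
  have "path_equiv n k (target b x) (a # v) (v @ [a])"
    using Cons.prems by (intro Cons.IH y) auto
  then have "path_equiv n k x ([b] @ (a # v)) ([b] @ (v @ [a]))"
    by (intro path_equiv_append path_equiv_refl Cons.prems y) simp
  ultimately show ?case by (auto intro: path_equiv_trans)
qed

lemma arrow_cancel:
  assumes x: "x \<in> ksubsets {0..n} k" and w: "is_walk n x [a, b]"
    and ab: "a = ArrR m \<and> b = ArrL m \<or> a = ArrL m \<and> b = ArrR m"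
  shows "path_equiv n k x [a, b] [LoopU m]"
proof (rule path_equiv_word_eq[OF x])
  show "word_eq [a, b] [LoopU m]" using ab by (auto intro: word_eq.intros)
  show "fold target [a, b] x = fold target [LoopU m] x" using ab w by (auto simp: set_eq_iff)
qed (use ab w in auto)

text \<open>An arrow of index \<open>i\<close> toggles the membership of \<open>i - 1\<close> and of
  \<open>i\<close>, so \<open>j\<close> is toggled by the indices \<open>j\<close> and
  \<open>j + 1\<close> only. For \<open>j = 0\<close> the count would include the loops, whose index
  is 0.\<close>

lemma fold_target_mem:
  assumes "is_walk n x w" "1 \<le> j"
  shows "j \<in> fold target w x \<longleftrightarrow> (j \<in> x \<longleftrightarrow> even (length (filter (\<lambda>a. arr_index a \<in> {j, j + 1}) w)))"
  using assms(1)
proof (induction w arbitrary: x)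
  case (Cons a w)
  have "j \<in> target a x \<longleftrightarrow> (j \<in> x \<longleftrightarrow> arr_index a \<notin> {j, j + 1})"
    using Cons.prems assms(2) by (cases a) auto
  then show ?case using Cons by auto
qed simp

text \<open>Between two consecutive arrows of the top index, the number of arrows of the next lower index
  is even by parity, hence can be reduced to 0; the two arrows then meet and cancel to a loop.\<close>

lemma reduce_top_index:
  assumes "x \<in> ksubsets {0..n} k" "is_walk n x w" "\<forall>a\<in>set w. arr_index a \<le> m"
  shows "\<exists>w'. path_equiv n k x w w' \<and> (\<forall>a\<in>set w'. arr_index a \<le> m) \<and>
    (1 \<le> m \<longrightarrow> length (filter (\<lambda>a. arr_index a = m) w') \<le> 1)"
  using assms
proof (induction m arbitrary: x w)
  case 0
  then show ?case by (intro exI[of _ w]) (auto simp: path_equiv_refl)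
next
  case (Suc m)
  \<comment> \<open>The inner induction is on the word, with the bound \<open>Suc m\<close> fixed:
    the tail is already reduced, and only a new leading arrow of top index can spoil it.\<close>
  from Suc.prems show ?case
  proof (induction w arbitrary: x)
    case Nil
    then show ?case by (intro exI[of _ "[]"]) (auto simp: path_equiv_refl)
  next
    case (Cons a w)
    define y where "y = target a x"
    have y: "y \<in> ksubsets {0..n} k" "is_walk n y w" "is_walk n x [a]"
      using Cons.prems fold_target_closed[of n x "[a]" k] by (auto simp: y_def)
    from Cons.IH[OF y(1,2)] Cons.prems(3) obtain w0 where w0: "path_equiv n k y w w0"
      "\<forall>a\<in>set w0. arr_index a \<le> Suc m" "length (filter (\<lambda>a. arr_index a = Suc m) w0) \<le> 1" by auto
    have "path_equiv n k x ([a] @ w) ([a] @ w0)"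
      using y w0 Cons.prems by (intro path_equiv_append path_equiv_refl) (auto simp: y_def)
    then have aw: "path_equiv n k x (a # w) (a # w0)" by simp
    show ?case
    proof (cases "arr_index a = Suc m \<and> filter (\<lambda>a. arr_index a = Suc m) w0 \<noteq> []")
      case False
      then show ?thesis using aw w0 Cons.prems by (intro exI[of _ "a # w0"]) auto
    next
      case True
      then have one: "length (filter (\<lambda>a. arr_index a = Suc m) w0) = 1"
        using w0(3) by (cases "filter (\<lambda>a. arr_index a = Suc m) w0") auto
      from True obtain b where "b \<in> set w0" and b: "arr_index b = Suc m" by (auto simp: filter_empty_conv)
      then obtain v u where w0_eq: "w0 = v @ b # u" by (meson split_list)
      have nil: "filter (\<lambda>a. arr_index a = Suc m) v = []" "filter (\<lambda>a. arr_index a = Suc m) u = []"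
        using one b by (auto simp: w0_eq)
      have vm: "\<forall>c\<in>set v. arr_index c \<le> m" and um: "\<forall>c\<in>set u. arr_index c \<le> m"
        using nil w0(2) le_Suc_eq by (auto simp: w0_eq filter_empty_conv)
      have w0_walk: "is_walk n y w0" using w0(1) by (simp add: path_equiv_def)
      then have v: "is_walk n y v" by (simp add: w0_eq)
      from Suc.IH[OF y(1) v vm] obtain v' where v': "path_equiv n k y v v'" "\<forall>c\<in>set v'. arr_index c \<le> m"
        "1 \<le> m \<longrightarrow> length (filter (\<lambda>a. arr_index a = m) v') \<le> 1" by auto
      define z where "z = fold target v y"
      have z: "z = fold target v' y" "is_walk n y v'" using v'(1) by (auto simp: z_def path_equiv_def)
      have bz: "is_arrow n b z" "is_walk n z (b # u)" using w0_walk by (auto simp: w0_eq z_def)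
      have a_cases: "a = ArrR (Suc m) \<or> a = ArrL (Suc m)" and b_cases: "b = ArrR (Suc m) \<or> b = ArrL (Suc m)"
        using True b by (cases a; cases b; simp)+
      have no_top: "filter (\<lambda>a. arr_index a \<in> {Suc m, Suc m + 1}) v' = []"
        using v'(2) by (force simp: filter_empty_conv)
      \<comment> \<open>Nothing between the two top arrows touches \<open>Suc m\<close>, so the
        second arrow finds it as the first one left it and has to undo that move.\<close>
      have Suc_mem: "Suc m \<in> z \<longleftrightarrow> Suc m \<in> y"
        using fold_target_mem[OF z(2), of "Suc m"] no_top by (simp add: z(1))
      have ax: "is_arrow n a x" using Cons.prems by simp
      have opp: "a = ArrR (Suc m) \<and> b = ArrL (Suc m) \<or> a = ArrL (Suc m) \<and> b = ArrR (Suc m)"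
        using a_cases b_cases Suc_mem ax bz(1) by (auto simp: y_def)
      have low: "\<forall>c\<in>set v'. arr_index c + 1 < Suc m \<or> arr_index c = 0"
      proof (cases "m = 0")
        case True
        then show ?thesis using v'(2) by auto
      next
        case False
        \<comment> \<open>As \<open>a\<close> and \<open>b\<close> are opposite, \<open>m\<close>
          belongs to the vertex after \<open>a\<close> exactly if it belongs to the vertex before
          \<open>b\<close>. The number of arrows of index \<open>m\<close> in between is then even
          and at most 1.\<close>
        have "m \<in> z \<longleftrightarrow> m \<in> y" using opp ax bz(1) by (auto simp: y_def)
        then have "even (length (filter (\<lambda>a. arr_index a \<in> {m, m + 1}) v'))"
          using fold_target_mem[OF z(2), of m] False by (auto simp: z(1))
        also have "filter (\<lambda>a. arr_index a \<in> {m, m + 1}) v' = filter (\<lambda>a. arr_index a = m) v'"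
          using v'(2) by (intro filter_cong) auto
        finally have "even (length (filter (\<lambda>a. arr_index a = m) v'))" .
        moreover have "length (filter (\<lambda>a. arr_index a = m) v') \<le> 1" using v'(3) False by simp
        ultimately have "length (filter (\<lambda>a. arr_index a = m) v') = 0" by presburger
        then show ?thesis using v'(2) by (force simp: filter_empty_conv)
      qed
      have xz: "fold target (a # v') x = z" by (simp add: z(1) y_def)
      have av': "is_walk n x (a # v')" using y(3) z(2) by (simp add: y_def)
      \<comment> \<open>With the index \<open>m\<close> gone from \<open>v'\<close>, the arrow
        \<open>a\<close> slides to the right until it meets \<open>b\<close>.\<close>
      have comm: "path_equiv n k x (a # v') (v' @ [a])"
        by (rule arrow_commute_word[OF Cons.prems(1) av' a_cases low])
      define x' where "x' = fold target v' x"
      have x': "is_walk n x v'" "is_arrow n a x'" "target a x' = z"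
        using comm xz by (auto simp: path_equiv_def x'_def)
      have x'_k: "x' \<in> ksubsets {0..n} k"
        using x' Cons.prems(1) by (simp add: x'_def fold_target_closed)
      have "path_equiv n k y (v @ (b # u)) (v' @ (b # u))"
        using y(1) v'(1) bz by (intro path_equiv_append path_equiv_refl) (auto simp: z_def)
      then have "path_equiv n k x ([a] @ (v @ (b # u))) ([a] @ (v' @ (b # u)))"
        using path_equiv_append[OF Cons.prems(1) path_equiv_refl[OF y(3)]] by (simp add: y_def)
      moreover have "path_equiv n k x ((a # v') @ (b # u)) ((v' @ [a]) @ (b # u))"
        using Cons.prems(1) comm bz xz by (intro path_equiv_append path_equiv_refl) auto
      moreover have "path_equiv n k x (v' @ ([a, b] @ u)) (v' @ ([LoopU (Suc m)] @ u))"
        using Cons.prems(1) x' x'_k bz opp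
        by (intro path_equiv_append path_equiv_refl arrow_cancel) (auto simp: x'_def)
      ultimately have "path_equiv n k x (a # w) (v' @ LoopU (Suc m) # u)"
        using aw unfolding w0_eq by (auto intro: path_equiv_trans)
      moreover have "filter (\<lambda>a. arr_index a = Suc m) (v' @ LoopU (Suc m) # u) = []"
        using v'(2) um by (force simp: filter_empty_conv)
      ultimately show ?thesis
        using v'(2) um by (intro exI[of _ "v' @ LoopU (Suc m) # u"]) auto
    qed
  qed
qed

text \<open>Both ends avoid \<open>n\<close>, and \<open>n\<close> is toggled only by arrows of
  index \<open>n\<close>, there being none of index \<open>n + 1\<close>. Their number is even, and
  the reduction brings it down to at most 1, hence to 0.\<close>

lemma reduce_avoiding_last:
  assumes "x \<in> ksubsets {..<n} k" "is_walk n x w" "fold target w x \<in> ksubsets {..<n} k"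
  shows "\<exists>w'. path_equiv n k x w w' \<and> (\<forall>a\<in>set w'. arr_index a < n)"
proof (cases "n = 0")
  case True
  then have "w = []" using assms(2) by (cases w; cases "hd w") auto
  then show ?thesis by (auto intro!: path_equiv_refl exI[of _ "[]"])
next
  case False
  have x: "x \<in> ksubsets {0..n} k" using assms(1) by (auto simp: ksubsets_def)
  have "\<forall>a\<in>set w. arr_index a \<le> n"
    using assms(2)
  proof (induction w arbitrary: x)
    case (Cons a w)
    then show ?case by (cases a) auto
  qed simp
  from reduce_top_index[OF x assms(2) this] False obtain w' where w': "path_equiv n k x w w'"
    "\<forall>a\<in>set w'. arr_index a \<le> n" "length (filter (\<lambda>a. arr_index a = n) w') \<le> 1" by auto
  have "filter (\<lambda>a. arr_index a \<in> {n, n + 1}) w' = filter (\<lambda>a. arr_index a = n) w'"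
    using w'(2) by (intro filter_cong) auto
  moreover have "n \<notin> x" "n \<notin> fold target w' x"
    using assms w'(1) by (auto simp: ksubsets_def path_equiv_def)
  ultimately have "even (length (filter (\<lambda>a. arr_index a = n) w'))"
    using fold_target_mem[of n x w' n] w'(1) False by (auto simp: path_equiv_def)
  then have "length (filter (\<lambda>a. arr_index a = n) w') = 0" using w'(3) by presburger
  then show ?thesis using w' by (force simp: filter_empty_conv)
qed

section \<open>Maps induced by maps of sign vectors\<close>

lemma scale_diff_right: "scale c (F - G) = scale c F - scale c G"
  by (rule poly_mapping_eqI) (simp only: lookup_scale lookup_minus right_diff_distrib)

definition bcls :: "nat \<Rightarrow> arrangement \<Rightarrow> fmod \<Rightarrow> fmod set" where
  "bcls n A F = Bideal n A +>\<^bsub>Bfree n A\<^esub> F"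

lemma bcls_hom: "bcls n A \<in> Ring.ring_hom (Bfree n A) (Btilde n A)"
  using ideal.rcos_ring_hom[OF ideal_Bideal, of n A] by (simp add: Btilde_def bcls_def[abs_def])

lemma
  assumes "F \<in> carrier (Bfree n A)" "G \<in> carrier (Bfree n A)"
  shows bcls_add: "bcls n A (F + G) = bcls n A F \<oplus>\<^bsub>Btilde n A\<^esub> bcls n A G"
    and bcls_mult: "bcls n A (bilinear_ext (fmult n) F G) = bcls n A F \<otimes>\<^bsub>Btilde n A\<^esub> bcls n A G"
  using ring_hom_add[OF bcls_hom assms] ring_hom_mult[OF bcls_hom assms] by simp_all

lemma bcls_closed: "F \<in> carrier (Bfree n A) \<Longrightarrow> bcls n A F \<in> carrier (Btilde n A)"
  by (rule ring_hom_closed[OF bcls_hom])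

lemma bcls_zero: "bcls n A 0 = \<zero>\<^bsub>Btilde n A\<^esub>"
  using rng_hom_zero[OF ring_Bfree ring_Btilde ring_hom_imp_rng_hom[OF bcls_hom]] by simp

lemma bcls_eq_iff:
  assumes "F \<in> carrier (Bfree n A)" "G \<in> carrier (Bfree n A)"
  shows "bcls n A F = bcls n A G \<longleftrightarrow> F - G \<in> Bideal n A"
proof -
  interpret ideal "Bideal n A" "Bfree n A" by (rule ideal_Bideal)
  have mem: "F \<in> bcls n A G \<longleftrightarrow> F - G \<in> Bideal n A"
    by (auto simp: bcls_def a_r_coset_def r_coset_def intro!: bexI[of _ "F - G"])
  show ?thesis
  proof
    assume "bcls n A F = bcls n A G"
    then show "F - G \<in> Bideal n A" using a_rcos_self[OF assms(1)] mem by (simp add: bcls_def)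
  next
    assume "F - G \<in> Bideal n A"
    then have "F \<in> Bideal n A +>\<^bsub>Bfree n A\<^esub> G" using mem by (simp add: bcls_def)
    then show "bcls n A F = bcls n A G"
      unfolding bcls_def by (rule a_repr_independence'[OF _ assms(2), symmetric])
  qed
qed

lemma bcls_elim:
  assumes "X \<in> carrier (Btilde n A)"
  obtains F where "F \<in> carrier (Bfree n A)" "X = bcls n A F"
  using assms unfolding Btilde_def bcls_def by (rule rcos_closed_elim)

lemma fcls_bcls: "fcls n A p \<alpha> \<beta> = bcls n A (scale p (fsym n A \<alpha> \<beta>))"
  by (simp add: fcls_def bcls_def)

lemma fcls_outside: "\<alpha> \<notin> PP n A \<or> \<beta> \<notin> PP n A \<Longrightarrow> fcls n A p \<alpha> \<beta> = \<zero>\<^bsub>Btilde n A\<^esub>"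
  by (auto simp: fcls_bcls fsym_def bcls_zero)

lemma fsym_closed: "p \<in> carrier (Zu n) \<Longrightarrow> scale p (fsym n A \<alpha> \<beta>) \<in> carrier (Bfree n A)"
  by (auto simp: fsym_def single_in_Bfree) (auto simp: carrier_Bfree)

text \<open>\<open>D\<close> is the domain on which the map \<open>s\<close> of sign vectors is
  applied; symbols outside it go to 0. \<open>inj\<close> keeps noncomposable symbols noncomposable,
  and \<open>Rideal\<close> lets the map descend to the quotients. \<open>mult_in\<close> treats
  products whose middle vector survives, and \<open>mult_out\<close> those whose middle vector is
  lost, so that their image has to vanish.\<close>

locale sign_map =
  fixes n n' :: nat and A A' :: arrangement and \<sigma> :: "nat \<Rightarrow> zpoly"
    and D :: "sgnvec \<Rightarrow> bool" and s :: "sgnvec \<Rightarrow> sgnvec"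
  assumes inj: "inj_on s {\<alpha> \<in> PP n A. D \<alpha>}"
    and \<sigma>: "j \<in> {1..n} \<Longrightarrow> \<sigma> j \<in> carrier (Zu n')"
    and Rideal: "\<lbrakk>\<alpha> \<in> PP n A; \<beta> \<in> PP n A; D \<alpha>; D \<beta>; s \<alpha> \<in> PP n' A'; s \<beta> \<in> PP n' A'; S \<subseteq> {1..n};
        Delta n A \<alpha> \<inter> Delta n A \<beta> \<inter> HS A S = {}\<rbrakk>
      \<Longrightarrow> poly_subst \<sigma> (uprod S) \<in> Rideal n' A' (s \<alpha>) (s \<beta>)"
    and mult_in: "\<lbrakk>\<alpha> \<in> PP n A; \<beta> \<in> PP n A; \<gamma> \<in> PP n A; D \<alpha>; D \<beta>; D \<gamma>\<rbrakk>
      \<Longrightarrow> poly_subst \<sigma> (uprod (Sdiff n \<alpha> \<beta> \<gamma>)) = uprod (Sdiff n' (s \<alpha>) (s \<beta>) (s \<gamma>))"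
    and mult_out: "\<lbrakk>\<alpha> \<in> PP n A; \<beta> \<in> PP n A; \<gamma> \<in> PP n A; D \<alpha>; D \<gamma>; s \<alpha> \<in> PP n' A'; s \<gamma> \<in> PP n' A';
        \<not> D \<beta> \<or> s \<beta> \<notin> PP n' A'\<rbrakk>
      \<Longrightarrow> poly_subst \<sigma> (uprod (Sdiff n \<alpha> \<beta> \<gamma>)) \<in> Rideal n' A' (s \<alpha>) (s \<gamma>)"
begin

definition g :: "sgnvec \<Rightarrow> sgnvec \<Rightarrow> fmod" where
  "g \<alpha> \<beta> = (if D \<alpha> \<and> D \<beta> then fsym n' A' (s \<alpha>) (s \<beta>) else 0)"

definition gmap :: "fmod \<Rightarrow> fmod" where
  "gmap F = (\<Sum>(\<alpha>, \<beta>)\<in>Poly_Mapping.keys F. scale (poly_subst \<sigma> (Poly_Mapping.lookup F (\<alpha>, \<beta>))) (g \<alpha> \<beta>))"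

lemma gmap_eq:
  "finite K \<Longrightarrow> Poly_Mapping.keys F \<subseteq> K \<Longrightarrow>
    gmap F = (\<Sum>b\<in>K. scale (poly_subst \<sigma> (Poly_Mapping.lookup F b)) (g (fst b) (snd b)))"
  unfolding gmap_def case_prod_unfold
  by (intro sum.mono_neutral_cong_left) (auto simp: in_keys_iff)

lemma gmap_add: "gmap (F + G) = gmap F + gmap G"
proof -
  let ?K = "Poly_Mapping.keys F \<union> Poly_Mapping.keys G"
  have "Poly_Mapping.keys (F + G) \<subseteq> ?K" by (rule keys_add)
  then show ?thesis
    by (subst (1 2 3) gmap_eq[where K = ?K])
       (auto simp: lookup_add poly_subst_add scale_add_left sum.distrib)
qed

lemma gmap_zero [simp]: "gmap 0 = 0" by (simp add: gmap_def)

lemma gmap_single [simp]: "gmap (Poly_Mapping.single b c) = scale (poly_subst \<sigma> c) (g (fst b) (snd b))"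
  by (subst gmap_eq[where K = "{b}"]) auto

lemma gmap_scale: "gmap (scale c F) = scale (poly_subst \<sigma> c) (gmap F)"
  by (subst (1 2) gmap_eq[where K = "Poly_Mapping.keys F"])
     (auto simp: poly_subst_mult scale_sum_right keys_scale[THEN subsetD])

lemma gmap_sum: "gmap (\<Sum>i\<in>I. f i) = (\<Sum>i\<in>I. gmap (f i))"
  by (induction I rule: infinite_finite_induct) (auto simp: gmap_add)

lemma g_closed: "c \<in> carrier (Zu n') \<Longrightarrow> scale c (g \<alpha> \<beta>) \<in> carrier (Bfree n' A')"
  by (auto simp: g_def fsym_closed) (auto simp: carrier_Bfree)

lemma subst_closed: "p \<in> carrier (Zu n) \<Longrightarrow> poly_subst \<sigma> p \<in> carrier (Zu n')"
  by (rule poly_subst_closed[OF \<sigma>])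

lemma gmap_closed: "F \<in> carrier (Bfree n A) \<Longrightarrow> gmap F \<in> carrier (Bfree n' A')"
  unfolding gmap_def case_prod_unfold
  by (intro Bfree_sum_closed g_closed subst_closed) (auto simp: carrier_Bfree)

lemma subst_Rideal:
  assumes "\<alpha> \<in> PP n A" "\<beta> \<in> PP n A" "D \<alpha>" "D \<beta>" "s \<alpha> \<in> PP n' A'" "s \<beta> \<in> PP n' A'"
    and "p \<in> Rideal n A \<alpha> \<beta>"
  shows "poly_subst \<sigma> p \<in> Rideal n' A' (s \<alpha>) (s \<beta>)"
  using assms(7)
proof (rule Rideal_induct)
  fix S assume "S \<subseteq> {1..n}" "Delta n A \<alpha> \<inter> Delta n A \<beta> \<inter> HS A S = {}"
  then show "poly_subst \<sigma> (uprod S) \<in> Rideal n' A' (s \<alpha>) (s \<beta>)"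
    by (rule Rideal[OF assms(1-6)])
qed (auto simp: poly_subst_add poly_subst_mult Rideal_closed(2,3,4) subst_closed)

lemma gmap_Bideal:
  assumes "F \<in> Bideal n A"
  shows "gmap F \<in> Bideal n' A'"
  unfolding gmap_def case_prod_unfold
proof (rule Bideal_sum)
  fix b assume "b \<in> Poly_Mapping.keys F"
  then obtain \<alpha> \<beta> where b: "b = (\<alpha>, \<beta>)" "\<alpha> \<in> PP n A" "\<beta> \<in> PP n A" and F: "Poly_Mapping.lookup F b \<in> Rideal n A \<alpha> \<beta>"
    using assms by (cases b) (auto simp: Bideal_iff)
  then show "scale (poly_subst \<sigma> (Poly_Mapping.lookup F (fst b, snd b))) (g (fst b) (snd b)) \<in> Bideal n' A'"
    by (auto simp: g_def fsym_def Bideal_zero intro!: Bideal_single subst_Rideal)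
qed

text \<open>Multiplicativity holds only modulo \<open>Bideal n' A'\<close>: when the middle vector
  is lost, the product of the images is 0, while the image of the product is a symbol whose
  coefficient is zero only in the quotient.\<close>

lemma gmap_fmult:
  assumes "a \<in> PP n A \<times> PP n A" "b \<in> PP n A \<times> PP n A"
  shows "gmap (fmult n a b) - bilinear_ext (fmult n') (g (fst a) (snd a)) (g (fst b) (snd b)) \<in> Bideal n' A'"
proof -
  obtain \<alpha> \<beta> \<beta>' \<gamma> where [simp]: "a = (\<alpha>, \<beta>)" "b = (\<beta>', \<gamma>)" by (metis surj_pair)
  have PP: "\<alpha> \<in> PP n A" "\<beta> \<in> PP n A" "\<beta>' \<in> PP n A" "\<gamma> \<in> PP n A" using assms by auto
  show ?thesis
  proof (cases "\<beta> = \<beta>'")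
    case False
    then have "D \<beta> \<and> D \<beta>' \<Longrightarrow> s \<beta> \<noteq> s \<beta>'" using inj PP by (auto simp: inj_on_def)
    then show ?thesis using False by (auto simp: fmult_def g_def fsym_def Bideal_zero)
  next
    case True
    show ?thesis
    proof (cases "D \<alpha> \<and> D \<gamma> \<and> s \<alpha> \<in> PP n' A' \<and> s \<gamma> \<in> PP n' A'")
      case False
      then show ?thesis using True by (auto simp: fmult_def g_def fsym_def Bideal_zero)
    next
      case ends: True
      show ?thesis
      proof (cases "D \<beta> \<and> s \<beta> \<in> PP n' A'")
        case in': True
        then show ?thesis using True ends PP mult_in[of \<alpha> \<beta> \<gamma>]
          by (simp add: fmult_def g_def fsym_def Bideal_zero)
      next
        case False
        then have "poly_subst \<sigma> (uprod (Sdiff n \<alpha> \<beta> \<gamma>)) \<in> Rideal n' A' (s \<alpha>) (s \<gamma>)"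
          using ends PP by (intro mult_out) auto
        then show ?thesis using False True ends PP
          by (auto simp: fmult_def g_def fsym_def Bideal_zero intro!: Bideal_single)
      qed
    qed
  qed
qed

lemma gmap_mult:
  assumes F: "F \<in> carrier (Bfree n A)" and G: "G \<in> carrier (Bfree n A)"
  shows "gmap (bilinear_ext (fmult n) F G) - bilinear_ext (fmult n') (gmap F) (gmap G) \<in> Bideal n' A'"
proof -
  let ?f = "\<lambda>a. Poly_Mapping.lookup F a" and ?h = "\<lambda>b. Poly_Mapping.lookup G b"
  have "gmap (bilinear_ext (fmult n) F G) = (\<Sum>a\<in>Poly_Mapping.keys F. \<Sum>b\<in>Poly_Mapping.keys G.
      scale (poly_subst \<sigma> (?f a) * poly_subst \<sigma> (?h b)) (gmap (fmult n a b)))"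
    by (simp add: bilinear_ext_def gmap_sum gmap_scale poly_subst_mult)
  moreover have "bilinear_ext (fmult n') (gmap F) (gmap G) =
      (\<Sum>a\<in>Poly_Mapping.keys F. \<Sum>b\<in>Poly_Mapping.keys G. scale (poly_subst \<sigma> (?f a) * poly_subst \<sigma> (?h b))
        (bilinear_ext (fmult n') (g (fst a) (snd a)) (g (fst b) (snd b))))"
    unfolding gmap_def[of F] case_prod_unfold bilinear_ext_sum_left bilinear_ext_scale_left
    unfolding gmap_def[of G] case_prod_unfold bilinear_ext_sum_right bilinear_ext_scale_right
    by (simp add: scale_sum_right)
  ultimately have "gmap (bilinear_ext (fmult n) F G) - bilinear_ext (fmult n') (gmap F) (gmap G) =
      (\<Sum>a\<in>Poly_Mapping.keys F. \<Sum>b\<in>Poly_Mapping.keys G. scale (poly_subst \<sigma> (?f a) * poly_subst \<sigma> (?h b))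
        (gmap (fmult n a b) - bilinear_ext (fmult n') (g (fst a) (snd a)) (g (fst b) (snd b))))"
    by (simp add: sum_subtractf scale_diff_right)
  also have "\<dots> \<in> Bideal n' A'"
    using F G by (intro Bideal_sum Bideal_scale gmap_fmult Zu_closed(4) subst_closed) (auto simp: carrier_Bfree)
  finally show ?thesis .
qed

text \<open>By \<open>gmap_Bideal\<close> all representatives of a class have the same image, so the
  union that defines \<open>induced_map\<close> runs over a constant family.\<close>

lemma induced_map_bcls:
  assumes F: "F \<in> carrier (Bfree n A)"
  shows "induced_map n' A' \<sigma> g (bcls n A F) = bcls n' A' (gmap F)"
proof -
  interpret ideal "Bideal n A" "Bfree n A" by (rule ideal_Bideal)
  have "induced_map n' A' \<sigma> g (bcls n A F) = (\<Union>G\<in>bcls n A F. bcls n' A' (gmap G))"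
    by (simp add: induced_map_def bcls_def gmap_def)
  also have "\<dots> = bcls n' A' (gmap F)"
  proof (rule SUP_eq_const)
    show "bcls n A F \<noteq> {}" using a_rcos_self[OF F] by (auto simp: bcls_def)
    fix G assume "G \<in> bcls n A F"
    then obtain H where H: "H \<in> Bideal n A" "G = H + F" by (auto simp: bcls_def a_r_coset_def r_coset_def)
    then have "G \<in> carrier (Bfree n A)" using a_closed F a_Hcarr by (metis Bfree_simps(3))
    then show "bcls n' A' (gmap G) = bcls n' A' (gmap F)"
      using gmap_Bideal[OF H(1)] H(2)
      by (intro bcls_eq_iff[THEN iffD2] gmap_closed F) (simp_all add: gmap_add)
  qed
  finally show ?thesis .
qed

lemma induced_map_rng_hom: "induced_map n' A' \<sigma> g \<in> rng_hom (Btilde n A) (Btilde n' A')"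
  unfolding rng_hom_def
proof (intro CollectI conjI ballI Pi_I)
  fix X assume "X \<in> carrier (Btilde n A)"
  then obtain F where F: "F \<in> carrier (Bfree n A)" "X = bcls n A F" by (rule bcls_elim)
  then show "induced_map n' A' \<sigma> g X \<in> carrier (Btilde n' A')"
    by (simp add: induced_map_bcls bcls_closed gmap_closed)
  fix Y assume "Y \<in> carrier (Btilde n A)"
  then obtain G where G: "G \<in> carrier (Bfree n A)" "Y = bcls n A G" by (rule bcls_elim)
  interpret R: ring "Bfree n A" by (rule ring_Bfree)
  interpret R': ring "Bfree n' A'" by (rule ring_Bfree)
  have c: "F + G \<in> carrier (Bfree n A)" "bilinear_ext (fmult n) F G \<in> carrier (Bfree n A)"
    using R.a_closed[OF F(1) G(1)] R.m_closed[OF F(1) G(1)] by simp_all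
  show "induced_map n' A' \<sigma> g (X \<oplus>\<^bsub>Btilde n A\<^esub> Y) =
      induced_map n' A' \<sigma> g X \<oplus>\<^bsub>Btilde n' A'\<^esub> induced_map n' A' \<sigma> g Y"
    using F G c by (simp add: induced_map_bcls gmap_add gmap_closed flip: bcls_add)
  have "bcls n' A' (gmap (bilinear_ext (fmult n) F G)) = bcls n' A' (bilinear_ext (fmult n') (gmap F) (gmap G))"
    using R'.m_closed[OF gmap_closed[OF F(1)] gmap_closed[OF G(1)]] c
    by (subst bcls_eq_iff) (simp_all add: gmap_closed gmap_mult F G)
  then show "induced_map n' A' \<sigma> g (X \<otimes>\<^bsub>Btilde n A\<^esub> Y) =
      induced_map n' A' \<sigma> g X \<otimes>\<^bsub>Btilde n' A'\<^esub> induced_map n' A' \<sigma> g Y"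
    using F G c by (simp add: induced_map_bcls gmap_closed flip: bcls_mult)
qed

text \<open>Nothing is assumed about \<open>s \<alpha>\<close> and \<open>s \<beta>\<close>: if one
  of them is outside \<open>PP n' A'\<close>, the symbol is 0 on both sides.\<close>

lemma induced_map_fcls:
  assumes "\<alpha> \<in> PP n A" "\<beta> \<in> PP n A" "D \<alpha>" "D \<beta>" "p \<in> carrier (Zu n)"
  shows "induced_map n' A' \<sigma> g (fcls n A p \<alpha> \<beta>) = fcls n' A' (poly_subst \<sigma> p) (s \<alpha>) (s \<beta>)"
  unfolding fcls_bcls using assms
  by (subst induced_map_bcls) (simp_all add: fsym_closed, simp add: fsym_def g_def)

end

section \<open>Deletion of the first hyperplane\<close>

lemma sgn_at_Suc: "sgn_at (b # \<alpha>) (Suc (Suc i)) = sgn_at \<alpha> (Suc i)"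
  by (simp add: sgn_at_def)

lemma lookup_vcons: "Poly_Mapping.lookup (vcons c x) i = (if i = 0 then 0 else if i = 1 then c else Poly_Mapping.lookup x (i - 1))"
  by transfer simp

lemma lookup_vtail: "Poly_Mapping.lookup (vtail x) i = (if i = 0 then 0 else Poly_Mapping.lookup x (i + 1))"
  by transfer simp

lemma vtail_add: "vtail (x + y) = vtail x + vtail y"
  by (rule poly_mapping_eqI) (simp add: lookup_vtail lookup_add)

lemma vcons_add: "vcons (a + b) (x + y) = vcons a x + vcons b y"
  by (rule poly_mapping_eqI) (simp add: lookup_vcons lookup_add)

lemma Sdiff_Cons: "Sdiff (Suc n) (b # \<alpha>) (b # \<beta>) (b # \<gamma>) = Suc ` Sdiff n \<alpha> \<beta> \<gamma>"
proof -
  have "i \<in> Sdiff (Suc n) (b # \<alpha>) (b # \<beta>) (b # \<gamma>) \<longleftrightarrow> i \<in> Suc ` Sdiff n \<alpha> \<beta> \<gamma>" for i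
  proof (cases "\<exists>j. i = Suc (Suc j)")
    case True
    then show ?thesis by (auto simp: Sdiff_def sgn_at_Suc image_iff)
  next
    case False
    then have "i = 0 \<or> i = 1" by (metis One_nat_def not0_implies_Suc)
    then show ?thesis by (auto simp: Sdiff_def sgn_at_def)
  qed
  then show ?thesis by blast
qed

lemma uprod_Suc: "uprod (Suc ` S) = (\<Prod>i\<in>S. uvar (i + 1))"
  by (simp add: uprod_def prod.reindex)

lemma lookup_scaleR: "Poly_Mapping.lookup (c *\<^sub>R x) i = c *\<^sub>R Poly_Mapping.lookup x i"
proof -
  have "finite {i. c *\<^sub>R Poly_Mapping.lookup x i \<noteq> 0}"
    by (rule finite_subset[OF _ finite_lookup[of x]]) auto
  then show ?thesis by (simp add: scaleR_poly_mapping_def)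
qed

text \<open>As the dimension is kept, \<open>vtail\<close> maps a basis bijectively onto a basis.
  Injectivity is what gives \<open>inv_into\<close> in \<open>first_deletion\<close> its intended
  meaning.\<close>

lemma inj_on_vtail:
  assumes V: "subspace V" and dim: "dim (vtail ` V) = dim V" "dim V > 0"
  shows "inj_on vtail V"
proof -
  have lin: "linear vtail"
    by (rule linearI) (auto intro!: poly_mapping_eqI simp: lookup_vtail lookup_add lookup_scaleR)
  obtain B where B: "B \<subseteq> V" "independent B" "V \<subseteq> span B" "card B = dim V" by (rule basis_exists)
  \<comment> \<open>Positive dimension excludes an infinite basis, whose \<open>card\<close> would
    be 0 by default.\<close>
  have fin: "finite B" using B(4) dim(2) card_ge_0_finite by metis
  have V_eq: "V = span B" using B V by (metis span_minimal subset_antisym)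
  have im: "vtail ` V = span (vtail ` B)" unfolding V_eq by (rule linear_span_image[OF lin, symmetric])
  obtain C where C: "C \<subseteq> vtail ` B" "independent C" "vtail ` B \<subseteq> span C" "card C = dim (vtail ` B)"
    by (rule basis_exists)
  have "card C = card B" using C(4) im dim(1) B(4) by (simp add: dim_span)
  moreover have "card (vtail ` B) \<le> card B" by (rule card_image_le[OF fin])
  ultimately have "C = vtail ` B" using C(1) fin by (intro card_seteq) auto
  then have "independent (vtail ` B)" "inj_on vtail B"
    using C(2) \<open>card C = card B\<close> fin by (auto simp: inj_on_iff_eq_card)
  then show ?thesis unfolding V_eq by (rule linear_inj_on_span_independent_image[OF lin])
qed

lemma sgn_at_Cons: "1 \<le> i \<Longrightarrow> sgn_at (b # \<alpha>) (Suc i) = sgn_at \<alpha> i"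
  by (cases i) (auto simp: sgn_at_Suc)

lemma Cons_in_signs: "\<alpha> \<in> signs n \<Longrightarrow> b = 1 \<or> b = -1 \<Longrightarrow> b # \<alpha> \<in> signs (Suc n)"
  by (auto simp: signs_def)

lemma signs_Suc_cases:
  assumes "\<alpha> \<in> signs (Suc n)"
  obtains b \<beta> where "\<alpha> = b # \<beta>" "b = 1 \<or> b = -1" "\<beta> \<in> signs n"
  using assms by (cases \<alpha>) (auto simp: signs_def)

context
  fixes n k :: nat and A Ahat :: arrangement
  assumes Ahat: "polarized_arrangement (Suc n) (Suc k) Ahat" and A: "polarized_arrangement n (Suc k) A"
    and A_def: "A = first_deletion Ahat"
begin

lemma vfun_deletion: "v \<in> vspace Ahat \<Longrightarrow> vfun A (vtail v) = vfun Ahat v"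
proof -
  assume v: "v \<in> vspace Ahat"
  have "inj_on vtail (vspace Ahat)"
    using Ahat A by (intro inj_on_vtail) (auto simp: polarized_arrangement_def A_def first_deletion_def)
  then show ?thesis using v by (simp add: A_def first_deletion_def)
qed

lemma Delta_deletion: "x \<in> Delta (Suc n) Ahat (1 # \<alpha>) \<Longrightarrow> vtail x \<in> Delta n A \<alpha>"
proof -
  assume x: "x \<in> Delta (Suc n) Ahat (1 # \<alpha>)"
  show ?thesis
    unfolding Delta_def
  proof (intro CollectI conjI ballI)
    show "vtail x \<in> vcoset A" using x by (simp add: Delta_def A_def first_deletion_def)
    fix i assume "i \<in> {1..n}"
    then have "Suc i \<in> {1..Suc n}" "1 \<le> i" by auto
    then have "0 \<le> real_of_int (sgn_at (1 # \<alpha>) (Suc i)) * Poly_Mapping.lookup x (Suc i)"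
      using x unfolding Delta_def by blast
    then show "0 \<le> real_of_int (sgn_at \<alpha> i) * Poly_Mapping.lookup (vtail x) i"
      using \<open>1 \<le> i\<close> by (simp add: lookup_vtail sgn_at_Cons)
  qed
qed

text \<open>An affine function that is bounded on the chamber of \<alpha> pulls back along
  \<open>vtail\<close>, so prepending a plus can destroy feasibility but not boundedness.\<close>

lemma PP_deletion:
  assumes \<alpha>: "\<alpha> \<in> PP n A" and f: "Delta (Suc n) Ahat (1 # \<alpha>) \<noteq> {}"
  shows "1 # \<alpha> \<in> PP (Suc n) Ahat"
proof -
  obtain h where h: "\<And>x v. x \<in> vcoset A \<Longrightarrow> v \<in> vspace A \<Longrightarrow> h (x + v) = h x + vfun A v"
    and b: "bdd_above (h ` Delta n A \<alpha>)"
    using \<alpha> by (auto simp: PP_def bounded_sgn_def)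
  have "bounded_sgn (Suc n) Ahat (1 # \<alpha>)"
    unfolding bounded_sgn_def
  proof (intro exI[of _ "h \<circ> vtail"] conjI ballI)
    fix x v assume "x \<in> vcoset Ahat" "v \<in> vspace Ahat"
    then show "(h \<circ> vtail) (x + v) = (h \<circ> vtail) x + vfun Ahat v"
      using h[of "vtail x" "vtail v"] vfun_deletion
      by (simp add: vtail_add A_def first_deletion_def)
  next
    show "bdd_above ((h \<circ> vtail) ` Delta (Suc n) Ahat (1 # \<alpha>))"
      by (rule bdd_above_mono[OF b]) (auto dest: Delta_deletion)
  qed
  then show ?thesis using \<alpha> f by (simp add: PP_def feasible_def Cons_in_signs)
qed

lemma deletion_sign_map: "sign_map n (Suc n) A Ahat (\<lambda>j. uvar (j + 1)) (\<lambda>_. True) (Cons 1)"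
proof
  show "inj_on ((#) 1) {\<alpha> \<in> PP n A. True}" by (auto simp: inj_on_def)
  show "uvar (j + 1) \<in> carrier (Zu (Suc n))" if "j \<in> {1..n}" for j using that by simp
next
  fix \<alpha> \<beta> S assume *: "S \<subseteq> {1..n}" "Delta n A \<alpha> \<inter> Delta n A \<beta> \<inter> HS A S = {}"
  have "vtail x \<in> HS A S" if "x \<in> HS Ahat (Suc ` S)" for x
    using that *(1) by (auto simp: HS_def lookup_vtail A_def first_deletion_def)
  note HS = this
  have "uprod (Suc ` S) \<in> Rideal (Suc n) Ahat (1 # \<alpha>) (1 # \<beta>)"
  proof (rule uprod_in_Rideal)
    show "Suc ` S \<subseteq> {1..Suc n}" using *(1) by auto
    show "Delta (Suc n) Ahat (1 # \<alpha>) \<inter> Delta (Suc n) Ahat (1 # \<beta>) \<inter> HS Ahat (Suc ` S) = {}"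
      using *(2) Delta_deletion HS by blast
  qed
  then show "poly_subst (\<lambda>j. uvar (j + 1)) (uprod S) \<in> Rideal (Suc n) Ahat (1 # \<alpha>) (1 # \<beta>)"
    by (simp add: poly_subst_uprod uprod_Suc)
next
  fix \<alpha> \<beta> \<gamma>
  show "poly_subst (\<lambda>j. uvar (j + 1)) (uprod (Sdiff n \<alpha> \<beta> \<gamma>)) = uprod (Sdiff (Suc n) (1 # \<alpha>) (1 # \<beta>) (1 # \<gamma>))"
    unfolding Sdiff_Cons poly_subst_uprod uprod_Suc by simp
  then have eq: "poly_subst (\<lambda>j. uvar (j + 1)) (uprod (Sdiff n \<alpha> \<beta> \<gamma>)) = uprod (Sdiff (Suc n) (1 # \<alpha>) (1 # \<beta>) (1 # \<gamma>))" .
  assume \<alpha>: "\<alpha> \<in> PP n A" "\<beta> \<in> PP n A" "\<gamma> \<in> PP n A"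
    and "\<not> True \<or> 1 # \<beta> \<notin> PP (Suc n) Ahat"
  \<comment> \<open>Since only feasibility can fail, the middle chamber is empty. By
    \<open>Delta_between\<close> the outer chambers then have no common point on the hyperplanes of
    \<open>Sdiff\<close>.\<close>
  then have "Delta (Suc n) Ahat (1 # \<beta>) = {}" using PP_deletion by blast
  moreover have "1 # \<alpha> \<in> signs (Suc n)" "1 # \<beta> \<in> signs (Suc n)" "1 # \<gamma> \<in> signs (Suc n)"
    using \<alpha> by (auto intro!: Cons_in_signs intro: PP_signs[of _ n A])
  ultimately show "poly_subst (\<lambda>j. uvar (j + 1)) (uprod (Sdiff n \<alpha> \<beta> \<gamma>)) \<in> Rideal (Suc n) Ahat (1 # \<alpha>) (1 # \<gamma>)"
    unfolding eq using Delta_between[of "1 # \<alpha>" "Suc n" "1 # \<beta>" "1 # \<gamma>"]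
    by (intro uprod_in_Rideal Sdiff_subset) blast
qed

lemma Del_map_rng_hom: "Del_map n Ahat \<in> rng_hom (Btilde n A) (Btilde (Suc n) Ahat)"
  and Del_map_fcls: "\<alpha> \<in> PP n A \<Longrightarrow> \<beta> \<in> PP n A \<Longrightarrow> p \<in> carrier (Zu n) \<Longrightarrow>
    Del_map n Ahat (fcls n A p \<alpha> \<beta>) =
      fcls (Suc n) Ahat (poly_subst (\<lambda>j. uvar (j + 1)) p) (1 # \<alpha>) (1 # \<beta>)"
proof -
  interpret sign_map n "Suc n" A Ahat "\<lambda>j. uvar (j + 1)" "\<lambda>_. True" "Cons 1" by (rule deletion_sign_map)
  have "g = (\<lambda>\<alpha> \<beta>. fsym (Suc n) Ahat (1 # \<alpha>) (1 # \<beta>))" by (simp add: fun_eq_iff g_def)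
  then have "Del_map n Ahat = induced_map (Suc n) Ahat (\<lambda>j. uvar (j + 1)) g" by (simp add: Del_map_def)
  then show "Del_map n Ahat \<in> rng_hom (Btilde n A) (Btilde (Suc n) Ahat)"
    "\<alpha> \<in> PP n A \<Longrightarrow> \<beta> \<in> PP n A \<Longrightarrow> p \<in> carrier (Zu n) \<Longrightarrow>
    Del_map n Ahat (fcls n A p \<alpha> \<beta>) =
      fcls (Suc n) Ahat (poly_subst (\<lambda>j. uvar (j + 1)) p) (1 # \<alpha>) (1 # \<beta>)"
    using induced_map_rng_hom induced_map_fcls by simp_all
qed

end

section \<open>Restriction to the first hyperplane\<close>

context
  fixes n :: nat and A' Ahat :: arrangement
  assumes A'_def: "A' = first_restriction n Ahat"
begin

lemma Delta_restriction: "x \<in> Delta n A' \<alpha> \<Longrightarrow> vcons 0 x \<in> Delta (Suc n) Ahat (1 # \<alpha>)"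
proof -
  assume x: "x \<in> Delta n A' \<alpha>"
  show ?thesis
    unfolding Delta_def
  proof (intro CollectI conjI ballI)
    show "vcons 0 x \<in> vcoset Ahat" using x by (simp add: Delta_def A'_def first_restriction_def)
    fix i assume i: "i \<in> {1..Suc n}"
    show "0 \<le> real_of_int (sgn_at (1 # \<alpha>) i) * Poly_Mapping.lookup (vcons 0 x) i"
    proof (cases "i = 1")
      case False
      then obtain j where "i = j + 1" "1 \<le> j" "j \<le> n" using i by (cases i) auto
      then show ?thesis using x by (simp add: Delta_def lookup_vcons sgn_at_Cons)
    qed (simp add: lookup_vcons)
  qed
qed

text \<open>The chamber of \<alpha> in the restriction embeds by \<open>vcons 0\<close> in the
  chamber of \<open>1 # \<alpha>\<close>, so a bound on the latter is inherited.\<close>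

lemma PP_restriction:
  assumes \<alpha>: "1 # \<alpha> \<in> PP (Suc n) Ahat" and f: "Delta n A' \<alpha> \<noteq> {}"
  shows "\<alpha> \<in> PP n A'"
proof -
  obtain h where h: "\<And>x v. x \<in> vcoset Ahat \<Longrightarrow> v \<in> vspace Ahat \<Longrightarrow> h (x + v) = h x + vfun Ahat v"
    and b: "bdd_above (h ` Delta (Suc n) Ahat (1 # \<alpha>))"
    using \<alpha> by (auto simp: PP_def bounded_sgn_def)
  have "bounded_sgn n A' \<alpha>"
    unfolding bounded_sgn_def
  proof (intro exI[of _ "h \<circ> vcons 0"] conjI ballI)
    fix x v assume "x \<in> vcoset A'" "v \<in> vspace A'"
    then show "(h \<circ> vcons 0) (x + v) = (h \<circ> vcons 0) x + vfun A' v"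
      using h[of "vcons 0 x" "vcons 0 v"] vcons_add[of 0 0 x v]
      by (simp add: A'_def first_restriction_def)
  next
    show "bdd_above ((h \<circ> vcons 0) ` Delta n A' \<alpha>)"
      by (rule bdd_above_mono[OF b]) (auto dest: Delta_restriction)
  qed
  then show ?thesis using \<alpha> f by (auto simp: PP_def feasible_def signs_def)
qed

lemma PP_hd_cases:
  assumes "\<alpha> \<in> PP (Suc n) Ahat"
  obtains b \<beta> where "\<alpha> = b # \<beta>" "b = 1 \<or> b = -1" "\<beta> \<in> signs n"
  using PP_signs[OF assms] by (rule signs_Suc_cases)

lemma poly_subst_restriction:
  "poly_subst (\<lambda>j. if j = 1 then 0 else uvar (j - 1)) (uprod (Suc ` T)) = uprod T" if "0 \<notin> T"
proof -
  have "(\<Prod>i\<in>T. if Suc i = 1 then 0 else uvar (Suc i - 1)) = uprod T"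
    unfolding uprod_def using that by (intro prod.cong) (auto split: if_splits)
  then show ?thesis by (simp add: poly_subst_uprod prod.reindex)
qed

lemma poly_subst_restriction_0:
  "finite S \<Longrightarrow> 1 \<in> S \<Longrightarrow> poly_subst (\<lambda>j. if j = 1 then 0 else uvar (j - 1)) (uprod S) = 0"
  unfolding poly_subst_uprod by (rule prod_zero) auto

text \<open>The variable of the first hyperplane goes to 0, which disposes of the generators
  involving it and of the products that pass through a vector beginning with a minus. What remains
  is a shift of indices together with the embedding \<open>vcons 0\<close>.\<close>

lemma restriction_sign_map:
  "sign_map (Suc n) n Ahat A' (\<lambda>j. if j = 1 then 0 else uvar (j - 1)) (\<lambda>\<alpha>. hd \<alpha> = 1) tl"
proof
  show "inj_on tl {\<alpha> \<in> PP (Suc n) Ahat. hd \<alpha> = 1}"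
    by (auto simp: inj_on_def elim!: PP_hd_cases)
  show "(if j = 1 then 0 else uvar (j - 1)) \<in> carrier (Zu n)" if "j \<in> {1..Suc n}" for j
    using that by auto
next
  fix \<alpha> \<beta> S assume *: "S \<subseteq> {1..Suc n}" "Delta (Suc n) Ahat \<alpha> \<inter> Delta (Suc n) Ahat \<beta> \<inter> HS Ahat S = {}"
    and PP: "\<alpha> \<in> PP (Suc n) Ahat" "\<beta> \<in> PP (Suc n) Ahat" "hd \<alpha> = 1" "hd \<beta> = 1"
  obtain \<alpha>' \<beta>' where \<alpha>: "\<alpha> = 1 # \<alpha>'" "\<beta> = 1 # \<beta>'" using PP by (auto elim!: PP_hd_cases)
  show "poly_subst (\<lambda>j. if j = 1 then 0 else uvar (j - 1)) (uprod S) \<in> Rideal n A' (tl \<alpha>) (tl \<beta>)"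
  proof (cases "1 \<in> S")
    case True
    then show ?thesis using finite_subset[OF *(1)] poly_subst_restriction_0[of S] by (simp add: Rideal_closed)
  next
    case False
    \<comment> \<open>As \<open>1 \<notin> S\<close>, every index in \<open>S\<close> is at least 2,
      so the shift down is reversible and stays within the positive indices.\<close>
    define T where "T = (\<lambda>i. i - 1) ` S"
    have ge: "2 \<le> i \<and> i \<le> Suc n" if "i \<in> S" for i
    proof -
      have "i \<noteq> 1" "1 \<le> i" "i \<le> Suc n" using *(1) False that by auto
      then show ?thesis by simp
    qed
    have "Suc ` T = id ` S" unfolding T_def image_image by (rule image_cong) (auto dest: ge)
    then have S: "S = Suc ` T" by simp
    have T: "T \<subseteq> {1..n}" unfolding T_def by (force dest: ge)
    have HS: "vcons 0 x \<in> HS Ahat S" if "x \<in> HS A' T" for x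
      using that by (auto simp: HS_def S lookup_vcons A'_def first_restriction_def)
    have "uprod T \<in> Rideal n A' \<alpha>' \<beta>'"
      using T *(2) HS by (intro uprod_in_Rideal) (auto simp: \<alpha> dest!: Delta_restriction)
    moreover have "0 \<notin> T" using T by auto
    ultimately show ?thesis using poly_subst_restriction by (simp add: \<alpha> S)
  qed
next
  fix \<alpha> \<beta> \<gamma> assume PP: "\<alpha> \<in> PP (Suc n) Ahat" "\<beta> \<in> PP (Suc n) Ahat" "\<gamma> \<in> PP (Suc n) Ahat"
    and hd: "hd \<alpha> = 1" "hd \<beta> = 1" "hd \<gamma> = 1"
  obtain \<alpha>' \<beta>' \<gamma>' where \<alpha>: "\<alpha> = 1 # \<alpha>'" "\<beta> = 1 # \<beta>'" "\<gamma> = 1 # \<gamma>'" using PP hd by (auto elim!: PP_hd_cases)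
  have "0 \<notin> Sdiff n \<alpha>' \<beta>' \<gamma>'" by (simp add: Sdiff_def)
  then show "poly_subst (\<lambda>j. if j = 1 then 0 else uvar (j - 1)) (uprod (Sdiff (Suc n) \<alpha> \<beta> \<gamma>)) =
      uprod (Sdiff n (tl \<alpha>) (tl \<beta>) (tl \<gamma>))"
    unfolding \<alpha> Sdiff_Cons list.sel by (rule poly_subst_restriction)
next
  fix \<alpha> \<beta> \<gamma> assume PP: "\<alpha> \<in> PP (Suc n) Ahat" "\<beta> \<in> PP (Suc n) Ahat" "\<gamma> \<in> PP (Suc n) Ahat"
    and hd: "hd \<alpha> = 1" "hd \<gamma> = 1" and out: "hd \<beta> \<noteq> 1 \<or> tl \<beta> \<notin> PP n A'"
  obtain \<alpha>' \<gamma>' b \<beta>' where \<alpha>: "\<alpha> = 1 # \<alpha>'" "\<beta> = b # \<beta>'" "\<gamma> = 1 # \<gamma>'" and b: "b = 1 \<or> b = -1"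
    and signs: "\<alpha>' \<in> signs n" "\<beta>' \<in> signs n" "\<gamma>' \<in> signs n"
    using PP hd by (auto elim!: PP_hd_cases)
  show "poly_subst (\<lambda>j. if j = 1 then 0 else uvar (j - 1)) (uprod (Sdiff (Suc n) \<alpha> \<beta> \<gamma>)) \<in> Rideal n A' (tl \<alpha>) (tl \<gamma>)"
  proof (cases "b = 1")
    case True
    have "0 \<notin> Sdiff n \<alpha>' \<beta>' \<gamma>'" by (simp add: Sdiff_def)
    then have eq: "poly_subst (\<lambda>j. if j = 1 then 0 else uvar (j - 1)) (uprod (Sdiff (Suc n) \<alpha> \<beta> \<gamma>)) =
        uprod (Sdiff n \<alpha>' \<beta>' \<gamma>')"
      unfolding \<alpha> True Sdiff_Cons by (rule poly_subst_restriction)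
    have "Delta n A' \<beta>' = {}" using PP_restriction[of \<beta>'] PP(2) out by (auto simp: \<alpha> True)
    then show ?thesis unfolding eq unfolding \<alpha> list.sel using Delta_between[OF signs]
      by (intro uprod_in_Rideal Sdiff_subset) blast
  next
    case False
    \<comment> \<open>The outer vectors begin with a plus and the middle one with a minus, so the
      first hyperplane is crossed twice and the monomial contains the variable sent to 0.\<close>
    then have "1 \<in> Sdiff (Suc n) \<alpha> \<beta> \<gamma>" by (simp add: Sdiff_def \<alpha> sgn_at_def)
    moreover have "finite (Sdiff (Suc n) \<alpha> \<beta> \<gamma>)" by (simp add: Sdiff_def)
    ultimately show ?thesis using poly_subst_restriction_0 by (simp add: Rideal_closed)
  qed
qed

lemma Rest_map_rng_hom: "Rest_map n A' \<in> rng_hom (Btilde (Suc n) Ahat) (Btilde n A')"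
  and Rest_map_fcls: "1 # \<alpha> \<in> PP (Suc n) Ahat \<Longrightarrow> 1 # \<beta> \<in> PP (Suc n) Ahat \<Longrightarrow> p \<in> carrier (Zu (Suc n)) \<Longrightarrow>
    Rest_map n A' (fcls (Suc n) Ahat p (1 # \<alpha>) (1 # \<beta>)) =
      fcls n A' (poly_subst (\<lambda>j. if j = 1 then 0 else uvar (j - 1)) p) \<alpha> \<beta>"
proof -
  interpret sign_map "Suc n" n Ahat A' "\<lambda>j. if j = 1 then 0 else uvar (j - 1)" "\<lambda>\<alpha>. hd \<alpha> = 1" tl
    by (rule restriction_sign_map)
  have "g = (\<lambda>\<alpha> \<beta>. if hd \<alpha> = 1 \<and> hd \<beta> = 1 then fsym n A' (tl \<alpha>) (tl \<beta>) else 0)" by (simp add: fun_eq_iff g_def)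
  then have "Rest_map n A' = induced_map n A' (\<lambda>j. if j = 1 then 0 else uvar (j - 1)) g" by (simp add: Rest_map_def)
  then show "Rest_map n A' \<in> rng_hom (Btilde (Suc n) Ahat) (Btilde n A')"
    "1 # \<alpha> \<in> PP (Suc n) Ahat \<Longrightarrow> 1 # \<beta> \<in> PP (Suc n) Ahat \<Longrightarrow> p \<in> carrier (Zu (Suc n)) \<Longrightarrow>
    Rest_map n A' (fcls (Suc n) Ahat p (1 # \<alpha>) (1 # \<beta>)) =
      fcls n A' (poly_subst (\<lambda>j. if j = 1 then 0 else uvar (j - 1)) p) \<alpha> \<beta>"
    using induced_map_rng_hom induced_map_fcls[of "1 # \<alpha>" "1 # \<beta>" p] by simp_all
qed

end

section \<open>Negation of an arrangement\<close>

lemma poly_subst_uvar_uprod: "poly_subst uvar (uprod S) = uprod S"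
  by (simp only: poly_subst_uprod) (simp add: uprod_def)

lemma sgn_at_uminus: "\<alpha> \<in> signs n \<Longrightarrow> i \<in> {1..n} \<Longrightarrow> sgn_at (map uminus \<alpha>) i = - sgn_at \<alpha> i"
  by (cases i) (auto simp: sgn_at_def signs_def)

lemma uminus_signs: "\<alpha> \<in> signs n \<Longrightarrow> map uminus \<alpha> \<in> signs n"
  by (auto simp: signs_def)

lemma uminus_uminus_sgnvec [simp]: "map uminus (map uminus \<alpha>) = (\<alpha> :: sgnvec)"
  by (simp add: map_idI)

context
  fixes n :: nat and A' A'' :: arrangement
  assumes A''_def: "A'' = negate_arrangement A'"
    and odd: "\<And>v. v \<in> vspace A' \<Longrightarrow> - v \<in> vspace A' \<and> vfun A' (- v) = - vfun A' v"
begin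

lemma Delta_negate: "\<alpha> \<in> signs n \<Longrightarrow> Delta n A'' (map uminus \<alpha>) = uminus ` Delta n A' \<alpha>"
  by (auto simp: Delta_def A''_def negate_arrangement_def sgn_at_uminus)

text \<open>Chambers are reflected by \<open>uminus\<close>. The function
  \<open>h \<circ> uminus\<close> serves in both directions, because the sign from reflecting
  \<open>v\<close> cancels the sign of the negated functional.\<close>

lemma PP_negate_iff:
  assumes \<alpha>: "\<alpha> \<in> signs n"
  shows "map uminus \<alpha> \<in> PP n A'' \<longleftrightarrow> \<alpha> \<in> PP n A'"
proof -
  have "bounded_sgn n A'' (map uminus \<alpha>) \<longleftrightarrow> bounded_sgn n A' \<alpha>"
  proof
    assume "bounded_sgn n A'' (map uminus \<alpha>)"
    then obtain h where h: "\<And>x v. x \<in> vcoset A'' \<Longrightarrow> v \<in> vspace A'' \<Longrightarrow> h (x + v) = h x + vfun A'' v"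
      and b: "bdd_above (h ` Delta n A'' (map uminus \<alpha>))"
      by (auto simp: bounded_sgn_def)
    show "bounded_sgn n A' \<alpha>"
      unfolding bounded_sgn_def
    proof (intro exI[of _ "h \<circ> uminus"] conjI ballI)
      fix x v assume "x \<in> vcoset A'" "v \<in> vspace A'"
      then show "(h \<circ> uminus) (x + v) = (h \<circ> uminus) x + vfun A' v"
        using h[of "- x" "- v"] odd[of v] by (simp add: A''_def negate_arrangement_def)
    next
      show "bdd_above ((h \<circ> uminus) ` Delta n A' \<alpha>)"
        using b by (simp add: Delta_negate[OF \<alpha>] image_comp)
    qed
  next
    assume "bounded_sgn n A' \<alpha>"
    then obtain h where h: "\<And>x v. x \<in> vcoset A' \<Longrightarrow> v \<in> vspace A' \<Longrightarrow> h (x + v) = h x + vfun A' v"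
      and b: "bdd_above (h ` Delta n A' \<alpha>)"
      by (auto simp: bounded_sgn_def)
    show "bounded_sgn n A'' (map uminus \<alpha>)"
      unfolding bounded_sgn_def
    proof (intro exI[of _ "h \<circ> uminus"] conjI ballI)
      fix x v assume "x \<in> vcoset A''" "v \<in> vspace A''"
      then show "(h \<circ> uminus) (x + v) = (h \<circ> uminus) x + vfun A'' v"
        using h[of "- x" "- v"] odd[of v] by (auto simp: A''_def negate_arrangement_def)
    next
      show "bdd_above ((h \<circ> uminus) ` Delta n A'' (map uminus \<alpha>))"
        using b by (simp add: Delta_negate[OF \<alpha>] image_comp)
    qed
  qed
  then show ?thesis using \<alpha> by (simp add: PP_def uminus_signs feasible_def Delta_negate)
qed

lemma negate_sign_map: "sign_map n n A' A'' uvar (\<lambda>_. True) (map uminus)"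
proof
  show "inj_on (map uminus) {\<alpha> \<in> PP n A'. True}" by (metis (mono_tags, lifting) inj_onI uminus_uminus_sgnvec)
  show "uvar j \<in> carrier (Zu n)" if "j \<in> {1..n}" for j using that by simp
next
  fix \<alpha> \<beta> S assume *: "S \<subseteq> {1..n}" "Delta n A' \<alpha> \<inter> Delta n A' \<beta> \<inter> HS A' S = {}"
    and "\<alpha> \<in> PP n A'" "\<beta> \<in> PP n A'"
  then have D: "Delta n A'' (map uminus \<alpha>) = uminus ` Delta n A' \<alpha>" "Delta n A'' (map uminus \<beta>) = uminus ` Delta n A' \<beta>"
    by (simp_all add: Delta_negate PP_signs)
  have "HS A'' S = uminus ` HS A' S" by (auto simp: HS_def A''_def negate_arrangement_def)
  then have "Delta n A'' (map uminus \<alpha>) \<inter> Delta n A'' (map uminus \<beta>) \<inter> HS A'' S = {}"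
    using *(2) by (auto simp: D)
  then show "poly_subst uvar (uprod S) \<in> Rideal n A'' (map uminus \<alpha>) (map uminus \<beta>)"
    using uprod_in_Rideal[OF *(1)] by (simp add: poly_subst_uvar_uprod)
next
  fix \<alpha> \<beta> \<gamma> assume "\<alpha> \<in> PP n A'" "\<beta> \<in> PP n A'" "\<gamma> \<in> PP n A'"
  then have "Sdiff n (map uminus \<alpha>) (map uminus \<beta>) (map uminus \<gamma>) = Sdiff n \<alpha> \<beta> \<gamma>"
    by (auto simp: Sdiff_def sgn_at_uminus[OF PP_signs] simp del: One_nat_def atLeastAtMost_iff)
  then show "poly_subst uvar (uprod (Sdiff n \<alpha> \<beta> \<gamma>)) =
      uprod (Sdiff n (map uminus \<alpha>) (map uminus \<beta>) (map uminus \<gamma>))"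
    by (simp add: poly_subst_uvar_uprod)
next
  fix \<beta> assume "\<beta> \<in> PP n A'" "\<not> True \<or> map uminus \<beta> \<notin> PP n A''"
  \<comment> \<open>Negation matches the two sets \<open>PP\<close>, so no middle vector is ever
    lost.\<close>
  then have False using PP_negate_iff[OF PP_signs] by blast
  then show "poly_subst uvar (uprod (Sdiff n \<alpha> \<beta> \<gamma>)) \<in> Rideal n A'' (map uminus \<alpha>) (map uminus \<gamma>)" for \<alpha> \<gamma> ..
qed

lemma Neg_map_rng_hom: "Neg_map n A'' \<in> rng_hom (Btilde n A') (Btilde n A'')"
  and Neg_map_fcls: "\<alpha> \<in> PP n A' \<Longrightarrow> \<beta> \<in> PP n A' \<Longrightarrow> p \<in> carrier (Zu n) \<Longrightarrow>
    Neg_map n A'' (fcls n A' p \<alpha> \<beta>) = fcls n A'' (poly_subst uvar p) (map uminus \<alpha>) (map uminus \<beta>)"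
proof -
  interpret sign_map n n A' A'' uvar "\<lambda>_. True" "map uminus" by (rule negate_sign_map)
  have "g = (\<lambda>\<alpha> \<beta>. fsym n A'' (map uminus \<alpha>) (map uminus \<beta>))" by (simp add: fun_eq_iff g_def)
  then have "Neg_map n A'' = induced_map n A'' uvar g" by (simp add: Neg_map_def)
  then show "Neg_map n A'' \<in> rng_hom (Btilde n A') (Btilde n A'')"
    "\<alpha> \<in> PP n A' \<Longrightarrow> \<beta> \<in> PP n A' \<Longrightarrow> p \<in> carrier (Zu n) \<Longrightarrow>
    Neg_map n A'' (fcls n A' p \<alpha> \<beta>) = fcls n A'' (poly_subst uvar p) (map uminus \<alpha>) (map uminus \<beta>)"
    using induced_map_rng_hom induced_map_fcls by simp_all
qed

end

section \<open>Corner rings and generators of the truncated quiver algebra\<close>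

text \<open>The corner consists of the elements that \<open>e\<close> fixes on both sides; in this
  form closure under the operations is equational.\<close>

lemma (in ring) corner_ring:
  assumes e: "e \<in> carrier R" "e \<otimes> e = e"
  shows "ring (R\<lparr>carrier := {e \<otimes> x \<otimes> e | x. x \<in> carrier R}, one := e\<rparr>)"
proof -
  let ?C = "{e \<otimes> x \<otimes> e | x. x \<in> carrier R}"
  have C_iff: "x \<in> ?C \<longleftrightarrow> x \<in> carrier R \<and> e \<otimes> x = x \<and> x \<otimes> e = x" for x
  proof
    assume "x \<in> ?C"
    then obtain y where y: "y \<in> carrier R" "x = e \<otimes> y \<otimes> e" by blast
    have "e \<otimes> x = (e \<otimes> e) \<otimes> y \<otimes> e" "x \<otimes> e = e \<otimes> y \<otimes> (e \<otimes> e)"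
      using y e(1) by (simp_all add: m_assoc)
    then show "x \<in> carrier R \<and> e \<otimes> x = x \<and> x \<otimes> e = x" using y e by simp
  next
    assume "x \<in> carrier R \<and> e \<otimes> x = x \<and> x \<otimes> e = x"
    then show "x \<in> ?C" by (auto intro!: exI[of _ x])
  qed
  show ?thesis
    unfolding Collect_mem_eq
  proof (rule ringI)
    let ?S = "R\<lparr>carrier := ?C, one := e\<rparr>"
    show "abelian_group ?S"
    proof (rule abelian_groupI)
      fix x assume "x \<in> carrier ?S"
      then have x: "x \<in> carrier R" "e \<otimes> x = x" "x \<otimes> e = x" using C_iff by auto
      then have "\<ominus> x \<in> ?C" unfolding C_iff using e by (simp add: l_minus r_minus)
      then have "\<ominus> x \<in> carrier ?S" by simp
      moreover have "\<ominus> x \<oplus>\<^bsub>?S\<^esub> x = \<zero>\<^bsub>?S\<^esub>" using x by (simp add: l_neg)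
      ultimately show "\<exists>y\<in>carrier ?S. y \<oplus>\<^bsub>?S\<^esub> x = \<zero>\<^bsub>?S\<^esub>" by blast
    qed (use e in \<open>auto simp: C_iff l_distr r_distr a_ac simp del: mem_Collect_eq\<close>)
    show "Group.monoid ?S"
    proof (rule monoidI)
      fix x y assume "x \<in> carrier ?S" "y \<in> carrier ?S"
      then have "x \<in> ?C" "y \<in> ?C" by auto
      then have xy: "x \<in> carrier R" "e \<otimes> x = x" "y \<in> carrier R" "y \<otimes> e = y" unfolding C_iff by auto
      have "e \<otimes> (x \<otimes> y) = (e \<otimes> x) \<otimes> y" "(x \<otimes> y) \<otimes> e = x \<otimes> (y \<otimes> e)"
        by (rule m_assoc[OF e(1) xy(1,3), symmetric], rule m_assoc[OF xy(1,3) e(1)])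
      then have "x \<otimes> y \<in> ?C" unfolding C_iff using xy(1,3) by (simp only: xy(2,4) m_closed simp_thms)
      then show "x \<otimes>\<^bsub>?S\<^esub> y \<in> carrier ?S" by simp
    qed (use e in \<open>auto simp: C_iff m_assoc simp del: mem_Collect_eq\<close>)
  qed (auto simp: C_iff l_distr r_distr simp del: mem_Collect_eq)
qed

lemma left_idem_qcls: "left_idem n k = qcls n k (\<Sum>x\<in>ksubsets {..<n} k. Poly_Mapping.single (x, []) 1)"
  by (simp add: left_idem_def qcls_def)

lemma ksubsets_subset: "x \<in> ksubsets {..<n} k \<Longrightarrow> x \<in> ksubsets {0..n} k"
  by (auto simp: ksubsets_def)

lemma left_idem_closed:
  "(\<Sum>x\<in>X. Poly_Mapping.single (x, []) 1) \<in> carrier (path_algebra n k)" if "X \<subseteq> ksubsets {..<n} k"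
  using that by (intro path_algebra_sum_closed single_in_path_algebra) (auto simp: qpaths_iff ksubsets_subset)

text \<open>Only the two ends have to avoid \<open>n\<close>; intermediate vertices may contain
  it.\<close>

definition corner_paths :: "nat \<Rightarrow> nat \<Rightarrow> qpath set" where
  "corner_paths n k = {(x, w). x \<in> ksubsets {..<n} k \<and> is_walk n x w \<and> fold target w x \<in> ksubsets {..<n} k}"

lemma corner_paths_qpaths: "corner_paths n k \<subseteq> qpaths n k"
  by (auto simp: corner_paths_def qpaths_iff ksubsets_subset)

lemma left_idem_mult_path:
  assumes "p \<in> qpaths n k"
  shows "bilinear_ext path_mult (bilinear_ext path_mult (\<Sum>x\<in>ksubsets {..<n} k. Poly_Mapping.single (x, []) 1)
      (Poly_Mapping.single p 1)) (\<Sum>x\<in>ksubsets {..<n} k. Poly_Mapping.single (x, []) 1) =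
    (if p \<in> corner_paths n k then Poly_Mapping.single p (1 :: int) else 0)"
  using assms
  by (cases p) (simp add: ksubset_mult_path corner_paths_def qpaths_iff, simp add: walk_end_def)

lemma left_idem_idem:
  "left_idem n k \<in> carrier (BB n k)" "left_idem n k \<otimes>\<^bsub>BB n k\<^esub> left_idem n k = left_idem n k"
proof -
  let ?E = "\<Sum>x\<in>ksubsets {..<n} k. Poly_Mapping.single (x, []) (1 :: int)"
  have E: "?E \<in> carrier (path_algebra n k)" by (rule left_idem_closed) simp
  then show "left_idem n k \<in> carrier (BB n k)" by (simp add: left_idem_qcls qcls_closed)
  have "bilinear_ext path_mult ?E ?E = (\<Sum>x\<in>ksubsets {..<n} k. bilinear_ext path_mult ?E (Poly_Mapping.single (x, []) 1))"
    by (rule bilinear_ext_sum_right)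
  also have "\<dots> = ?E" by (intro sum.cong refl) (simp add: ksubset_mult_path)
  finally show "left_idem n k \<otimes>\<^bsub>BB n k\<^esub> left_idem n k = left_idem n k"
    using E by (simp add: left_idem_qcls flip: qcls_mult)
qed

lemma ring_Bl: "ring (Bl n k)"
  unfolding Bl_def by (rule ring.corner_ring[OF ring_BB left_idem_idem])

lemma Bl_simps [simp]:
  "x \<oplus>\<^bsub>Bl n k\<^esub> y = x \<oplus>\<^bsub>BB n k\<^esub> y" "x \<otimes>\<^bsub>Bl n k\<^esub> y = x \<otimes>\<^bsub>BB n k\<^esub> y" "\<zero>\<^bsub>Bl n k\<^esub> = \<zero>\<^bsub>BB n k\<^esub>"
  "\<one>\<^bsub>Bl n k\<^esub> = left_idem n k"
  by (simp_all add: Bl_def)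

text \<open>This replaces the abstract corner by classes of combinations of
  \<open>corner_paths\<close>, on which the rewriting of paths can act.\<close>

lemma corner_qcls:
  assumes F: "F \<in> carrier (path_algebra n k)"
  shows "left_idem n k \<otimes>\<^bsub>BB n k\<^esub> qcls n k F \<otimes>\<^bsub>BB n k\<^esub> left_idem n k =
    qcls n k (\<Sum>p\<in>Poly_Mapping.keys F \<inter> corner_paths n k. Poly_Mapping.single p (Poly_Mapping.lookup F p))"
proof -
  interpret ring "path_algebra n k" by (rule ring_path_algebra)
  let ?E = "\<Sum>x\<in>ksubsets {..<n} k. Poly_Mapping.single (x, []) (1 :: int)"
  have E: "?E \<in> carrier (path_algebra n k)" by (rule left_idem_closed) simp
  have EF: "bilinear_ext path_mult ?E F \<in> carrier (path_algebra n k)" using m_closed[OF E F] by simp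
  have "left_idem n k \<otimes>\<^bsub>BB n k\<^esub> qcls n k F \<otimes>\<^bsub>BB n k\<^esub> left_idem n k =
      qcls n k (bilinear_ext path_mult (bilinear_ext path_mult ?E F) ?E)"
    using E F EF by (simp add: left_idem_qcls qcls_mult)
  also have "bilinear_ext path_mult (bilinear_ext path_mult ?E F) ?E =
      (\<Sum>p\<in>Poly_Mapping.keys F. scale (Poly_Mapping.lookup F p)
        (bilinear_ext path_mult (bilinear_ext path_mult ?E (Poly_Mapping.single p 1)) ?E))"
    by (subst bilinear_ext_linear_right[of _ _ F]) (simp only: bilinear_ext_sum_left bilinear_ext_scale_left)
  also have "\<dots> = (\<Sum>p\<in>Poly_Mapping.keys F. if p \<in> corner_paths n k then Poly_Mapping.single p (Poly_Mapping.lookup F p) else 0)"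
  proof (rule sum.cong[OF refl])
    fix p assume "p \<in> Poly_Mapping.keys F"
    then have "p \<in> qpaths n k" using F by (auto simp: carrier_path_algebra)
    then show "scale (Poly_Mapping.lookup F p) (bilinear_ext path_mult (bilinear_ext path_mult ?E (Poly_Mapping.single p 1)) ?E) =
        (if p \<in> corner_paths n k then Poly_Mapping.single p (Poly_Mapping.lookup F p) else 0)"
      by (simp add: left_idem_mult_path)
  qed
  also have "\<dots> = (\<Sum>p\<in>Poly_Mapping.keys F \<inter> corner_paths n k. Poly_Mapping.single p (Poly_Mapping.lookup F p))"
    by (simp add: sum.inter_restrict)
  finally show ?thesis .
qed

lemma carrier_Bl: "carrier (Bl n k) = qcls n k ` {F. Poly_Mapping.keys F \<subseteq> corner_paths n k}"
proof -
  have "carrier (Bl n k) = {left_idem n k \<otimes>\<^bsub>BB n k\<^esub> qcls n k F \<otimes>\<^bsub>BB n k\<^esub> left_idem n k | F. F \<in> carrier (path_algebra n k)}"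
    unfolding Bl_def using qcls_closed
    by (auto simp: BB_def qcls_def elim!: rcos_closed_elim)
  also have "\<dots> = qcls n k ` {F. Poly_Mapping.keys F \<subseteq> corner_paths n k}"
  proof (intro equalityI subsetI)
    fix X assume "X \<in> {left_idem n k \<otimes>\<^bsub>BB n k\<^esub> qcls n k F \<otimes>\<^bsub>BB n k\<^esub> left_idem n k | F. F \<in> carrier (path_algebra n k)}"
    then obtain F where F: "F \<in> carrier (path_algebra n k)"
      "X = left_idem n k \<otimes>\<^bsub>BB n k\<^esub> qcls n k F \<otimes>\<^bsub>BB n k\<^esub> left_idem n k" by blast
    let ?G = "\<Sum>p\<in>Poly_Mapping.keys F \<inter> corner_paths n k. Poly_Mapping.single p (Poly_Mapping.lookup F p)"
    have "Poly_Mapping.keys ?G \<subseteq> corner_paths n k"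
      by (rule order_trans[OF keys_sum]) (auto simp: split: if_splits)
    then show "X \<in> qcls n k ` {F. Poly_Mapping.keys F \<subseteq> corner_paths n k}" using F by (auto simp: corner_qcls)
  next
    fix X assume "X \<in> qcls n k ` {F. Poly_Mapping.keys F \<subseteq> corner_paths n k}"
    then obtain F where F: "Poly_Mapping.keys F \<subseteq> corner_paths n k" "X = qcls n k F" by blast
    then have "F \<in> carrier (path_algebra n k)" using corner_paths_qpaths by (auto simp: carrier_path_algebra)
    moreover have "(\<Sum>p\<in>Poly_Mapping.keys F \<inter> corner_paths n k. Poly_Mapping.single p (Poly_Mapping.lookup F p)) = F"
      using F(1) by (simp add: Int_absorb2 sum_scale_single)
    ultimately show "X \<in> {left_idem n k \<otimes>\<^bsub>BB n k\<^esub> qcls n k F \<otimes>\<^bsub>BB n k\<^esub> left_idem n k | F. F \<in> carrier (path_algebra n k)}"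
      using F(2) by (intro CollectI exI[of _ F]) (simp add: corner_qcls)
  qed
  finally show ?thesis .
qed

lemma pcls_in_Bl: "(x, w) \<in> corner_paths n k \<Longrightarrow> pcls n k x w \<in> carrier (Bl n k)"
  by (auto simp: carrier_Bl pcls_qcls)

lemma target_avoids_last: "is_arrow n a x \<Longrightarrow> arr_index a < n \<Longrightarrow> x \<subseteq> {..<n} \<Longrightarrow> target a x \<subseteq> {..<n}"
  by (cases a) auto

text \<open>A combination of corner paths is reduced by additivity to single paths, and each of
  these to an equivalent path without arrows of index \<open>n\<close>. The homomorphisms need not
  be unital, so agreement on the vertices is among the conditions.\<close>

lemma rng_hom_Bl_eqI:
  assumes T: "ring T" and \<phi>: "\<phi> \<in> rng_hom (Bl n k) T" and \<psi>: "\<psi> \<in> rng_hom (Bl n k) T"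
    and idem: "\<And>x. x \<in> ksubsets {..<n} k \<Longrightarrow> \<phi> (pcls n k x []) = \<psi> (pcls n k x [])"
    and arr: "\<And>x a i. x \<in> ksubsets {..<n} k \<Longrightarrow> a \<in> {ArrR i, ArrL i} \<Longrightarrow> is_arrow n a x \<Longrightarrow> target a x \<subseteq> {..<n} \<Longrightarrow>
      \<phi> (pcls n k x [a]) = \<psi> (pcls n k x [a])"
    and loop: "\<And>x i. x \<in> ksubsets {..<n} k \<Longrightarrow> i \<in> {1..n} \<Longrightarrow> \<phi> (pcls n k x [LoopU i]) = \<psi> (pcls n k x [LoopU i])"
    and X: "X \<in> carrier (Bl n k)"
  shows "\<phi> X = \<psi> X"
proof -
  interpret T: ring T by fact
  interpret Bl: ring "Bl n k" by (rule ring_Bl)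
  \<comment> \<open>Without arrows of index \<open>n\<close> a walk never leaves the truncation, so
    every prefix ends at a vertex there and the word factors into generators.\<close>
  have low: "(x, w) \<in> corner_paths n k \<and> \<phi> (pcls n k x w) = \<psi> (pcls n k x w)"
    if "x \<in> ksubsets {..<n} k" "is_walk n x w" "\<forall>a\<in>set w. arr_index a < n" for x w
    using that
  proof (induction w arbitrary: x)
    case Nil
    then show ?case using idem by (simp add: corner_paths_def)
  next
    case (Cons a w)
    have "target a x \<subseteq> {..<n}" using Cons.prems by (intro target_avoids_last) (auto simp: ksubsets_def)
    moreover have "card (target a x) = k"
      using fold_target_closed[of n x "[a]" k] Cons.prems ksubsets_subset by (auto simp: ksubsets_def)
    ultimately have t: "target a x \<in> ksubsets {..<n} k" by (simp add: ksubsets_def)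
    note IH = Cons.IH[OF t] and a_arr = \<open>is_walk n x (a # w)\<close>
    have w: "(target a x, w) \<in> corner_paths n k" "\<phi> (pcls n k (target a x) w) = \<psi> (pcls n k (target a x) w)"
      using IH Cons.prems by auto
    have a: "(x, [a]) \<in> corner_paths n k" using Cons.prems t by (simp add: corner_paths_def)
    have "\<phi> (pcls n k x [a]) = \<psi> (pcls n k x [a])"
      using arr[of x a "arr_index a"] loop[of x] Cons.prems \<open>target a x \<subseteq> {..<n}\<close> by (cases a) auto
    moreover have "pcls n k x (a # w) = pcls n k x [a] \<otimes>\<^bsub>Bl n k\<^esub> pcls n k (target a x) w"
      using a w(1) corner_paths_qpaths by (simp add: pcls_mult subset_iff)
    moreover have "(x, a # w) \<in> corner_paths n k" using a w(1) Cons.prems by (auto simp: corner_paths_def)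
    ultimately show ?case
      using w pcls_in_Bl[OF a] pcls_in_Bl[OF w(1)] by (simp add: rng_hom_mult[OF \<phi>] rng_hom_mult[OF \<psi>] del: Bl_simps)
  qed
  obtain F where F: "Poly_Mapping.keys F \<subseteq> corner_paths n k" "X = qcls n k F" using X by (auto simp: carrier_Bl)
  have "Poly_Mapping.keys F \<subseteq> corner_paths n k \<and> \<phi> (qcls n k F) = \<psi> (qcls n k F)"
    using F(1)
  proof (induction F rule: frag_induction)
    case zero
    show ?case
      using rng_hom_zero[OF ring_Bl T \<phi>] rng_hom_zero[OF ring_Bl T \<psi>] Bl.zero_closed
      by (simp add: qcls_zero)
  next
    case (one p)
    then obtain x w where p: "p = (x, w)" "x \<in> ksubsets {..<n} k" "is_walk n x w" "fold target w x \<in> ksubsets {..<n} k"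
      by (auto simp: corner_paths_def)
    from reduce_avoiding_last[OF p(2-)] obtain w' where w': "path_equiv n k x w w'" "\<forall>a\<in>set w'. arr_index a < n"
      by blast
    have "qcls n k (frag_of p) = pcls n k x w'" using w'(1) by (simp add: p(1) pcls_qcls path_equiv_def)
    moreover have "is_walk n x w'" using w'(1) by (simp add: path_equiv_def)
    ultimately show ?case using low[OF p(2) _ w'(2)] one by simp
  next
    case (diff a b)
    have c: "F \<in> carrier (path_algebra n k)" "qcls n k F \<in> carrier (Bl n k)"
      if "Poly_Mapping.keys F \<subseteq> corner_paths n k" for F
      using that corner_paths_qpaths by (auto simp: carrier_path_algebra carrier_Bl)
    have ab: "Poly_Mapping.keys (a - b) \<subseteq> corner_paths n k" using diff keys_diff[of a b] by blast
    \<comment> \<open>\<open>rng_hom\<close> speaks of sums only, so the difference is treated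
      through \<open>a = (a - b) + b\<close> and cancellation.\<close>
    have "qcls n k a = qcls n k (a - b) \<oplus>\<^bsub>Bl n k\<^esub> qcls n k b"
      using c(1) ab diff by (simp flip: qcls_add)
    then have "\<phi> (qcls n k (a - b)) \<oplus>\<^bsub>T\<^esub> \<phi> (qcls n k b) = \<psi> (qcls n k (a - b)) \<oplus>\<^bsub>T\<^esub> \<phi> (qcls n k b)"
      using diff ab c(2) by (metis rng_hom_add[OF \<phi>] rng_hom_add[OF \<psi>])
    then have "\<phi> (qcls n k (a - b)) = \<psi> (qcls n k (a - b))"
      using diff ab c(2) by (simp add: rng_hom_closed[OF \<phi>] rng_hom_closed[OF \<psi>])
    then show ?case using ab by simp
  qed
  then show ?thesis by (simp add: F(2))
qed

section \<open>Sign vectors as subsets\<close>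

text \<open>On sign vectors this is the inverse of \<open>sgn_of\<close>. Position 0 compares the
  first entry with the prepended plus.\<close>

definition sign_changes :: "nat \<Rightarrow> sgnvec \<Rightarrow> nat set" where
  "sign_changes n \<alpha> = {i. i < n \<and> sgn_at \<alpha> i \<noteq> sgn_at \<alpha> (i + 1)}"

lemma sgn_at_0 [simp]: "sgn_at \<alpha> 0 = 1"
  by (simp add: sgn_at_def)

lemma sgn_at_Suc_eq:
  assumes "\<alpha> \<in> signs n" "i < n"
  shows "sgn_at \<alpha> (Suc i) = (if i \<in> sign_changes n \<alpha> then - sgn_at \<alpha> i else sgn_at \<alpha> i)"
proof -
  have "i \<le> n" "Suc i \<le> n" using assms(2) by auto
  then show ?thesis
    using sgn_at_cases[OF assms(1) \<open>i \<le> n\<close>] sgn_at_cases[OF assms(1) \<open>Suc i \<le> n\<close>] assms(2)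
    by (elim disjE) (simp_all add: sign_changes_def)
qed

text \<open>Starting from the prepended plus, the set of changes determines the entries one after
  the other.\<close>

lemma sign_changes_inj:
  assumes "\<alpha> \<in> signs n" "\<beta> \<in> signs n" "sign_changes n \<alpha> = sign_changes n \<beta>"
  shows "\<alpha> = \<beta>"
proof -
  have eq: "i \<le> n \<Longrightarrow> sgn_at \<alpha> i = sgn_at \<beta> i" for i
  proof (induction i)
    case (Suc i)
    then show ?case using assms by (simp add: sgn_at_Suc_eq)
  qed simp
  show ?thesis
  proof (rule nth_equalityI)
    show "length \<alpha> = length \<beta>" using assms by (simp add: signs_def)
    fix i assume "i < length \<alpha>"
    then show "\<alpha> ! i = \<beta> ! i" using eq[of "Suc i"] assms(1) by (simp add: sgn_at_def signs_def)
  qed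
qed

lemma sign_changes_surj:
  assumes "x \<subseteq> {..<n}"
  obtains \<alpha> where "\<alpha> \<in> signs n" "sign_changes n \<alpha> = x"
proof -
  \<comment> \<open>The sign at \<open>j\<close> is given by the parity of the number of prescribed
    changes before \<open>j\<close>.\<close>
  define p where "p = (\<lambda>j. if even (card (x \<inter> {..<j})) then 1 else -1 :: int)"
  define \<alpha> where "\<alpha> = map (\<lambda>j. p (Suc j)) [0..<n]"
  have at: "sgn_at \<alpha> i = p i" if "i \<le> n" for i
    using that by (cases i) (auto simp: sgn_at_def \<alpha>_def p_def)
  have "p i \<noteq> p (Suc i) \<longleftrightarrow> i \<in> x" for i
  proof (cases "i \<in> x")
    case True
    then have "x \<inter> {..<Suc i} = insert i (x \<inter> {..<i})" by auto
    then show ?thesis using True by (simp add: p_def)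
  next
    case False
    then have "x \<inter> {..<Suc i} = x \<inter> {..<i}" by (auto simp: less_Suc_eq)
    then show ?thesis using False by (simp add: p_def)
  qed
  moreover have "sign_changes n \<alpha> = {i. i < n \<and> p i \<noteq> p (Suc i)}"
    by (auto simp: sign_changes_def at)
  ultimately have "sign_changes n \<alpha> = x" using assms by auto
  moreover have "\<alpha> \<in> signs n" by (auto simp: signs_def \<alpha>_def p_def)
  ultimately show ?thesis using that by blast
qed

lemma sgn_of_sign_changes: "\<alpha> \<in> signs n \<Longrightarrow> sgn_of n (sign_changes n \<alpha>) = \<alpha>"
  unfolding sgn_of_def sign_changes_def[of n, symmetric]
  by (rule the_equality) (auto intro: sign_changes_inj)

lemma
  assumes "x \<subseteq> {..<n}"
  shows sgn_of_signs: "sgn_of n x \<in> signs n" and sign_changes_sgn_of: "sign_changes n (sgn_of n x) = x"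
proof -
  obtain \<alpha> where "\<alpha> \<in> signs n" "sign_changes n \<alpha> = x" using sign_changes_surj[OF assms] .
  then show "sgn_of n x \<in> signs n" "sign_changes n (sgn_of n x) = x"
    using sgn_of_sign_changes[of \<alpha> n] by simp_all
qed

text \<open>Adjacent entries are negated together, which does not affect their comparison; only
  position 0 compares with a plus that stays. For \<open>n = 0\<close> that position does not
  exist.\<close>

lemma sign_changes_uminus:
  assumes \<alpha>: "\<alpha> \<in> signs n" and n: "0 < n"
  shows "sign_changes n (map uminus \<alpha>) = (if 0 \<in> sign_changes n \<alpha> then sign_changes n \<alpha> - {0} else insert 0 (sign_changes n \<alpha>))"
proof -
  show ?thesis
  proof (rule Set.set_eqI)
    fix i
    show "i \<in> sign_changes n (map uminus \<alpha>) \<longleftrightarrow>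
        i \<in> (if 0 \<in> sign_changes n \<alpha> then sign_changes n \<alpha> - {0} else insert 0 (sign_changes n \<alpha>))"
    proof (cases "i = 0")
      case True
      have "1 \<le> n" using n by simp
      then show ?thesis
        using sgn_at_uminus[OF \<alpha>, of 1] sgn_at_cases[OF \<alpha> \<open>1 \<le> n\<close>] True n
        by (elim disjE) (simp_all add: sign_changes_def)
    next
      case False
      then have "i \<in> sign_changes n (map uminus \<alpha>) \<longleftrightarrow> i \<in> sign_changes n \<alpha>"
        using sgn_at_uminus[OF \<alpha>, of i] sgn_at_uminus[OF \<alpha>, of "i + 1"] by (auto simp: sign_changes_def)
      then show ?thesis using False by simp
    qed
  qed
qed

lemma ring_iso_rng_hom: "h \<in> ring_iso R S \<Longrightarrow> h \<in> rng_hom R S"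
  by (auto simp: ring_iso_def intro: ring_hom_imp_rng_hom)

text \<open>The images of the \<open>I\<^sub>x\<close> sum to 1, and \<open>e\<^sub>\<alpha> \<noteq> 0\<close> for feasible \<open>\<alpha>\<close>.\<close>

lemma identification_PP:
  assumes id: "identification n k A \<Phi>"
  shows "PP n A \<subseteq> sgn_of n ` ksubsets {..<n} k"
proof
  fix \<alpha> assume \<alpha>: "\<alpha> \<in> PP n A"
  let ?K = "ksubsets {..<n} k"
  have \<Phi>: "\<Phi> \<in> ring_iso (Bl n k) (Btilde n A)"
    and PP: "\<And>x. x \<in> ?K \<Longrightarrow> sgn_of n x \<in> PP n A"
    and idem: "\<And>x. x \<in> ?K \<Longrightarrow> \<Phi> (pcls n k x []) = fcls n A 1 (sgn_of n x) (sgn_of n x)"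
    using id by (auto simp: identification_def)
  note hom = ring_iso_rng_hom[OF \<Phi>]
  let ?s = "\<lambda>x. Poly_Mapping.single (sgn_of n x, sgn_of n x) (1 :: zpoly)"
  have s: "?s x \<in> carrier (Bfree n A)" if "x \<in> ?K" for x using that PP by (intro single_in_Bfree) auto
  \<comment> \<open>Additivity is available for two summands at a time, so the image of the unit is
    built up vertex by vertex.\<close>
  have "qcls n k (\<Sum>x\<in>X. Poly_Mapping.single (x, []) 1) \<in> carrier (Bl n k) \<and>
      \<Phi> (qcls n k (\<Sum>x\<in>X. Poly_Mapping.single (x, []) 1)) = bcls n A (\<Sum>x\<in>X. ?s x)"
    if "finite X" "X \<subseteq> ?K" for X
    using that
  proof (induction X rule: finite_induct)
    case empty
    then show ?case
      using rng_hom_zero[OF ring_Bl ring_Btilde hom] ring.ring_simprules(2)[OF ring_Bl, of n k]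
      by (simp add: qcls_zero bcls_zero)
  next
    case (insert x X)
    let ?p = "Poly_Mapping.single (x, []) (1 :: int)" and ?P = "\<Sum>x\<in>X. Poly_Mapping.single (x, []) (1 :: int)"
    have "qcls n k (\<Sum>x\<in>insert x X. Poly_Mapping.single (x, []) 1) = pcls n k x [] \<oplus>\<^bsub>Bl n k\<^esub> qcls n k ?P"
      using insert left_idem_closed[of X n k] left_idem_closed[of "{x}" n k] by (simp add: pcls_qcls qcls_add)
    moreover have px: "pcls n k x [] \<in> carrier (Bl n k)"
      using insert by (intro pcls_in_Bl) (auto simp: corner_paths_def)
    moreover have "qcls n k ?P \<in> carrier (Bl n k)" "\<Phi> (qcls n k ?P) = bcls n A (\<Sum>x\<in>X. ?s x)"
      using insert by auto
    moreover have "\<Phi> (pcls n k x []) = bcls n A (?s x)"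
      using insert idem PP by (simp add: fcls_bcls fsym_def)
    moreover have "(\<Sum>x\<in>X. ?s x) \<in> carrier (Bfree n A)" using s insert by (intro Bfree_sum_closed) auto
    ultimately show ?case
      using insert s ring.ring_simprules(1)[OF ring_Bl, of "pcls n k x []" n k "qcls n k ?P"]
      by (simp add: rng_hom_add[OF hom] bcls_add del: Bl_simps)
  qed
  from this[OF finite_ksubsets subset_refl]
  have "\<Phi> \<one>\<^bsub>Bl n k\<^esub> = bcls n A (\<Sum>x\<in>?K. ?s x)" by (simp add: left_idem_qcls)
  moreover have "\<Phi> \<one>\<^bsub>Bl n k\<^esub> = \<one>\<^bsub>Btilde n A\<^esub>" using \<Phi> by (auto simp: ring_iso_def Ring.ring_hom_def)
  moreover have "\<one>\<^bsub>Btilde n A\<^esub> = bcls n A (\<Sum>\<alpha>\<in>PP n A. Poly_Mapping.single (\<alpha>, \<alpha>) 1)"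
    using ring_hom_one[OF bcls_hom, of n A] by simp
  ultimately have "(\<Sum>\<alpha>\<in>PP n A. Poly_Mapping.single (\<alpha>, \<alpha>) 1) - (\<Sum>x\<in>?K. ?s x) \<in> Bideal n A"
    using s PP by (subst bcls_eq_iff[symmetric]) (auto intro!: Bfree_sum_closed single_in_Bfree)
  \<comment> \<open>At \<open>(\<alpha>, \<alpha>)\<close> the unit of the arrangement algebra has
    coefficient 1, which is not in the ideal. Hence the sum over the vertices has a nonzero
    coefficient there, so some vertex yields \<alpha>.\<close>
  then have "Poly_Mapping.lookup ((\<Sum>\<alpha>\<in>PP n A. Poly_Mapping.single (\<alpha>, \<alpha>) 1) - (\<Sum>x\<in>?K. ?s x)) (\<alpha>, \<alpha>) \<in> Rideal n A \<alpha> \<alpha>"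
    by (simp only: Bideal_iff)
  moreover have "Poly_Mapping.lookup (\<Sum>\<alpha>\<in>PP n A. Poly_Mapping.single (\<alpha>, \<alpha>) (1 :: zpoly)) (\<alpha>, \<alpha>) = 1"
    using \<alpha> finite_PP[of n A] by (simp add: lookup_sum lookup_single when_def)
  moreover have "1 \<notin> Rideal n A \<alpha> \<alpha>" using \<alpha> by (intro one_notin_Rideal) (simp add: PP_def feasible_def)
  ultimately have "Poly_Mapping.lookup (\<Sum>x\<in>?K. ?s x) (\<alpha>, \<alpha>) \<noteq> 0" by (auto simp: lookup_minus)
  then have "(\<Sum>x\<in>?K. 1 when (sgn_of n x, sgn_of n x) = (\<alpha>, \<alpha>) :: zpoly) \<noteq> 0" by (simp add: lookup_sum lookup_single)
  then obtain x where "x \<in> ?K" "(1 when (sgn_of n x, sgn_of n x) = (\<alpha>, \<alpha>) :: zpoly) \<noteq> 0" by (meson sum.neutral)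
  then show "\<alpha> \<in> sgn_of n ` ?K" by (auto simp: when_def split: if_splits)
qed

text \<open>Supplies the oddness assumption of the negation maps, from linearity of the functional
  of \<open>Ahat\<close> with the scalar \<open>- 1\<close>.\<close>

lemma restriction_odd:
  assumes Ahat: "polarized_arrangement (Suc n) (Suc k) Ahat" and A': "A' = first_restriction n Ahat"
    and v: "v \<in> vspace A'"
  shows "- v \<in> vspace A' \<and> vfun A' (- v) = - vfun A' v"
proof -
  have v': "v \<in> Rn n" "vcons 0 v \<in> vspace Ahat" using v by (auto simp: A' first_restriction_def)
  have neg: "vcons 0 (- v) = - vcons 0 v" by (rule poly_mapping_eqI) (simp add: lookup_vcons)
  have "(- 1) *\<^sub>R vcons 0 v \<in> vspace Ahat" "vfun Ahat ((- 1) *\<^sub>R vcons 0 v) = - 1 * vfun Ahat (vcons 0 v)"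
    using Ahat v'(2) unfolding polarized_arrangement_def by (blast intro: subspace_scale)+
  moreover have "- v \<in> Rn n" using v'(1) by (auto simp: Rn_def in_keys_iff)
  ultimately show ?thesis using v' by (simp add: A' first_restriction_def neg)
qed

text \<open>No case distinction survives in the formula: if \<alpha> or \<beta> is lost at the
  deletion or at the restriction, its negative is outside \<open>PP n A''\<close> as well, and both
  sides are zero.\<close>

lemma deletion_restriction_fcls:
  fixes n k :: nat
  assumes Ahat: "polarized_arrangement (Suc n) (Suc k) Ahat" and A: "polarized_arrangement n (Suc k) A"
    and A_def: "A = first_deletion Ahat" and A': "A' = first_restriction n Ahat" and A'': "A'' = negate_arrangement A'"
    and p: "p \<in> carrier (Zu n)" and \<alpha>: "\<alpha> \<in> PP n A" "\<beta> \<in> PP n A"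
  shows "Neg_map n A'' (Rest_map n A' (Del_map n Ahat (fcls n A p \<alpha> \<beta>))) =
    fcls n A'' (poly_subst uvar (poly_subst (\<lambda>j. if j = 1 then 0 else uvar (j - 1)) (poly_subst (\<lambda>j. uvar (j + 1)) p)))
      (map uminus \<alpha>) (map uminus \<beta>)"
proof -
  note odd = restriction_odd[OF Ahat A']
  note Del_hom = Del_map_rng_hom[OF Ahat A A_def] and Rest_hom = Rest_map_rng_hom[OF A'] and Neg_hom = Neg_map_rng_hom[OF A'' odd]
  note zero = rng_hom_zero[OF ring_Btilde ring_Btilde]
  \<comment> \<open>A point of the restricted chamber is a point of the chamber of
    \<open>1 # \<gamma>\<close> on the first hyperplane. It provides feasibility in
    \<open>Ahat\<close>, and boundedness is inherited from the deletion.\<close>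
  have PP': "\<gamma> \<in> PP n A' \<Longrightarrow> 1 # \<gamma> \<in> PP (Suc n) Ahat" if "\<gamma> \<in> PP n A" for \<gamma>
    using Delta_restriction[OF A', of _ \<gamma>] by (intro PP_deletion[OF Ahat A A_def that]) (auto simp: PP_def feasible_def)
  have p': "poly_subst (\<lambda>j. uvar (j + 1)) p \<in> carrier (Zu (Suc n))"
    by (rule poly_subst_closed[OF _ p]) auto
  have p'': "poly_subst (\<lambda>j. if j = 1 then 0 else uvar (j - 1)) (poly_subst (\<lambda>j. uvar (j + 1)) p) \<in> carrier (Zu n)"
    by (rule poly_subst_closed[OF _ p']) auto
  have out: "map uminus \<gamma> \<notin> PP n A''" if "\<gamma> \<in> PP n A" "\<gamma> \<notin> PP n A'" for \<gamma>
    using that PP_negate_iff[OF A'' odd PP_signs] by blast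
  show ?thesis
  proof (cases "\<alpha> \<in> PP n A' \<and> \<beta> \<in> PP n A'")
    case True
    then show ?thesis
      using \<alpha> PP' p p' p''
      by (simp add: Del_map_fcls[OF Ahat A A_def] Rest_map_fcls[OF A'] Neg_map_fcls[OF A'' odd] del: One_nat_def)
  next
    case False
    \<comment> \<open>The class may vanish already in the algebra of \<open>Ahat\<close>, or only
      under the restriction.\<close>
    have "Rest_map n A' (Del_map n Ahat (fcls n A p \<alpha> \<beta>)) = \<zero>\<^bsub>Btilde n A'\<^esub>"
    proof (cases "1 # \<alpha> \<in> PP (Suc n) Ahat \<and> 1 # \<beta> \<in> PP (Suc n) Ahat")
      case True
      then show ?thesis using \<alpha> p p' False
        by (simp add: Del_map_fcls[OF Ahat A A_def] Rest_map_fcls[OF A'] fcls_outside del: One_nat_def)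
    next
      case False
      then show ?thesis using \<alpha> p zero[OF Rest_hom]
        by (simp add: Del_map_fcls[OF Ahat A A_def] fcls_outside del: One_nat_def)
    qed
    moreover have "map uminus \<alpha> \<notin> PP n A'' \<or> map uminus \<beta> \<notin> PP n A''" using False out \<alpha> by blast
    ultimately show ?thesis using zero[OF Neg_hom] by (simp add: fcls_outside)
  qed
qed

section \<open>The homomorphism of \<open>F\<^sub>k\<close>\<close>

text \<open>Existence in the definite description is witnessed by \<open>\<phi>\<close> itself, and
  uniqueness comes from generation. Off the carrier the value is fixed by extensionality, hence the
  \<open>restrict\<close>.\<close>

lemma F_map_eqI:
  assumes \<phi>: "\<phi> \<in> rng_hom (Bl n (k + 1)) (Bl n k)"
    and idem: "\<And>x. x \<in> ksubsets {..<n} (k + 1) \<Longrightarrow>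
      \<phi> (pcls n (k + 1) x []) = (if 0 \<in> x then pcls n k (x - {0}) [] else \<zero>\<^bsub>Bl n k\<^esub>)"
    and arr: "\<And>x a i. x \<in> ksubsets {..<n} (k + 1) \<Longrightarrow> a \<in> {ArrR i, ArrL i} \<Longrightarrow> is_arrow n a x \<Longrightarrow> target a x \<subseteq> {..<n} \<Longrightarrow>
      \<phi> (pcls n (k + 1) x [a]) = (if 0 \<in> x \<inter> target a x then pcls n k (x - {0}) [a] else \<zero>\<^bsub>Bl n k\<^esub>)"
    and loop: "\<And>x i. x \<in> ksubsets {..<n} (k + 1) \<Longrightarrow> i \<in> {1..n} \<Longrightarrow>
      \<phi> (pcls n (k + 1) x [LoopU i]) = (if 0 \<in> x then pcls n k (x - {0}) [LoopU i] else \<zero>\<^bsub>Bl n k\<^esub>)"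
  shows "F_map n k = restrict \<phi> (carrier (Bl n (k + 1)))"
  unfolding F_map_def
proof (rule the_equality)
  let ?C = "carrier (Bl n (k + 1))"
  have Bl1: "ring (Bl n (k + 1))" by (rule ring_Bl)
  \<comment> \<open>The generators must be known to lie in the carrier, since
    \<open>restrict\<close> forgets \<open>\<phi>\<close> elsewhere.\<close>
  have gens: "pcls n (k + 1) x [] \<in> ?C" "i \<in> {1..n} \<Longrightarrow> pcls n (k + 1) x [LoopU i] \<in> ?C"
    "is_arrow n a x \<Longrightarrow> target a x \<subseteq> {..<n} \<Longrightarrow> pcls n (k + 1) x [a] \<in> ?C"
    if x: "x \<in> ksubsets {..<n} (k + 1)" for x i a
  proof -
    show "pcls n (k + 1) x [] \<in> ?C" "i \<in> {1..n} \<Longrightarrow> pcls n (k + 1) x [LoopU i] \<in> ?C"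
      using x by (auto intro!: pcls_in_Bl simp: corner_paths_def)
    assume a: "is_arrow n a x" "target a x \<subseteq> {..<n}"
    then have "target a x \<in> ksubsets {..<n} (k + 1)"
      using fold_target_closed[of n x "[a]" "k + 1"] ksubsets_subset[OF x] by (auto simp: ksubsets_def)
    then show "pcls n (k + 1) x [a] \<in> ?C" using a x by (intro pcls_in_Bl) (auto simp: corner_paths_def)
  qed
  have "restrict \<phi> ?C \<in> rng_hom (Bl n (k + 1)) (Bl n k)"
    using \<phi> ring.ring_simprules(1,5)[OF Bl1] by (auto simp: rng_hom_def Pi_def simp del: Bl_simps)
  then show "restrict \<phi> ?C \<in> rng_hom (Bl n (k + 1)) (Bl n k) \<inter> extensional ?C \<and>
     (\<forall>x\<in>ksubsets {..<n} (k + 1).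
        restrict \<phi> ?C (pcls n (k + 1) x []) = (if 0 \<in> x then pcls n k (x - {0}) [] else \<zero>\<^bsub>Bl n k\<^esub>)) \<and>
     (\<forall>x\<in>ksubsets {..<n} (k + 1). \<forall>i. \<forall>a\<in>{ArrR i, ArrL i}. is_arrow n a x \<and> target a x \<subseteq> {..<n} \<longrightarrow>
        restrict \<phi> ?C (pcls n (k + 1) x [a]) =
          (if 0 \<in> x \<inter> target a x then pcls n k (x - {0}) [a] else \<zero>\<^bsub>Bl n k\<^esub>)) \<and>
     (\<forall>x\<in>ksubsets {..<n} (k + 1). \<forall>i\<in>{1..n}.
        restrict \<phi> ?C (pcls n (k + 1) x [LoopU i]) = (if 0 \<in> x then pcls n k (x - {0}) [LoopU i] else \<zero>\<^bsub>Bl n k\<^esub>))"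
    using idem arr loop gens by (simp del: Bl_simps is_arrow_simps target.simps is_arrow.simps add: restrict_apply')
  fix \<psi>
  assume \<psi>: "\<psi> \<in> rng_hom (Bl n (k + 1)) (Bl n k) \<inter> extensional ?C \<and>
     (\<forall>x\<in>ksubsets {..<n} (k + 1).
        \<psi> (pcls n (k + 1) x []) = (if 0 \<in> x then pcls n k (x - {0}) [] else \<zero>\<^bsub>Bl n k\<^esub>)) \<and>
     (\<forall>x\<in>ksubsets {..<n} (k + 1). \<forall>i. \<forall>a\<in>{ArrR i, ArrL i}. is_arrow n a x \<and> target a x \<subseteq> {..<n} \<longrightarrow>
        \<psi> (pcls n (k + 1) x [a]) =
          (if 0 \<in> x \<inter> target a x then pcls n k (x - {0}) [a] else \<zero>\<^bsub>Bl n k\<^esub>)) \<and>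
     (\<forall>x\<in>ksubsets {..<n} (k + 1). \<forall>i\<in>{1..n}.
        \<psi> (pcls n (k + 1) x [LoopU i]) = (if 0 \<in> x then pcls n k (x - {0}) [LoopU i] else \<zero>\<^bsub>Bl n k\<^esub>))"
  then have hom: "\<psi> \<in> rng_hom (Bl n (k + 1)) (Bl n k)" by blast
  have "\<psi> X = \<phi> X" if "X \<in> ?C" for X
  proof (rule rng_hom_Bl_eqI[OF ring_Bl hom \<phi> _ _ _ that])
    show "\<psi> (pcls n (k + 1) x []) = \<phi> (pcls n (k + 1) x [])" if "x \<in> ksubsets {..<n} (k + 1)" for x
      using \<psi> that idem[OF that] by metis
    show "\<psi> (pcls n (k + 1) x [a]) = \<phi> (pcls n (k + 1) x [a])"
      if "x \<in> ksubsets {..<n} (k + 1)" "a \<in> {ArrR i, ArrL i}" "is_arrow n a x" "target a x \<subseteq> {..<n}" for x a i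
      using \<psi> that arr[OF that] by metis
    show "\<psi> (pcls n (k + 1) x [LoopU i]) = \<phi> (pcls n (k + 1) x [LoopU i])"
      if "x \<in> ksubsets {..<n} (k + 1)" "i \<in> {1..n}" for x i
      using \<psi> that loop[OF that] by metis
  qed
  then show "\<psi> = restrict \<phi> ?C" using \<psi> by (intro extensionalityI[of _ ?C]) auto
qed

theorem proposition5p8:
  fixes n k :: nat and A Ahat A' A'' :: arrangement
    and \<Phi> \<Phi>hat \<Phi>'' :: "(qpath \<Rightarrow>\<^sub>0 int) set \<Rightarrow> fmod set"
  assumes "left_cyclic n (k + 1) A"
    and "left_cyclic (n + 1) (k + 1) Ahat"
    and "first_deletion Ahat = A"
    and "A' = first_restriction n Ahat"
    and "A'' = negate_arrangement A'"
    and "identification n (k + 1) A \<Phi>"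
    and "identification (n + 1) (k + 1) Ahat \<Phi>hat"
    and "identification n k A'' \<Phi>''"
  shows "bimodule_isomorphic (Bl n k) (Bl n (k + 1))
    (FF n k)
    (tensor_bimodule (Bl (n + 1) (k + 1))
      (pullback_bimodule \<Phi>'' \<Phi>hat (Rest1 n Ahat))
      (pullback_bimodule \<Phi>hat \<Phi> (Del1 n A Ahat)))"
proof -
  define \<delta> where "\<delta> = Del_map n Ahat"
  define \<rho> where "\<rho> = Neg_map n A'' \<circ> Rest_map n A'"
  have \<Phi>: "\<Phi> \<in> ring_iso (Bl n (k + 1)) (Btilde n A)"
    and \<Phi>hat: "\<Phi>hat \<in> ring_iso (Bl (n + 1) (k + 1)) (Btilde (n + 1) Ahat)"
    and \<Phi>'': "\<Phi>'' \<in> ring_iso (Bl n k) (Btilde n A'')"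
    using assms(6-8) by (auto simp: identification_def)
  note pol = assms(1,2)[unfolded left_cyclic_def, THEN conjunct1, unfolded Suc_eq_plus1[symmetric]]
  have \<delta>: "\<delta> \<in> rng_hom (Btilde n A) (Btilde (n + 1) Ahat)"
    using Del_map_rng_hom[OF pol(2,1) assms(3)[symmetric]] by (simp add: \<delta>_def)
  have \<rho>: "\<rho> \<in> rng_hom (Btilde (n + 1) Ahat) (Btilde n A'')"
    using rng_hom_comp[OF Rest_map_rng_hom[OF assms(4)] Neg_map_rng_hom[OF assms(5) restriction_odd[OF pol(2) assms(4)]]]
    by (simp add: \<rho>_def)
  have \<rho>\<delta>: "\<rho> (\<delta> (fcls n A p \<alpha> \<beta>)) = fcls n A'' p (map uminus \<alpha>) (map uminus \<beta>)"
    if "\<alpha> \<in> PP n A" "\<beta> \<in> PP n A" "p = 1 \<or> (\<exists>i\<in>{1..n}. p = uvar i)" for \<alpha> \<beta> p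
  proof -
    have p: "p \<in> carrier (Zu n)" using that(3) by auto
    \<comment> \<open>The shift up avoids the variable that the restriction kills, and the shift
      down undoes it.\<close>
    have "poly_subst uvar (poly_subst (\<lambda>j. if j = 1 then 0 else uvar (j - 1)) (poly_subst (\<lambda>j. uvar (j + 1)) p)) = p"
      using that(3) by auto
    then show ?thesis
      using deletion_restriction_fcls[OF pol(2,1) assms(3)[symmetric] assms(4,5) p that(1,2)]
      by (simp only: \<rho>_def \<delta>_def o_apply)
  qed
  define \<Psi> where "\<Psi> = inv_into (carrier (Bl n k)) \<Phi>''"
  have \<Psi>_iso: "\<Psi> \<in> ring_iso (Btilde n A'') (Bl n k)"
    unfolding \<Psi>_def by (rule ring_iso_set_sym[OF ring_Bl \<Phi>''])
  note \<Psi>_hom = ring_iso_rng_hom[OF \<Psi>_iso]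
  have bij: "bij_betw \<Phi>'' (carrier (Bl n k)) (carrier (Btilde n A''))" using \<Phi>'' by (simp add: ring_iso_def)
  have \<Psi>\<Phi>: "\<Psi> (\<Phi>'' X) = X" if "X \<in> carrier (Bl n k)" for X
    unfolding \<Psi>_def using bij that by (rule bij_betw_inv_into_left)
  have \<Phi>\<Psi>: "\<Phi>'' (\<Psi> Y) = Y" if "Y \<in> carrier (Btilde n A'')" for Y
    unfolding \<Psi>_def using bij that by (rule bij_betw_inv_into_right)
  have \<Psi>0: "\<Psi> \<zero>\<^bsub>Btilde n A''\<^esub> = \<zero>\<^bsub>Bl n k\<^esub>" by (rule rng_hom_zero[OF ring_Btilde ring_Bl \<Psi>_hom])
  \<comment> \<open>The candidate for \<open>F_map\<close>: routed through the arrangement algebras,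
    it is a homomorphism by construction, whatever the quiver relations are.\<close>
  define \<phi> where "\<phi> = \<Psi> \<circ> (\<rho> \<circ> (\<delta> \<circ> \<Phi>))"
  have \<phi>: "\<phi> \<in> rng_hom (Bl n (k + 1)) (Bl n k)"
    unfolding \<phi>_def by (intro rng_hom_comp[OF _ \<Psi>_hom] rng_hom_comp[OF _ \<rho>] rng_hom_comp[OF _ \<delta>] ring_iso_rng_hom \<Phi>)
  note id = assms(6)[unfolded identification_def] and id'' = assms(8)[unfolded identification_def]
  have PP: "sgn_of n x \<in> PP n A" if "x \<in> ksubsets {..<n} (k + 1)" for x using id that by blast
  have neg_in: "map uminus (sgn_of n x) = sgn_of n (x - {0}) \<and> x - {0} \<in> ksubsets {..<n} k"
    if x: "x \<in> ksubsets {..<n} (k + 1)" "0 \<in> x" for x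
  proof -
    have sub: "x \<subseteq> {..<n}" and n: "0 < n" and fin: "finite x" using x by (auto simp: ksubsets_def intro: finite_subset)
    have "sign_changes n (map uminus (sgn_of n x)) = x - {0}"
      using sign_changes_uminus[OF sgn_of_signs[OF sub] n] x(2) by (simp add: sign_changes_sgn_of[OF sub])
    then have "sgn_of n (x - {0}) = map uminus (sgn_of n x)"
      using sgn_of_sign_changes[OF uminus_signs[OF sgn_of_signs[OF sub]]] by simp
    moreover have "x - {0} \<in> ksubsets {..<n} k" using x fin by (auto simp: ksubsets_def)
    ultimately show ?thesis by simp
  qed
  \<comment> \<open>If \<open>0 \<notin> x\<close>, negation adds a change at 0 and makes
    \<open>k + 2\<close> of them, whereas the vectors in \<open>PP n A''\<close> have
    \<open>k\<close>.\<close>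
  have neg_out: "map uminus (sgn_of n x) \<notin> PP n A''" if x: "x \<in> ksubsets {..<n} (k + 1)" "0 \<notin> x" for x
  proof
    assume "map uminus (sgn_of n x) \<in> PP n A''"
    then obtain y where y: "y \<in> ksubsets {..<n} k" "map uminus (sgn_of n x) = sgn_of n y"
      using identification_PP[OF assms(8)] by blast
    have sub: "x \<subseteq> {..<n}" "y \<subseteq> {..<n}" and fin: "finite x" using x y by (auto simp: ksubsets_def intro: finite_subset)
    have "x \<noteq> {}" using x by (auto simp: ksubsets_def)
    then have n: "0 < n" using sub by auto
    have "sign_changes n (map uminus (sgn_of n x)) = insert 0 x"
      using sign_changes_uminus[OF sgn_of_signs[OF sub(1)] n] x(2) by (simp add: sign_changes_sgn_of[OF sub(1)])
    then have "y = insert 0 x" using sign_changes_sgn_of[OF sub(2)] y(2) by simp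
    then show False using x y fin by (simp add: ksubsets_def)
  qed
  \<comment> \<open>Vertices and loops are the case \<open>y = x\<close>, with \<open>p\<close>
    equal to 1 or to a variable; for arrows \<open>y\<close> is the target and
    \<open>p = 1\<close>.\<close>
  have \<phi>_fcls: "\<phi> X = (if Q then pcls n k (x - {0}) w else \<zero>\<^bsub>Bl n k\<^esub>)"
    if x: "x \<in> ksubsets {..<n} (k + 1)" "y \<in> ksubsets {..<n} (k + 1)" and Q: "Q \<longleftrightarrow> 0 \<in> x \<and> 0 \<in> y"
      and X: "\<Phi> X = fcls n A p (sgn_of n x) (sgn_of n y)" and p: "p = 1 \<or> (\<exists>i\<in>{1..n}. p = uvar i)"
      and w: "Q \<Longrightarrow> (x - {0}, w) \<in> corner_paths n k \<and>
        \<Phi>'' (pcls n k (x - {0}) w) = fcls n A'' p (sgn_of n (x - {0})) (sgn_of n (y - {0}))"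
    for X Q x y p w
  proof (cases Q)
    case True
    then have "\<phi> X = \<Psi> (\<Phi>'' (pcls n k (x - {0}) w))"
      using w Q neg_in x \<rho>\<delta>[OF PP[OF x(1)] PP[OF x(2)] p] X by (simp add: \<phi>_def)
    also have "\<dots> = pcls n k (x - {0}) w" using True w by (intro \<Psi>\<Phi> pcls_in_Bl) blast
    finally show ?thesis using True by simp
  next
    case False
    then have "\<rho> (\<delta> (\<Phi> X)) = \<zero>\<^bsub>Btilde n A''\<^esub>"
      using \<rho>\<delta>[OF PP[OF x(1)] PP[OF x(2)] p] X Q neg_out x fcls_outside by metis
    then show ?thesis using False \<Psi>0 by (simp add: \<phi>_def)
  qed
  have F_map: "F_map n k = restrict \<phi> (carrier (Bl n (k + 1)))"
  proof (rule F_map_eqI[OF \<phi>])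
    fix x assume x: "x \<in> ksubsets {..<n} (k + 1)"
    show "\<phi> (pcls n (k + 1) x []) = (if 0 \<in> x then pcls n k (x - {0}) [] else \<zero>\<^bsub>Bl n k\<^esub>)"
      using x id id'' neg_in[OF x]
      by (intro \<phi>_fcls[of x x _ _ 1]) (auto simp: corner_paths_def)
    show "\<phi> (pcls n (k + 1) x [LoopU i]) = (if 0 \<in> x then pcls n k (x - {0}) [LoopU i] else \<zero>\<^bsub>Bl n k\<^esub>)"
      if "i \<in> {1..n}" for i
      using x id id'' neg_in[OF x] that
      by (intro \<phi>_fcls[of x x _ _ "uvar i"]) (auto simp: corner_paths_def)
    fix a i assume a: "a \<in> {ArrR i, ArrL i}" "is_arrow n a x" "target a x \<subseteq> {..<n}"
    have y: "target a x \<in> ksubsets {..<n} (k + 1)"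
      using a fold_target_closed[of n x "[a]" "k + 1"] ksubsets_subset[OF x] by (auto simp: ksubsets_def)
    show "\<phi> (pcls n (k + 1) x [a]) = (if 0 \<in> x \<inter> target a x then pcls n k (x - {0}) [a] else \<zero>\<^bsub>Bl n k\<^esub>)"
    proof (rule \<phi>_fcls[of x "target a x" _ _ 1])
      show "\<Phi> (pcls n (k + 1) x [a]) = fcls n A 1 (sgn_of n x) (sgn_of n (target a x))"
        using id x a by blast
      assume Q: "0 \<in> x \<inter> target a x"
      \<comment> \<open>As 0 belongs to both ends, the arrow does not move it: its index is at least
        2, and it remains an arrow once 0 is removed.\<close>
      have arrow: "is_arrow n a (x - {0})" and t: "target a (x - {0}) = target a x - {0}"
        using a Q by (auto split: if_splits)
      have x': "x - {0} \<in> ksubsets {..<n} k" and y': "target a x - {0} \<in> ksubsets {..<n} k"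
        using neg_in[OF x] neg_in[OF y] Q by auto
      have "\<Phi>'' (pcls n k (x - {0}) [a]) = fcls n A'' 1 (sgn_of n (x - {0})) (sgn_of n (target a (x - {0})))"
        using id'' x' a(1) arrow y' unfolding t[symmetric] ksubsets_def by blast
      then show "(x - {0}, [a]) \<in> corner_paths n k \<and>
          \<Phi>'' (pcls n k (x - {0}) [a]) = fcls n A'' 1 (sgn_of n (x - {0})) (sgn_of n (target a x - {0}))"
        using x' y' arrow by (simp add: t corner_paths_def)
    qed (use x y in auto)
  qed
  have F: "F_map n k a \<in> carrier (Bl n k)" "\<Phi>'' (F_map n k a) = \<rho> (\<delta> (\<Phi> a))"
    if a: "a \<in> carrier (Bl n (k + 1))" for a
  proof -
    show "F_map n k a \<in> carrier (Bl n k)" using a rng_hom_closed[OF \<phi> a] by (simp add: F_map)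
    have "\<rho> (\<delta> (\<Phi> a)) \<in> carrier (Btilde n A'')"
      using a by (intro rng_hom_closed[OF \<rho>] rng_hom_closed[OF \<delta>] rng_hom_closed[OF ring_iso_rng_hom[OF \<Phi>]])
    then show "\<Phi>'' (F_map n k a) = \<rho> (\<delta> (\<Phi> a))" using a \<Phi>\<Psi> by (simp add: F_map \<phi>_def)
  qed
  show ?thesis
    unfolding FF_def Rest1_def Del1_def Let_def assms(4)[symmetric] assms(5)[symmetric]
      \<delta>_def[symmetric] \<rho>_def[symmetric]
    by (rule bimodule_isomorphic_tensor_hom_bimodules[OF ring_Btilde ring_Btilde ring_Btilde ring_Bl ring_Bl
        \<delta> \<rho> \<Phi> \<Phi>hat \<Phi>'' F])
qed

end
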